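(* For every $d\in\mathbb{N}$ and every $\zeta>0$ there exists $n_0=n_0(d,\zeta)$ such that the following holds. Let $n>n_0$, let $k$ be an integer with $\zeta n\le k\le\left(\frac{d}{d+1}-\zeta\right)n$, and let $\mathcal{F}\subseteq\binom{[n]}{k}$ be a family that does not contain a $\left(d,k,\left(\frac{d+1}{d}+\zeta\right)k\right)$-cluster. Then $|\mathcal{F}|\le\binom{n-1}{k-1}$, with equality if and only if $\mathcal{F}$ is a star.
   Context: $[n]=\{1,\dots,n\}$ and $\binom{[n]}{k}$ denotes the family of all $k$-element subsets of $[n]$. For real $s$, a family $\{A_0,\dots,A_d\}\subseteq\binom{[n]}{k}$ is called a $(d,k,s)$-cluster if $|A_0\cup\cdots\cup A_d|\le s$ and $A_0\cap\cdots\cap A_d=\varnothing$. A family $\mathcal{F}$ "contains" such a cluster if all of $A_0,\dots,A_d$ belong to $\mathcal{F}$. A star is a family of the form $\{A\in\binom{[n]}{k}: i\in A\}$ for some fixed $i\in[n]$. *)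

theory Defs
  imports Main Complex_Main
begin

definition ksubsets :: "nat \<Rightarrow> nat \<Rightarrow> nat set set" where
  "ksubsets n k = {A. A \<subseteq> {1..n} \<and> card A = k}"

definition contains_cluster :: "nat set set \<Rightarrow> nat \<Rightarrow> real \<Rightarrow> bool" where
  "contains_cluster F d s \<longleftrightarrow>
     (\<exists>A :: nat \<Rightarrow> nat set. (\<forall>i\<le>d. A i \<in> F) \<and>
        real (card (\<Union>i\<le>d. A i)) \<le> s \<and> (\<Inter>i\<le>d. A i) = {})"

definition star :: "nat \<Rightarrow> nat \<Rightarrow> nat \<Rightarrow> nat set set" where
  "star n k i = {A \<in> ksubsets n k. i \<in> A}"

definition is_star :: "nat \<Rightarrow> nat \<Rightarrow> nat set set \<Rightarrow> bool" where
  "is_star n k F \<longleftrightarrow> (\<exists>i\<in>{1..n}. F = star n k i)"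

end

theory Submission
  imports Defs "HOL-Analysis.Convex" "HOL-Library.FuncSet" "HOL-Combinatorics.Permutations"
begin

text \<open>
  Let \<open>\<alpha> = k/n\<close>, let \<open>F\<close> be cluster-free with \<open>|F| \<ge> (n-1 choose k-1)\<close>, and let \<open>G\<close> be its
  up-closure. The biased measure of \<open>G\<close> has bounded derivative at some \<open>p\<close> slightly above \<open>\<alpha>\<close>, so a
  Friedgut-type argument shows that \<open>G\<close> is close to a junta \<open>U\<close> on boundedly many coordinates \<open>J\<close>.
  Members of \<open>U\<close> have fibres of measure nearly 1, so random sets outside \<open>J\<close> complete any
  \<open>d+1\<close> members of \<open>U\<close> with empty intersection to a cluster in \<open>F\<close> of small union; hence \<open>U\<close> is
  \<open>(d+1)\<close>-wise intersecting and has measure at most \<open>c = d/(d+1)\<close> at bias \<open>c\<close>. If no coordinate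
  had influence near 1 on \<open>[p, c]\<close>, a sharpened Poincare inequality would make the log-odds of the
  measure of \<open>U\<close> grow strictly faster than those of the bias, a contradiction as the measure at
  \<open>p\<close> is almost \<open>p\<close>. So \<open>F\<close> is almost contained in a star with some centre \<open>i\<close>.

  Finally let \<open>H\<close> be the members of \<open>F\<close> missing \<open>i\<close> and \<open>M\<close> the \<open>(k-1)\<close>-sets \<open>B\<close> avoiding \<open>i\<close> with
  \<open>B \<union> {i} \<notin> F\<close>, so \<open>|M| \<le> |H|\<close>. Whenever \<open>d\<close> sets \<open>B\<close> would form a cluster with a given
  member of \<open>H\<close>, one of them lies in \<open>M\<close>. Thus correlated random pairs hit \<open>H \<times> M\<close> with
  probability at least a constant times the density of \<open>H\<close>, which contradicts small-set expansion
  (hypercontractivity) unless \<open>H\<close> is empty.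
\<close>

subsection \<open>The biased cube\<close>

text \<open>The theorem lives on a slice, the tools on product measures. The bridge is a bias
  slightly above \<open>k / n\<close>: a random set then has at least \<open>k\<close> elements with
  high probability, and by symmetry the mean density of a family of \<open>k\<close>-sets inside it
  is almost its density in the slice. The constant (d+1)/d stems from a way to choose d+1 random
  sets of bias p without a common point: from each element of a random set of bias p(d+1)/d exactly
  one of them is withheld. This requires p \<le> c. The gap \<zeta> below c leaves an interval of
  biases on which log-odds can be compared, and the slack \<zeta>k in the size of the union absorbs
  \<open>J\<close>, whose size is bounded independently of n. Closeness to a star does not exclude a
  sparse set of exceptions; what excludes it is a power gain: the density of \<open>H\<close> is at
  most a constant times the r-th power of the density of \<open>M\<close> with r > 1. This gain and
  the Friedgut-type step rest on the same two-point inequality.\<close>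

text \<open>Expectation over a random subset of bias \<open>p\<close>, written as a finite sum: it
  is a polynomial in \<open>p\<close>, to be differentiated in \<open>russo_bexp\<close>, and splits
  coordinate by coordinate.\<close>

definition bexp :: "real \<Rightarrow> 'a set \<Rightarrow> ('a set \<Rightarrow> real) \<Rightarrow> real" where
  "bexp p N f = (\<Sum>A\<in>Pow N. p ^ card A * (1 - p) ^ card (N - A) * f A)"

lemma bexp_empty [simp]: "bexp p {} f = f {}"
  by (simp add: bexp_def)

lemma bexp_insert:
  assumes "finite N" "i \<notin> N"
  shows "bexp p (insert i N) f = p * bexp p N (\<lambda>A. f (insert i A)) + (1 - p) * bexp p N f"
proof -
  let ?g = "\<lambda>A. p ^ card A * (1 - p) ^ card (insert i N - A) * f A"
  have "bexp p (insert i N) f = sum ?g (Pow N) + sum ?g (insert i ` Pow N)"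
    unfolding bexp_def Pow_insert using assms by (intro sum.union_disjoint) auto
  also have "sum ?g (insert i ` Pow N) = (\<Sum>A\<in>Pow N. ?g (insert i A))"
    using assms by (intro sum.reindex_cong[of "insert i"]) (auto simp: inj_on_def)
  also have "\<dots> = (\<Sum>A\<in>Pow N. p * (p ^ card A * (1 - p) ^ card (N - A) * f (insert i A)))"
  proof (rule sum.cong[OF refl])
    fix A assume "A \<in> Pow N"
    then have "insert i N - insert i A = N - A" "card (insert i A) = Suc (card A)"
      using assms by (auto intro!: card_insert_disjoint intro: finite_subset)
    then show "?g (insert i A) = p * (p ^ card A * (1 - p) ^ card (N - A) * f (insert i A))"
      by simp
  qed
  also have "sum ?g (Pow N) = (\<Sum>A\<in>Pow N. (1 - p) * (p ^ card A * (1 - p) ^ card (N - A) * f A))"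
  proof (rule sum.cong[OF refl])
    fix A assume "A \<in> Pow N"
    then have "insert i N - A = insert i (N - A)" "i \<notin> N - A" "finite (N - A)"
      using assms by auto
    then show "?g A = (1 - p) * (p ^ card A * (1 - p) ^ card (N - A) * f A)"
      by simp
  qed
  finally show ?thesis
    by (simp add: bexp_def sum_distrib_left)
qed

lemma bexp_cong:
  "(\<And>A. A \<subseteq> N \<Longrightarrow> f A = g A) \<Longrightarrow> bexp p N f = bexp p N g"
  by (simp add: bexp_def)

lemma bexp_mono:
  assumes "0 \<le> p" "p \<le> 1" "\<And>A. A \<subseteq> N \<Longrightarrow> f A \<le> g A"
  shows "bexp p N f \<le> bexp p N g"
  unfolding bexp_def using assms by (intro sum_mono mult_left_mono) auto

lemma bexp_add: "bexp p N (\<lambda>A. f A + g A) = bexp p N f + bexp p N g"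
  by (simp add: bexp_def sum.distrib algebra_simps)

lemma bexp_diff: "bexp p N (\<lambda>A. f A - g A) = bexp p N f - bexp p N g"
  by (simp add: bexp_def sum_subtractf algebra_simps)

lemma bexp_cmult: "bexp p N (\<lambda>A. c * f A) = c * bexp p N f"
  by (simp add: bexp_def sum_distrib_left algebra_simps)

lemma bexp_sum: "bexp p N (\<lambda>A. \<Sum>t\<in>T. f t A) = (\<Sum>t\<in>T. bexp p N (f t))"
  unfolding bexp_def by (simp add: sum_distrib_left) (rule sum.swap)

lemma bexp_const [simp]: "finite N \<Longrightarrow> bexp p N (\<lambda>A. c) = c"
  by (induction N rule: finite_induct) (auto simp: bexp_insert algebra_simps)

lemma bexp_nonneg: "0 \<le> p \<Longrightarrow> p \<le> 1 \<Longrightarrow> (\<And>A. A \<subseteq> N \<Longrightarrow> 0 \<le> f A) \<Longrightarrow> 0 \<le> bexp p N f"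
  unfolding bexp_def by (intro sum_nonneg mult_nonneg_nonneg) auto

lemma bexp_le_1:
  "0 \<le> p \<Longrightarrow> p \<le> 1 \<Longrightarrow> finite N \<Longrightarrow> (\<And>A. A \<subseteq> N \<Longrightarrow> f A \<le> 1) \<Longrightarrow> bexp p N f \<le> 1"
  using bexp_mono[of p N f "\<lambda>_. 1"] by simp

lemma bexp_union:
  assumes "finite K" "finite J" "J \<inter> K = {}"
  shows "bexp p (J \<union> K) f = bexp p J (\<lambda>B. bexp p K (\<lambda>C. f (B \<union> C)))"
  using assms
proof (induction K arbitrary: f rule: finite_induct)
  case (insert i K)
  have "bexp p (J \<union> insert i K) f = bexp p (insert i (J \<union> K)) f"
    by simp
  also have "\<dots> = p * bexp p (J \<union> K) (\<lambda>A. f (insert i A)) + (1 - p) * bexp p (J \<union> K) f"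
    using insert by (intro bexp_insert) auto
  also have "\<dots> = bexp p J (\<lambda>B. bexp p (insert i K) (\<lambda>C. f (B \<union> C)))"
    using insert by (simp add: bexp_insert bexp_add bexp_cmult)
  finally show ?case .
qed simp

section \<open>Discrete derivatives and energy\<close>

definition dif :: "'a \<Rightarrow> ('a set \<Rightarrow> real) \<Rightarrow> 'a set \<Rightarrow> real" where
  "dif j f A = f (insert j A) - f (A - {j})"

text \<open>Without the usual factor \<open>p * (1 - p)\<close>, so that for up-sets it is the total
  influence, hence the derivative of the measure in \<open>p\<close>.\<close>

definition energy :: "real \<Rightarrow> 'a set \<Rightarrow> ('a set \<Rightarrow> real) \<Rightarrow> real" where
  "energy p N f = (\<Sum>j\<in>N. bexp p N (\<lambda>A. (dif j f A)\<^sup>2))"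

lemma dif_insert: "i \<noteq> j \<Longrightarrow> dif j f (insert i A) = dif j (\<lambda>B. f (insert i B)) A"
  by (simp add: dif_def insert_commute insert_Diff_if)

text \<open>\<open>F\<close> is the identity for influences and the square for energies.\<close>

lemma bexp_dif_self:
  assumes "finite N" "i \<notin> N"
  shows "bexp p (insert i N) (\<lambda>A. F (dif i f A)) = bexp p N (\<lambda>A. F (f (insert i A) - f A))"
proof -
  have "A - {i} = A" if "A \<subseteq> N" for A
    using assms(2) that by auto
  then have "bexp p N (\<lambda>A. F (dif i f (insert i A))) = bexp p N (\<lambda>A. F (f (insert i A) - f A))"
       "bexp p N (\<lambda>A. F (dif i f A)) = bexp p N (\<lambda>A. F (f (insert i A) - f A))"
    by (auto intro!: bexp_cong simp: dif_def)
  then show ?thesis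
    using assms by (simp add: bexp_insert algebra_simps)
qed

lemma bexp_dif_other:
  assumes "finite N" "i \<notin> N" "i \<noteq> j"
  shows "bexp p (insert i N) (\<lambda>A. F (dif j f A)) =
    p * bexp p N (\<lambda>A. F (dif j (\<lambda>B. f (insert i B)) A)) + (1 - p) * bexp p N (\<lambda>A. F (dif j f A))"
  using assms by (simp add: bexp_insert dif_insert)

lemma energy_insert:
  assumes "finite N" "i \<notin> N"
  shows "energy p (insert i N) f = bexp p N (\<lambda>A. (f (insert i A) - f A)\<^sup>2)
    + p * energy p N (\<lambda>A. f (insert i A)) + (1 - p) * energy p N f"
proof -
  have "(\<Sum>j\<in>N. bexp p (insert i N) (\<lambda>A. (dif j f A)\<^sup>2)) =
    (\<Sum>j\<in>N. p * bexp p N (\<lambda>A. (dif j (\<lambda>B. f (insert i B)) A)\<^sup>2) + (1 - p) * bexp p N (\<lambda>A. (dif j f A)\<^sup>2))"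
    using assms by (intro sum.cong bexp_dif_other[where F = "\<lambda>x. x\<^sup>2"]) auto
  then show ?thesis
    using assms bexp_dif_self[OF assms, of p "\<lambda>x. x\<^sup>2" f]
    by (simp add: energy_def sum.distrib sum_distrib_left)
qed

lemma energy_nonneg: "0 \<le> p \<Longrightarrow> p \<le> 1 \<Longrightarrow> 0 \<le> energy p N f"
  unfolding energy_def by (intro sum_nonneg bexp_nonneg) auto

section \<open>The two-point inequality\<close>

text \<open>Weighted AM-GM for \<open>x powr r = x powr (2 - r) * (x\<^sup>2) powr (r - 1)\<close>.
  The weight \<open>r - 1\<close> of the square is the source of the small factor in all later error
  terms.\<close>

lemma powr_le_interpolation:
  fixes x r :: real
  assumes "x \<ge> 0" "1 \<le> r" "r \<le> 2"
  shows "x powr r \<le> (2 - r) * x + (r - 1) * x\<^sup>2"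
proof (cases "x = 0")
  case False
  then have "x powr (2 - r) * (x\<^sup>2) powr (r - 1) \<le> (2 - r) * x + (r - 1) * x\<^sup>2"
    using assms by (intro Youngs_inequality_0) auto
  moreover have "(x\<^sup>2) powr (r - 1) = x powr (2 * (r - 1))"
    using assms False by (simp add: powr_powr flip: powr_numeral)
  moreover have "x powr (2 - r) * x powr (2 * (r - 1)) = x powr r"
    using assms False by (simp flip: powr_add)
  ultimately show ?thesis
    by simp
qed simp

text \<open>The tangent of a concave power at \<open>x\<close> lies above its graph; after division
  by \<open>x powr s\<close> this is weighted AM-GM for \<open>y / x\<close> and 1.\<close>

lemma powr_concave_tangent:
  fixes x y s :: real
  assumes "0 \<le> y" "y \<le> x" "0 < x" "0 < s" "s \<le> 1"
  shows "s * x powr (s - 1) * (x - y) \<le> x powr s - y powr s"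
proof -
  have "(y / x) powr s \<le> s * (y / x) + (1 - s)"
  proof (cases "y = 0")
    case False
    then show ?thesis
      using Youngs_inequality_0[of s "1 - s" "y / x" 1] assms by simp
  qed (use assms in auto)
  then have "(y / x) powr s * x powr s \<le> (s * (y / x) + (1 - s)) * x powr s"
    by (intro mult_right_mono) auto
  moreover have "(y / x) powr s * x powr s = y powr s"
    using assms by (simp flip: powr_mult)
  moreover have "s * x powr (s - 1) * (x - y) = s * x powr s * (1 - y / x)"
    using assms by (simp add: powr_diff field_simps)
  ultimately show ?thesis
    by (simp add: algebra_simps)
qed

text \<open>With mean 1, interpolation bounds the excess of the \<open>r\<close>-th moment by
  \<open>r - 1\<close> times the variance. Since \<open>p0 * x \<le> 1\<close>, the slope of the
  power \<open>r/2\<close> at the larger value \<open>x\<close> is bounded below, which turns the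
  variance into the squared difference of the powers.\<close>

lemma two_point_normalised:
  fixes p p0 r x y :: real
  assumes p: "0 < p0" "p0 \<le> p" "p \<le> 1 - p0" and r: "1 \<le> r" "r \<le> 2"
    and xy: "0 \<le> y" "y \<le> x" and mean: "p * x + (1 - p) * y = 1"
  shows "p * x powr r + (1 - p) * y powr r \<le> 1 + (r - 1) / p0 * (x powr (r/2) - y powr (r/2))\<^sup>2"
proof -
  have x1: "1 \<le> x"
    using mean xy p mult_left_mono[OF xy(2), of "1 - p"] by (simp add: algebra_simps)
  have "p0 * x \<le> p * x"
    using p x1 by (intro mult_right_mono) auto
  moreover have "p * x \<le> 1"
    using mean xy p by (smt (verit) mult_nonneg_nonneg)
  ultimately have p0x: "p0 * x \<le> 1" by simp
  have "p * x powr r + (1 - p) * y powr r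
      \<le> p * ((2 - r) * x + (r - 1) * x\<^sup>2) + (1 - p) * ((2 - r) * y + (r - 1) * y\<^sup>2)"
    using p xy r by (intro add_mono mult_left_mono powr_le_interpolation) auto
  also have "\<dots> = (2 - r) * (p * x + (1 - p) * y) + (r - 1) * (p * x\<^sup>2 + (1 - p) * y\<^sup>2)"
    by (simp add: algebra_simps)
  also have "p * x\<^sup>2 + (1 - p) * y\<^sup>2 = (p * x + (1 - p) * y)\<^sup>2 + p * (1 - p) * (x - y)\<^sup>2"
    by (simp add: power2_eq_square algebra_simps)
  finally have gap: "p * x powr r + (1 - p) * y powr r \<le> 1 + (r - 1) * (p * (1 - p) * (x - y)\<^sup>2)"
    unfolding mean by (simp add: algebra_simps)
  have tan: "r/2 * x powr (r/2 - 1) * (x - y) \<le> x powr (r/2) - y powr (r/2)"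
    using xy x1 r by (intro powr_concave_tangent) auto
  have "p0 \<le> x powr (r - 2)"
  proof -
    have "p0 \<le> x powr (-1)"
      using p0x x1 by (simp add: powr_minus field_simps)
    also have "\<dots> \<le> x powr (r - 2)"
      using x1 r by (intro powr_mono) auto
    finally show ?thesis .
  qed
  \<comment> \<open>The 1/4 from \<open>(r/2)\<^sup>2\<close> is cancelled below by
    \<open>p * (1 - p) \<le> 1 / 4\<close>.\<close>
  then have "1 / 4 * p0 * (x - y)\<^sup>2 \<le> (r/2)\<^sup>2 * x powr (r - 2) * (x - y)\<^sup>2"
    using r p power_mono[of "1/2" "r/2" 2] by (intro mult_right_mono mult_mono) (auto simp: power2_eq_square)
  also have "\<dots> = (r/2 * x powr (r/2 - 1) * (x - y))\<^sup>2"
  proof -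
    have "x powr (r - 2) = (x powr (r/2 - 1))\<^sup>2"
      by (simp add: power2_eq_square flip: powr_add)
    then show ?thesis by (simp add: power_mult_distrib power_divide)
  qed
  also have "\<dots> \<le> (x powr (r/2) - y powr (r/2))\<^sup>2"
    using tan xy r by (intro power_mono) auto
  finally have "(x - y)\<^sup>2 / 4 \<le> (x powr (r/2) - y powr (r/2))\<^sup>2 / p0"
    using p by (simp add: field_simps)
  moreover have "p * (1 - p) \<le> 1 / 4"
    using zero_le_power2[of "p - 1/2"] by (simp add: power2_eq_square algebra_simps)
  then have "p * (1 - p) * (x - y)\<^sup>2 \<le> 1 / 4 * (x - y)\<^sup>2"
    by (intro mult_right_mono) auto
  ultimately have "p * (1 - p) * (x - y)\<^sup>2 \<le> (x powr (r/2) - y powr (r/2))\<^sup>2 / p0"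
    by linarith
  then have "(r - 1) * (p * (1 - p) * (x - y)\<^sup>2) \<le> (r - 1) * ((x powr (r/2) - y powr (r/2))\<^sup>2 / p0)"
    using r by (intro mult_left_mono) auto
  then show ?thesis
    using gap by simp
qed

text \<open>Both sides are homogeneous of degree \<open>r\<close>, so the mean can be scaled to 1
  unless it is 0; exchanging \<open>p\<close> and \<open>1 - p\<close> brings the larger value to
  the front.\<close>

lemma two_point:
  fixes p p0 r a b :: real
  assumes p: "0 < p0" "p0 \<le> p" "p \<le> 1 - p0" and r: "1 \<le> r" "r \<le> 2" and ab: "0 \<le> a" "0 \<le> b"
  shows "p * a powr r + (1 - p) * b powr r
    \<le> (p * a + (1 - p) * b) powr r + (r - 1) / p0 * (a powr (r/2) - b powr (r/2))\<^sup>2"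
proof -
  define m where "m = p * a + (1 - p) * b"
  show ?thesis
  proof (cases "m = 0")
    case True
    then have "p * a = 0 \<and> (1 - p) * b = 0"
      using p ab unfolding m_def by (intro add_nonneg_eq_0_iff[THEN iffD1]) auto
    then show ?thesis
      using p r by auto
  next
    case False
    then have m: "m > 0"
      using p ab unfolding m_def by (smt (verit) mult_nonneg_nonneg)
    define x y where "x = a / m" and "y = b / m"
    have a: "a = m * x" and b: "b = m * y"
      using m by (auto simp: x_def y_def)
    have xy: "0 \<le> x" "0 \<le> y"
      using m ab by (auto simp: x_def y_def)
    have mean: "p * x + (1 - p) * y = 1"
      using m by (simp add: x_def y_def m_def flip: add_divide_distrib)
    have "p * x powr r + (1 - p) * y powr r \<le> 1 + (r - 1) / p0 * (x powr (r/2) - y powr (r/2))\<^sup>2"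
    proof (cases "y \<le> x")
      case True
      then show ?thesis
        using two_point_normalised[OF p r xy(2) True mean] by simp
    next
      case False
      then show ?thesis
        using two_point_normalised[of p0 "1 - p" r x y] p r xy mean
        by (simp add: power2_commute)
    qed
    then have "m powr r * (p * x powr r + (1 - p) * y powr r)
        \<le> m powr r * (1 + (r - 1) / p0 * (x powr (r/2) - y powr (r/2))\<^sup>2)"
      by (intro mult_left_mono) auto
    moreover have "m powr r = (m powr (r/2))\<^sup>2"
      by (simp add: power2_eq_square flip: powr_add)
    ultimately have "p * (m powr r * x powr r) + (1 - p) * (m powr r * y powr r)
        \<le> m powr r + (r - 1) / p0 * (m powr (r/2) * x powr (r/2) - m powr (r/2) * y powr (r/2))\<^sup>2"
      by (simp add: algebra_simps power2_eq_square)
    then show ?thesis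
      unfolding m_def[symmetric] unfolding a b using m xy by (simp add: powr_mult)
  qed
qed

subsection \<open>A Beckner inequality and martingale variance\<close>

lemma powr_convex_nonneg:
  fixes x y t q :: real
  assumes "0 \<le> x" "0 \<le> y" "0 \<le> t" "t \<le> 1" "1 \<le> q"
  shows "(t * x + (1 - t) * y) powr q \<le> t * x powr q + (1 - t) * y powr q"
proof -
  have scale: "(s * z) powr q \<le> s * z powr q" if "0 \<le> s" "s \<le> 1" "0 \<le> z" for s z :: real
    using that assms powr_le_one_le[of s q]
    by (cases "s = 0") (auto simp: powr_mult intro!: mult_right_mono)
  consider "x = 0" | "y = 0" | "x > 0" "y > 0"
    using assms by linarith
  then show ?thesis
  proof cases
    case 3
    then show ?thesis
      using powr_convex[OF assms(5)] assms(3,4)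
      unfolding convex_on_def by (auto dest!: bspec[of _ _ x] bspec[of _ _ y] spec[of _ t])
  qed (use scale[of "1 - t" y] scale[of t x] assms in auto)
qed

text \<open>Minkowski's inequality for the \<open>q\<close>-norm and its comparison with the 2-norm
  in one step: convexity with weights proportional to the two norms, then AM-GM for the
  \<open>q\<close>-th power of \<open>|h1 - h0| / w\<close>, both applied pointwise and
  averaged.\<close>

lemma powr_norm_triangle:
  fixes h0 h1 :: "'a set \<Rightarrow> real"
  assumes p: "0 \<le> p" "p \<le> 1" and N: "finite N" and q: "1 \<le> q" "q \<le> 2"
    and nn: "\<And>A. A \<subseteq> N \<Longrightarrow> 0 \<le> h0 A" "\<And>A. A \<subseteq> N \<Longrightarrow> 0 \<le> h1 A"
  shows "bexp p N (\<lambda>A. h1 A powr q) powr (1/q)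
    \<le> bexp p N (\<lambda>A. h0 A powr q) powr (1/q) + sqrt (bexp p N (\<lambda>A. (h1 A - h0 A)\<^sup>2))"
    (is "?u \<le> ?v + ?w")
proof (rule field_le_epsilon)
  fix e :: real assume "e > 0"
  txt \<open>The slack \<open>e / 2\<close> keeps both norms away from 0, so that one may divide by them.\<close>
  define v w where "v = ?v + e / 2" and "w = ?w + e / 2"
  have "?w \<ge> 0"
    using p by (intro real_sqrt_ge_zero bexp_nonneg) auto
  then have vw: "v > 0" "w > 0"
    using \<open>e > 0\<close> by (auto simp: v_def w_def add_nonneg_pos)
  define t where "t = v / (v + w)"
  have t: "0 \<le> t" "t \<le> 1" "1 - t = w / (v + w)"
    using vw by (auto simp: t_def field_simps)
  have pt: "h1 A powr q \<le> (v + w) powr q *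
      (t * (h0 A powr q / v powr q) + (1 - t) * (q/2 * ((h1 A - h0 A)\<^sup>2 / w\<^sup>2) + (1 - q/2)))"
    if "A \<subseteq> N" for A
  proof -
    let ?g = "\<bar>h1 A - h0 A\<bar>"
    have "h1 A powr q \<le> (h0 A + ?g) powr q"
      using nn[OF that] q by (intro powr_mono2) auto
    also have "h0 A + ?g = (v + w) * (t * (h0 A / v) + (1 - t) * (?g / w))"
    proof -
      have "(v + w) * t = v" "(v + w) * (1 - t) = w"
        using vw t(3) by (auto simp: t_def)
      then have "(v + w) * (t * (h0 A / v) + (1 - t) * (?g / w)) = v * (h0 A / v) + w * (?g / w)"
        by (simp only: distrib_left mult.assoc[symmetric])
      then show ?thesis
        using vw by simp
    qed
    also have "\<dots> powr q = (v + w) powr q * (t * (h0 A / v) + (1 - t) * (?g / w)) powr q"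
      by (rule powr_mult)
    also have "\<dots> \<le> (v + w) powr q * (t * (h0 A / v) powr q + (1 - t) * (?g / w) powr q)"
      using vw t nn[OF that] q by (intro mult_left_mono powr_convex_nonneg) auto
    finally have le: "h1 A powr q \<le> (v + w) powr q * (t * (h0 A / v) powr q + (1 - t) * (?g / w) powr q)" .
    have "(?g / w) powr q \<le> q/2 * ((h1 A - h0 A)\<^sup>2 / w\<^sup>2) + (1 - q/2)"
    proof (cases "?g = 0")
      case False
      then have "((?g / w)\<^sup>2) powr (q/2) * 1 powr (1 - q/2) \<le> q/2 * (?g / w)\<^sup>2 + (1 - q/2) * 1"
        using vw q by (intro Youngs_inequality_0) auto
      moreover have "((?g / w)\<^sup>2) powr (q/2) = (?g / w) powr q"
        using False vw by (simp add: powr_powr flip: powr_numeral)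
      ultimately show ?thesis
        by (simp add: power_divide)
    qed (use q in auto)
    then have "(v + w) powr q * (t * (h0 A / v) powr q + (1 - t) * (?g / w) powr q) \<le> (v + w) powr q *
      (t * (h0 A / v) powr q + (1 - t) * (q/2 * ((h1 A - h0 A)\<^sup>2 / w\<^sup>2) + (1 - q/2)))"
      using t(2) by (intro mult_left_mono add_left_mono) auto
    moreover have "(h0 A / v) powr q = h0 A powr q / v powr q"
      using vw nn[OF that] by (simp add: powr_divide)
    ultimately show ?thesis
      using le by simp
  qed
  have v': "bexp p N (\<lambda>A. h0 A powr q) \<le> v powr q"
  proof -
    have "bexp p N (\<lambda>A. h0 A powr q) = ?v powr q"
      using q p nn by (simp add: powr_powr bexp_nonneg)
    also have "\<dots> \<le> v powr q"
      using \<open>e > 0\<close> q by (intro powr_mono2) (auto simp: v_def)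
    finally show ?thesis .
  qed
  have w': "bexp p N (\<lambda>A. (h1 A - h0 A)\<^sup>2) \<le> w\<^sup>2"
  proof -
    have "bexp p N (\<lambda>A. (h1 A - h0 A)\<^sup>2) = ?w\<^sup>2"
      using p by (simp add: bexp_nonneg)
    also have "\<dots> \<le> w\<^sup>2"
      using \<open>e > 0\<close> \<open>?w \<ge> 0\<close> by (intro power_mono) (auto simp: w_def)
    finally show ?thesis .
  qed
  have "bexp p N (\<lambda>A. h1 A powr q) \<le> bexp p N (\<lambda>A. (v + w) powr q *
      (t * (inverse (v powr q) * h0 A powr q) + (1 - t) * (q/2 * (inverse (w\<^sup>2) * (h1 A - h0 A)\<^sup>2) + (1 - q/2))))"
    using pt by (intro bexp_mono p) (simp add: field_simps)
  also have "\<dots> = (v + w) powr q * (t * (inverse (v powr q) * bexp p N (\<lambda>A. h0 A powr q))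
      + (1 - t) * (q/2 * (inverse (w\<^sup>2) * bexp p N (\<lambda>A. (h1 A - h0 A)\<^sup>2)) + (1 - q/2)))"
    by (simp only: bexp_cmult bexp_add bexp_const[OF N])
  also have "\<dots> \<le> (v + w) powr q * (t * (inverse (v powr q) * v powr q)
      + (1 - t) * (q/2 * (inverse (w\<^sup>2) * w\<^sup>2) + (1 - q/2)))"
    using v' w' t q by (intro mult_left_mono add_mono order_refl) auto
  also have "\<dots> = (v + w) powr q"
    using vw by simp
  finally have "?u \<le> ((v + w) powr q) powr (1/q)"
    using q p by (intro powr_mono2) (auto intro!: bexp_nonneg)
  also have "\<dots> = v + w"
    using vw q by (simp add: powr_powr)
  finally show "?u \<le> ?v + ?w + e"
    by (simp add: v_def w_def)
qed

lemma powr_norm_diff_le: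
  fixes h0 h1 :: "'a set \<Rightarrow> real"
  assumes p: "0 \<le> p" "p \<le> 1" and N: "finite N" and q: "1 \<le> q" "q \<le> 2"
    and nn: "\<And>A. A \<subseteq> N \<Longrightarrow> 0 \<le> h0 A" "\<And>A. A \<subseteq> N \<Longrightarrow> 0 \<le> h1 A"
  shows "(bexp p N (\<lambda>A. h1 A powr q) powr (1/q) - bexp p N (\<lambda>A. h0 A powr q) powr (1/q))\<^sup>2
    \<le> bexp p N (\<lambda>A. (h1 A - h0 A)\<^sup>2)"
proof -
  let ?w = "sqrt (bexp p N (\<lambda>A. (h1 A - h0 A)\<^sup>2))"
  have "\<bar>bexp p N (\<lambda>A. h1 A powr q) powr (1/q) - bexp p N (\<lambda>A. h0 A powr q) powr (1/q)\<bar> \<le> ?w"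
    using powr_norm_triangle[OF p N q, of h0 h1] powr_norm_triangle[OF p N q, of h1 h0] nn
    by (simp add: power2_commute abs_le_iff)
  then have "\<bar>bexp p N (\<lambda>A. h1 A powr q) powr (1/q) - bexp p N (\<lambda>A. h0 A powr q) powr (1/q)\<bar>\<^sup>2 \<le> ?w\<^sup>2"
    by (intro power_mono) auto
  then show ?thesis
    using p by (simp add: bexp_nonneg)
qed

text \<open>Induction on the coordinates, with the two-point inequality applied to the moments of
  the two restrictions. The powers \<open>r/2\<close> of these moments are \<open>2/r\<close>-norms,
  so their squared difference is at most the squared 2-norm of the difference of the restrictions,
  which is the energy in the new direction. \<open>C\<close> stays free as it is used with
  \<open>p * (1 - p)\<close> at \<open>r = 2\<close> and with \<open>(r - 1) / p0\<close>.\<close>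

lemma beckner_tensor:
  fixes h :: "'a set \<Rightarrow> real"
  assumes p: "0 \<le> p" "p \<le> 1" and r: "1 \<le> r" "r \<le> 2" and "0 \<le> C"
    and two: "\<And>a b. 0 \<le> a \<Longrightarrow> 0 \<le> b \<Longrightarrow> p * a powr r + (1 - p) * b powr r
      \<le> (p * a + (1 - p) * b) powr r + C * (a powr (r/2) - b powr (r/2))\<^sup>2"
    and "finite N" "\<And>A. A \<subseteq> N \<Longrightarrow> 0 \<le> h A"
  shows "bexp p N (\<lambda>A. (h A)\<^sup>2) \<le> bexp p N (\<lambda>A. h A powr (2/r)) powr r + C * energy p N h"
  using assms(7,8)
proof (induction N arbitrary: h rule: finite_induct)
  case empty
  then show ?case
    using r by (simp add: powr_powr energy_def)
next
  case (insert i N)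
  let ?h1 = "\<lambda>A. h (insert i A)"
  let ?a = "bexp p N (\<lambda>A. ?h1 A powr (2/r))" and ?b = "bexp p N (\<lambda>A. h A powr (2/r))"
  have nn: "0 \<le> ?h1 A" "0 \<le> h A" if "A \<subseteq> N" for A
    using that by (auto intro!: insert.prems)
  have IH1: "bexp p N (\<lambda>A. (?h1 A)\<^sup>2) \<le> ?a powr r + C * energy p N ?h1"
    by (rule insert.IH) (rule nn)
  have IH0: "bexp p N (\<lambda>A. (h A)\<^sup>2) \<le> ?b powr r + C * energy p N h"
    by (rule insert.IH) (rule nn)
  have "(?a powr (1/(2/r)) - ?b powr (1/(2/r)))\<^sup>2 \<le> bexp p N (\<lambda>A. (?h1 A - h A)\<^sup>2)"
    using r nn by (intro powr_norm_diff_le p insert.hyps) (auto simp: field_simps)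
  then have D: "C * (?a powr (r/2) - ?b powr (r/2))\<^sup>2 \<le> C * bexp p N (\<lambda>A. (?h1 A - h A)\<^sup>2)"
    using \<open>0 \<le> C\<close> by (intro mult_left_mono) auto
  have ab: "0 \<le> ?a" "0 \<le> ?b"
    using p by (auto intro!: bexp_nonneg)
  have "bexp p (insert i N) (\<lambda>A. (h A)\<^sup>2)
      = p * bexp p N (\<lambda>A. (?h1 A)\<^sup>2) + (1 - p) * bexp p N (\<lambda>A. (h A)\<^sup>2)"
    using insert.hyps by (simp add: bexp_insert)
  also have "\<dots> \<le> p * (?a powr r + C * energy p N ?h1) + (1 - p) * (?b powr r + C * energy p N h)"
    using IH1 IH0 p by (intro add_mono mult_left_mono) auto
  also have "\<dots> = (p * ?a powr r + (1 - p) * ?b powr r) + C * (p * energy p N ?h1 + (1 - p) * energy p N h)"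
    by (simp add: algebra_simps)
  also have "\<dots> \<le> (p * ?a + (1 - p) * ?b) powr r + C * bexp p N (\<lambda>A. (?h1 A - h A)\<^sup>2)
      + C * (p * energy p N ?h1 + (1 - p) * energy p N h)"
    using two[OF ab] D by simp
  also have "\<dots> = bexp p (insert i N) (\<lambda>A. h A powr (2/r)) powr r + C * energy p (insert i N) h"
    using insert.hyps by (simp add: energy_insert bexp_insert algebra_simps)
  finally show ?case .
qed

text \<open>Averaging out the coordinates of \<open>K\<close> one at a time, the loss of energy at a coordinate pays for
  the energy of the derivative in its direction.\<close>
lemma martingale_variance:
  fixes f :: "'a set \<Rightarrow> real"
  assumes p: "0 \<le> p" "p \<le> 1" and "0 \<le> C"
    and bound: "\<And>M h. finite M \<Longrightarrow> (\<And>A :: 'a set. A \<subseteq> M \<Longrightarrow> 0 \<le> h A \<and> h A \<le> 1) \<Longrightarrow>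
      bexp p M (\<lambda>A. (h A)\<^sup>2) \<le> bexp p M h powr r + C * energy p M h"
    and J: "finite J" and K: "finite K" "J \<inter> K = {}"
    and f: "\<And>j A. j \<in> J \<union> K \<Longrightarrow> A \<subseteq> J \<union> K \<Longrightarrow> 0 \<le> dif j f A \<and> dif j f A \<le> 1"
  shows "(p * (1 - p) + C) * (bexp p (J \<union> K) (\<lambda>A. (f A)\<^sup>2) - bexp p J (\<lambda>B. (bexp p K (\<lambda>A. f (B \<union> A)))\<^sup>2))
    \<le> p * (1 - p) * (p * (1 - p) * (\<Sum>i\<in>K. bexp p (J \<union> K) (dif i f) powr r) + C * energy p (J \<union> K) f)"
  using K f
proof (induction K arbitrary: f rule: finite_induct)
  case empty
  then show ?case
    using p \<open>0 \<le> C\<close> by (simp add: energy_nonneg)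
next
  case (insert i K)
  define N where "N = J \<union> K"
  have N: "finite N" "i \<notin> N" "J \<union> insert i K = insert i N"
    using insert J by (auto simp: N_def)
  define h where "h A = f (insert i A) - f A" for A
  define g where "g A = p * f (insert i A) + (1 - p) * f A" for A
  define s where "s = p * (1 - p)"
  have s: "0 \<le> s" using p by (simp add: s_def)
  have bexp_ins: "bexp p (insert i N) F = p * bexp p N (\<lambda>A. F (insert i A)) + (1 - p) * bexp p N F" for F
    using N by (simp add: bexp_insert)
  have dg: "dif j g = (\<lambda>A. p * dif j (\<lambda>B. f (insert i B)) A + (1 - p) * dif j f A)" for j
    by (rule ext) (simp add: dif_def g_def algebra_simps)
  have dh: "dif j h A = dif j (\<lambda>B. f (insert i B)) A - dif j f A" for j A
    by (simp add: dif_def h_def algebra_simps)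
  have h01: "0 \<le> h A \<and> h A \<le> 1" if "A \<subseteq> N" for A
  proof -
    have "A - {i} = A" using that N by auto
    then have "dif i f A = h A" by (simp add: dif_def h_def)
    then show ?thesis
      using insert.prems(2)[of i A] that N(3) by (auto simp: N_def)
  qed
  have g01: "0 \<le> dif j g A \<and> dif j g A \<le> 1" if "j \<in> N" "A \<subseteq> N" for j A
  proof -
    have ne: "i \<noteq> j" using that N by auto
    have "0 \<le> dif j f (insert i A) \<and> dif j f (insert i A) \<le> 1"
      by (rule insert.prems(2)) (use that N(3) in auto)
    moreover have "0 \<le> dif j f A \<and> dif j f A \<le> 1"
      by (rule insert.prems(2)) (use that N(3) in auto)
    ultimately show ?thesis
      using p convex_bound_le[of "dif j (\<lambda>B. f (insert i B)) A" 1 "dif j f A" p "1 - p"]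
      unfolding dg dif_insert[OF ne] by auto
  qed
  have infl_i: "bexp p (insert i N) (dif i f) = bexp p N h"
    using bexp_dif_self[OF N(1,2), of p "\<lambda>x. x" f] by (simp add: h_def[abs_def])
  have infl_j: "bexp p (insert i N) (dif j f) = bexp p N (dif j g)" if "j \<in> N" for j
    using that N bexp_dif_other[OF N(1,2), of j p "\<lambda>x. x" f]
    by (auto simp: dg bexp_add bexp_cmult)
  have E: "energy p (insert i N) f = energy p N g + bexp p N (\<lambda>A. (h A)\<^sup>2) + s * energy p N h"
  proof -
    have "p * (dif j (\<lambda>B. f (insert i B)) A)\<^sup>2 + (1 - p) * (dif j f A)\<^sup>2 = (dif j g A)\<^sup>2 + s * (dif j h A)\<^sup>2" for j A
      unfolding dg dh s_def by (simp add: power2_eq_square algebra_simps)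
    then have "p * energy p N (\<lambda>B. f (insert i B)) + (1 - p) * energy p N f = energy p N g + s * energy p N h"
      by (simp add: energy_def sum_distrib_left bexp_cmult[symmetric] bexp_add[symmetric] sum.distrib[symmetric])
    then show ?thesis
      using N by (simp add: energy_insert h_def)
  qed
  have "p * (f (insert i A))\<^sup>2 + (1 - p) * (f A)\<^sup>2 = (g A)\<^sup>2 + s * (h A)\<^sup>2" for A
    unfolding g_def h_def s_def by (simp add: power2_eq_square algebra_simps)
  then have sq: "bexp p (insert i N) (\<lambda>A. (f A)\<^sup>2) = bexp p N (\<lambda>A. (g A)\<^sup>2) + s * bexp p N (\<lambda>A. (h A)\<^sup>2)"
    by (simp add: bexp_ins bexp_cmult[symmetric] bexp_add[symmetric])
  have cond: "bexp p (insert i K) (\<lambda>A. f (B \<union> A)) = bexp p K (\<lambda>A. g (B \<union> A))" for B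
    using insert.hyps by (simp add: bexp_insert g_def bexp_add bexp_cmult)
  have IH: "(s + C) * (bexp p N (\<lambda>A. (g A)\<^sup>2) - bexp p J (\<lambda>B. (bexp p K (\<lambda>A. g (B \<union> A)))\<^sup>2))
    \<le> s * (s * (\<Sum>j\<in>K. bexp p N (dif j g) powr r) + C * energy p N g)"
    unfolding s_def N_def by (rule insert.IH) (use insert.prems g01 N_def in auto)
  have "s * bexp p N (\<lambda>A. (h A)\<^sup>2) \<le> s * (bexp p N h powr r + C * energy p N h)"
    using s h01 N by (intro mult_left_mono bound) auto
  \<comment> \<open>Adding \<open>C\<close> times the second moment of \<open>h\<close> completes
    the last bracket to the energy lost from \<open>f\<close> to \<open>g\<close>, as computed in
    \<open>E\<close>; hence the factor \<open>s + C\<close>.\<close>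
  then have "s * ((s + C) * bexp p N (\<lambda>A. (h A)\<^sup>2))
      \<le> s * (s * bexp p N h powr r + C * (bexp p N (\<lambda>A. (h A)\<^sup>2) + s * energy p N h))"
    using s by (intro mult_left_mono) (auto simp: algebra_simps)
  then have "(s + C) * (bexp p N (\<lambda>A. (g A)\<^sup>2) + s * bexp p N (\<lambda>A. (h A)\<^sup>2) - bexp p J (\<lambda>B. (bexp p K (\<lambda>A. g (B \<union> A)))\<^sup>2))
    \<le> s * (s * (bexp p N h powr r + (\<Sum>j\<in>K. bexp p N (dif j g) powr r)) + C * (energy p N g + bexp p N (\<lambda>A. (h A)\<^sup>2) + s * energy p N h))"
    using IH by (simp add: algebra_simps)
  moreover have "(\<Sum>j\<in>insert i K. bexp p (insert i N) (dif j f) powr r)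
      = bexp p N h powr r + (\<Sum>j\<in>K. bexp p N (dif j g) powr r)"
    using insert.hyps infl_i infl_j by (auto simp: N_def)
  ultimately show ?case
    unfolding N(3) cond sq E s_def by simp
qed

subsection \<open>Influences of up-sets\<close>

definition upset :: "'a set \<Rightarrow> 'a set set \<Rightarrow> bool" where
  "upset N G \<longleftrightarrow> (\<forall>A B. A \<in> G \<longrightarrow> A \<subseteq> B \<longrightarrow> B \<subseteq> N \<longrightarrow> B \<in> G)"

definition mu :: "real \<Rightarrow> 'a set \<Rightarrow> 'a set set \<Rightarrow> real" where
  "mu p N G = bexp p N (\<lambda>A. of_bool (A \<in> G))"

definition infl :: "real \<Rightarrow> 'a set \<Rightarrow> 'a set set \<Rightarrow> 'a \<Rightarrow> real" where
  "infl p N G i = bexp p N (dif i (\<lambda>A. of_bool (A \<in> G)))"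

lemma of_bool_power2: "(of_bool P :: real)\<^sup>2 = of_bool P"
  by (cases P) auto

lemma dif_upset:
  assumes "upset N G" "j \<in> N" "A \<subseteq> N"
  shows "dif j (\<lambda>A. of_bool (A \<in> G)) A \<in> {0, 1 :: real}"
proof -
  have "A - {j} \<in> G \<longrightarrow> insert j A \<in> G"
    using assms unfolding upset_def by (meson Diff_subset insert_subset subset_insertI subset_trans)
  then show ?thesis
    by (auto simp: dif_def)
qed

lemma dif_upset_bounds:
  assumes "upset N G" "j \<in> N" "A \<subseteq> N"
  shows "0 \<le> dif j (\<lambda>A. of_bool (A \<in> G) :: real) A \<and> dif j (\<lambda>A. of_bool (A \<in> G) :: real) A \<le> 1"
  using dif_upset[OF assms] by auto

lemma energy_upset:
  assumes "upset N G"
  shows "energy p N (\<lambda>A. of_bool (A \<in> G)) = (\<Sum>i\<in>N. infl p N G i)"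
  unfolding energy_def infl_def
proof (intro sum.cong refl bexp_cong)
  fix i A assume "i \<in> N" "A \<subseteq> N"
  then show "(dif i (\<lambda>A. of_bool (A \<in> G) :: real) A)\<^sup>2 = dif i (\<lambda>A. of_bool (A \<in> G)) A"
    using dif_upset[OF assms, of i A] by auto
qed

lemma infl_bounds:
  assumes "upset N G" "finite N" "i \<in> N" "0 \<le> p" "p \<le> 1"
  shows "0 \<le> infl p N G i" "infl p N G i \<le> 1"
  unfolding infl_def using assms dif_upset_bounds[OF assms(1,3)]
  by (auto intro!: bexp_nonneg bexp_le_1)

lemma mu_bounds:
  assumes "finite N" "0 \<le> p" "p \<le> 1"
  shows "0 \<le> mu p N G" "mu p N G \<le> 1"
  unfolding mu_def using assms by (auto intro!: bexp_nonneg bexp_le_1)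

lemma mu_mono:
  assumes "0 \<le> p" "p \<le> 1" "\<And>A. A \<subseteq> N \<Longrightarrow> A \<in> G \<Longrightarrow> A \<in> H"
  shows "mu p N G \<le> mu p N H"
  unfolding mu_def using assms by (intro bexp_mono) auto

text \<open>The martingale bound for \<open>r = 2\<close> and \<open>J = {}\<close>, where the
  two-point inequality with \<open>C = p * (1 - p)\<close> is an identity. Compared with the
  Poincare inequality, an influence \<open>I\<close> counts as \<open>(I + I\<^sup>2) / 2\<close>, a
  constant gain unless \<open>I\<close> is near 1.\<close>

lemma poincare_improved:
  assumes p: "0 < p" "p < 1" and N: "finite N" and G: "upset N G"
  shows "mu p N G * (1 - mu p N G) \<le> p * (1 - p) / 2 * (\<Sum>i\<in>N. infl p N G i + (infl p N G i)\<^sup>2)"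
proof -
  define s where "s = p * (1 - p)"
  have s: "s > 0" using p by (simp add: s_def)
  have bound: "bexp p M (\<lambda>A. (h A)\<^sup>2) \<le> bexp p M h powr 2 + s * energy p M h"
    if "finite M" "\<And>A. A \<subseteq> M \<Longrightarrow> 0 \<le> h A \<and> h A \<le> 1" for M and h :: "'a set \<Rightarrow> real"
  proof -
    have "bexp p M (\<lambda>A. (h A)\<^sup>2) \<le> bexp p M (\<lambda>A. h A powr (2/2)) powr 2 + s * energy p M h"
    proof (rule beckner_tensor)
      fix a b :: real assume "0 \<le> a" "0 \<le> b"
      moreover from this have "0 \<le> p * a + (1 - p) * b"
        using p by simp
      ultimately show "p * a powr 2 + (1 - p) * b powr 2
        \<le> (p * a + (1 - p) * b) powr 2 + s * (a powr (2/2) - b powr (2/2))\<^sup>2"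
        unfolding powr_numeral by (simp add: s_def) (simp add: power2_eq_square algebra_simps)
    qed (use p s that in auto)
    also have "bexp p M (\<lambda>A. h A powr (2/2)) = bexp p M h"
      using that by (intro bexp_cong) auto
    finally show ?thesis .
  qed
  have "(p * (1 - p) + s) * (bexp p ({} \<union> N) (\<lambda>A. (of_bool (A \<in> G))\<^sup>2)
        - bexp p {} (\<lambda>B. (bexp p N (\<lambda>A. of_bool (B \<union> A \<in> G)))\<^sup>2))
    \<le> p * (1 - p) * (p * (1 - p) * (\<Sum>i\<in>N. bexp p ({} \<union> N) (dif i (\<lambda>A. of_bool (A \<in> G))) powr 2)
        + s * energy p ({} \<union> N) (\<lambda>A. of_bool (A \<in> G)))"
    using p s N bound dif_upset_bounds[OF G] by (intro martingale_variance) auto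
  then have "s * (2 * (mu p N G - (mu p N G)\<^sup>2))
      \<le> s * (s * (\<Sum>i\<in>N. infl p N G i powr 2) + s * (\<Sum>i\<in>N. infl p N G i))"
    unfolding s_def[symmetric] by (simp add: energy_upset[OF G] infl_def mu_def of_bool_power2 algebra_simps)
  then have "2 * (mu p N G - (mu p N G)\<^sup>2)
      \<le> s * (\<Sum>i\<in>N. infl p N G i powr 2) + s * (\<Sum>i\<in>N. infl p N G i)"
    using s by simp
  also have "(\<Sum>i\<in>N. infl p N G i powr 2) = (\<Sum>i\<in>N. (infl p N G i)\<^sup>2)"
    using p N infl_bounds[OF G N] by (intro sum.cong) auto
  finally show ?thesis
    unfolding s_def[symmetric] sum.distrib by (simp add: field_simps power2_eq_square)
qed

text \<open>The left side is the mean variance of \<open>G\<close> once its trace on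
  \<open>J\<close> is known. An influence \<open>I \<le> \<tau>\<close> contributes
  \<open>I powr r \<le> \<tau> powr (r - 1) * I\<close>, so the bound vanishes if first
  \<open>r\<close> approaches 1 and then \<open>\<tau>\<close> approaches 0.\<close>

lemma junta_variance:
  assumes p: "0 < p0" "p0 \<le> p" "p \<le> 1 - p0" and r: "1 \<le> r" "r \<le> 2" and "0 < \<tau>"
    and JK: "finite J" "finite K" "J \<inter> K = {}" and G: "upset (J \<union> K) G"
    and small: "\<And>i. i \<in> K \<Longrightarrow> infl p (J \<union> K) G i \<le> \<tau>"
    and total: "(\<Sum>i\<in>J \<union> K. infl p (J \<union> K) G i) \<le> Q"
  shows "bexp p J (\<lambda>B. mu p K {C. B \<union> C \<in> G} * (1 - mu p K {C. B \<union> C \<in> G}))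
    \<le> (\<tau> powr (r - 1) + (r - 1) / p0) * Q"
proof -
  define s where "s = p * (1 - p)"
  define C where "C = (r - 1) / p0"
  have p': "0 \<le> p" "p \<le> 1" using p by auto
  have s: "s > 0" "s \<le> 1" using p by (auto simp: s_def intro!: mult_le_one)
  have C: "C \<ge> 0" using p r by (simp add: C_def)
  define V where "V = bexp p J (\<lambda>B. mu p K {C. B \<union> C \<in> G} * (1 - mu p K {C. B \<union> C \<in> G}))"
  have "0 \<le> V"
    unfolding V_def using p' JK mu_bounds[of K p] by (intro bexp_nonneg) auto
  have bound: "bexp p M (\<lambda>A. (h A)\<^sup>2) \<le> bexp p M h powr r + C * energy p M h"
    if "finite M" "\<And>A. A \<subseteq> M \<Longrightarrow> 0 \<le> h A \<and> h A \<le> 1" for M and h :: "'a set \<Rightarrow> real"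
  proof -
    have "bexp p M (\<lambda>A. (h A)\<^sup>2) \<le> bexp p M (\<lambda>A. h A powr (2/r)) powr r + C * energy p M h"
      using two_point[OF p r] that p' r C by (intro beckner_tensor) (auto simp: C_def)
    also have "bexp p M (\<lambda>A. h A powr (2/r)) powr r \<le> bexp p M h powr r"
    proof (intro powr_mono2 bexp_mono)
      fix A assume "A \<subseteq> M"
      then show "h A powr (2/r) \<le> h A"
        using that(2)[of A] r powr_mono'[of 1 "2/r" "h A"] by auto
    qed (use p' r in \<open>auto intro!: bexp_nonneg\<close>)
    finally show ?thesis by simp
  qed
  have I: "0 \<le> infl p (J \<union> K) G i" if "i \<in> J \<union> K" for i
    using infl_bounds[OF G] that JK p' by auto
  have Vb: "(s + C) * (bexp p (J \<union> K) (\<lambda>A. (of_bool (A \<in> G))\<^sup>2)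
        - bexp p J (\<lambda>B. (bexp p K (\<lambda>A. of_bool (B \<union> A \<in> G)))\<^sup>2))
    \<le> s * (s * (\<Sum>i\<in>K. bexp p (J \<union> K) (dif i (\<lambda>A. of_bool (A \<in> G))) powr r)
        + C * energy p (J \<union> K) (\<lambda>A. of_bool (A \<in> G)))"
    unfolding s_def using p' C JK bound dif_upset_bounds[OF G] by (intro martingale_variance) auto
  have "bexp p (J \<union> K) (\<lambda>A. (of_bool (A \<in> G))\<^sup>2) = bexp p J (\<lambda>B. mu p K {C. B \<union> C \<in> G})"
    using JK by (simp add: bexp_union mu_def of_bool_power2)
  then have "bexp p (J \<union> K) (\<lambda>A. (of_bool (A \<in> G))\<^sup>2)
      - bexp p J (\<lambda>B. (bexp p K (\<lambda>A. of_bool (B \<union> A \<in> G)))\<^sup>2) = V"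
    unfolding V_def by (simp add: mu_def bexp_diff[symmetric] power2_eq_square algebra_simps)
  with Vb have "(s + C) * V \<le> s * (s * (\<Sum>i\<in>K. infl p (J \<union> K) G i powr r) + C * (\<Sum>i\<in>J \<union> K. infl p (J \<union> K) G i))"
    by (simp add: energy_upset[OF G] infl_def)
  moreover have "s * V \<le> (s + C) * V"
    using C \<open>0 \<le> V\<close> by (simp add: distrib_right)
  ultimately have "V \<le> s * (\<Sum>i\<in>K. infl p (J \<union> K) G i powr r) + C * (\<Sum>i\<in>J \<union> K. infl p (J \<union> K) G i)"
    using s by (meson mult_le_cancel_left_pos order_trans)
  also have "\<dots> \<le> 1 * (\<Sum>i\<in>K. infl p (J \<union> K) G i powr r) + C * Q"
    using s C total by (intro add_mono mult_right_mono mult_left_mono sum_nonneg) auto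
  also have "(\<Sum>i\<in>K. infl p (J \<union> K) G i powr r) \<le> (\<Sum>i\<in>K. \<tau> powr (r - 1) * infl p (J \<union> K) G i)"
  proof (rule sum_mono)
    fix i assume i: "i \<in> K"
    have "infl p (J \<union> K) G i powr r = infl p (J \<union> K) G i powr (r - 1) * infl p (J \<union> K) G i"
      using I[of i] i r by (cases "infl p (J \<union> K) G i = 0") (auto simp: powr_diff)
    also have "\<dots> \<le> \<tau> powr (r - 1) * infl p (J \<union> K) G i"
      using I[of i] i r small[OF i] by (intro mult_right_mono powr_mono2) auto
    finally show "infl p (J \<union> K) G i powr r \<le> \<tau> powr (r - 1) * infl p (J \<union> K) G i" .
  qed
  also have "\<dots> \<le> \<tau> powr (r - 1) * (\<Sum>i\<in>J \<union> K. infl p (J \<union> K) G i)"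
    using I JK unfolding sum_distrib_left[symmetric] by (intro mult_left_mono sum_mono2) auto
  also have "\<dots> \<le> \<tau> powr (r - 1) * Q"
    using total by (intro mult_left_mono) auto
  finally show ?thesis
    by (simp add: V_def C_def algebra_simps)
qed

section \<open>Russo's formula and the growth of the log-odds\<close>

text \<open>The Margulis-Russo formula, for arbitrary functions because the induction passes to the
  restriction \<open>\<lambda>A. f (insert i A)\<close>.\<close>

lemma russo_bexp:
  assumes "finite N"
  shows "((\<lambda>p. bexp p N f) has_real_derivative (\<Sum>i\<in>N. bexp p N (dif i f))) (at p)"
  using assms
proof (induction N arbitrary: f rule: finite_induct)
  case (insert i N)
  let ?f1 = "\<lambda>A. f (insert i A)"
  have "(\<Sum>j\<in>N. bexp p (insert i N) (dif j f))
      = (\<Sum>j\<in>N. p * bexp p N (dif j ?f1) + (1 - p) * bexp p N (dif j f))"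
  proof (rule sum.cong[OF refl])
    fix j assume "j \<in> N"
    then have "i \<noteq> j" using insert.hyps by auto
    then show "bexp p (insert i N) (dif j f) = p * bexp p N (dif j ?f1) + (1 - p) * bexp p N (dif j f)"
      using bexp_dif_other[OF insert.hyps, where F = "\<lambda>x. x"] by simp
  qed
  also have "\<dots> = (\<Sum>j\<in>N. bexp p N (dif j ?f1)) * p + (\<Sum>j\<in>N. bexp p N (dif j f)) * (1 - p)"
    by (simp add: sum.distrib sum_distrib_left mult.commute)
  finally have val: "(\<Sum>j\<in>insert i N. bexp p (insert i N) (dif j f)) =
      (1 * bexp p N ?f1 + (\<Sum>j\<in>N. bexp p N (dif j ?f1)) * p) +
      ((0 - 1) * bexp p N f + (\<Sum>j\<in>N. bexp p N (dif j f)) * (1 - p))"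
    using insert.hyps bexp_dif_self[OF insert.hyps, where F = "\<lambda>x. x"] by (simp add: bexp_diff)
  show ?case
    unfolding val unfolding bexp_insert[OF insert.hyps]
    by (intro DERIV_add DERIV_mult DERIV_diff DERIV_ident DERIV_const insert.IH)
qed simp

lemma russo:
  assumes "finite N"
  shows "((\<lambda>p. mu p N G) has_real_derivative (\<Sum>i\<in>N. infl p N G i)) (at p)"
  unfolding mu_def infl_def using assms by (rule russo_bexp)

lemma mu_mono_p:
  assumes "upset N G" "finite N" "0 \<le> p" "p \<le> p'" "p' \<le> 1"
  shows "mu p N G \<le> mu p' N G"
proof (rule DERIV_nonneg_imp_nondecreasing[OF assms(4)])
  fix x assume "p \<le> x" "x \<le> p'"
  then have "0 \<le> (\<Sum>i\<in>N. infl x N G i)"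
    using assms infl_bounds[OF assms(1,2)] by (intro sum_nonneg) auto
  then show "\<exists>y. ((\<lambda>p. mu p N G) has_real_derivative y) (at x) \<and> 0 \<le> y"
    using russo[OF assms(2)] by blast
qed

text \<open>If all influences were at most \<open>1 - \<kappa>\<close>, the log-odds of the measure
  would grow at least \<open>1 + \<kappa> / 2\<close> times as fast as those of the bias. The latter
  gain at least \<open>z\<close> between \<open>p\<close> and \<open>c\<close>, which makes a
  surplus of at least \<open>\<kappa> * z / 2\<close>; the tolerance
  \<open>\<kappa> * z\<^sup>2 / 8\<close> in \<open>lo\<close> leaves room for only
  \<open>3 * \<kappa> * z / 8\<close>.\<close>

lemma large_influence:
  assumes z: "0 < z" "z \<le> p" "p + z \<le> c" "c < 1" and \<kappa>: "0 < \<kappa>" "\<kappa> \<le> 1"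
    and J: "finite J" and U: "upset J U"
    and lo: "p - \<kappa> * z\<^sup>2 / 8 \<le> mu p J U" and hi: "mu c J U \<le> c"
  shows "\<exists>x\<in>{p..c}. \<exists>i\<in>J. 1 - \<kappa> < infl x J U i"
proof (rule ccontr)
  assume "\<not> ?thesis"
  then have small: "infl x J U i \<le> 1 - \<kappa>" if "p \<le> x" "x \<le> c" "i \<in> J" for x i
    using that by (auto simp: not_less)
  define L where "L x = ln x - ln (1 - x)" for x :: real
  define e where "e = \<kappa> * z\<^sup>2 / 8"
  have "z < 1" using z by simp
  have e: "0 < e" "e \<le> z / 8" "3 * (e / z) < \<kappa> / 2 * z"
  proof -
    show "0 < e" using z \<kappa> by (simp add: e_def)
    have "\<kappa> * z\<^sup>2 \<le> 1 * (z * 1)"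
      unfolding power2_eq_square using z \<kappa> by (intro mult_mono) auto
    then show "e \<le> z / 8" by (simp add: e_def)
    show "3 * (e / z) < \<kappa> / 2 * z"
      using z \<kappa> by (simp add: e_def power2_eq_square field_simps)
  qed
  have h: "0 < mu x J U \<and> mu x J U < 1" if "p \<le> x" "x \<le> c" for x
  proof -
    have "mu p J U \<le> mu x J U" "mu x J U \<le> mu c J U"
      using that z by (auto intro!: mu_mono_p U J)
    then show ?thesis
      using lo hi z e by (simp add: e_def[symmetric])
  qed
  have L_mono: "L x \<le> L y" if "0 < x" "x \<le> y" "y < 1" for x y
    using that unfolding L_def by (intro diff_mono) auto
  define \<Psi> where "\<Psi> x = L (mu x J U) - (1 + \<kappa> / 2) * L x" for x
  have "\<Psi> p \<le> \<Psi> c"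
  proof (rule DERIV_nonneg_imp_nondecreasing[of p c \<Psi>])
    fix x assume x: "p \<le> x" "x \<le> c"
    define m D where "m = mu x J U" and "D = (\<Sum>i\<in>J. infl x J U i)"
    have x01: "0 < x" "x < 1" using x z by auto
    have m01: "0 < m" "m < 1" using h[OF x] by (auto simp: m_def)
    have "((\<lambda>x. L (mu x J U)) has_real_derivative (D / m - (0 - D) / (1 - m))) (at x)"
      unfolding L_def using m01 russo[OF J, of U x]
      by (auto intro!: derivative_eq_intros simp: m_def D_def)
    moreover have "(L has_real_derivative (1 / x - (0 - 1) / (1 - x))) (at x)"
      unfolding L_def using x01 by (auto intro!: derivative_eq_intros)
    ultimately have "(\<Psi> has_real_derivative (D / m - (0 - D) / (1 - m)) - (1 + \<kappa> / 2) * (1 / x - (0 - 1) / (1 - x))) (at x)"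
      unfolding \<Psi>_def by (intro DERIV_diff DERIV_cmult)
    moreover have "(D / m - (0 - D) / (1 - m)) - (1 + \<kappa> / 2) * (1 / x - (0 - 1) / (1 - x))
        = D / (m * (1 - m)) - (1 + \<kappa> / 2) / (x * (1 - x))"
      using x01 m01 by (simp add: field_simps)
    moreover have "(1 + \<kappa> / 2) / (x * (1 - x)) \<le> D / (m * (1 - m))"
    proof -
      have I0: "0 \<le> infl x J U i" if "i \<in> J" for i
        using infl_bounds[OF U J that] x01 by auto
      then have "D \<ge> 0" by (auto simp: D_def intro!: sum_nonneg)
      have "m * (1 - m) \<le> x * (1 - x) / 2 * (\<Sum>i\<in>J. infl x J U i + (infl x J U i)\<^sup>2)"
        unfolding m_def using x01 by (intro poincare_improved J U) auto
      moreover have "(\<Sum>i\<in>J. infl x J U i + (infl x J U i)\<^sup>2) \<le> (\<Sum>i\<in>J. (2 - \<kappa>) * infl x J U i)"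
      proof (rule sum_mono)
        fix i assume i: "i \<in> J"
        have "(infl x J U i)\<^sup>2 \<le> (1 - \<kappa>) * infl x J U i"
          unfolding power2_eq_square using small[OF x i] I0[OF i] by (intro mult_right_mono) auto
        then show "infl x J U i + (infl x J U i)\<^sup>2 \<le> (2 - \<kappa>) * infl x J U i"
          by (simp add: algebra_simps)
      qed
      then have "x * (1 - x) / 2 * (\<Sum>i\<in>J. infl x J U i + (infl x J U i)\<^sup>2) \<le> x * (1 - x) / 2 * ((2 - \<kappa>) * D)"
        using x01 by (intro mult_left_mono) (auto simp: D_def sum_distrib_left)
      moreover have "x * (1 - x) / 2 * ((2 - \<kappa>) * D) = x * (1 - x) * ((1 - \<kappa> / 2) * D)"
        by (simp add: field_simps)
      ultimately have "m * (1 - m) \<le> x * (1 - x) * ((1 - \<kappa> / 2) * D)"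
        by linarith
      \<comment> \<open>The rate is chosen here: times the factor \<open>1 - \<kappa> / 2\<close> of
        the Poincare bound, \<open>1 + \<kappa> / 2\<close> is at most 1.\<close>
      then have "(1 + \<kappa> / 2) * (m * (1 - m)) \<le> (1 + \<kappa> / 2) * (x * (1 - x) * ((1 - \<kappa> / 2) * D))"
        using \<kappa> by (intro mult_left_mono) auto
      also have "\<dots> = (1 - (\<kappa> / 2)\<^sup>2) * (x * (1 - x) * D)"
      proof -
        have "(1 + t) * (y * ((1 - t) * D)) = (1 - t\<^sup>2) * (y * D)" for t y :: real
          by (simp add: power2_eq_square algebra_simps)
        then show ?thesis .
      qed
      also have "\<dots> \<le> 1 * (x * (1 - x) * D)"
        using x01 \<open>D \<ge> 0\<close> by (intro mult_right_mono) auto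
      finally show ?thesis
        using x01 m01 by (simp add: divide_le_eq le_divide_eq mult.commute)
    qed
    ultimately show "\<exists>y. (\<Psi> has_real_derivative y) (at x) \<and> 0 \<le> y"
      by (metis diff_ge_0_iff_ge)
  qed (use z in auto)
  moreover have "L (mu c J U) \<le> L c"
    using h[of c] z hi by (intro L_mono) auto
  moreover have "L (p - e) \<le> L (mu p J U)"
    using h[of p] z lo e by (intro L_mono) (auto simp: e_def)
  \<comment> \<open>Since \<open>p - e\<close> is at least \<open>z / 2\<close> and
    \<open>1 - p\<close> at least \<open>z\<close>, the two logarithms contribute 2 and 1 times
    \<open>e / z\<close>.\<close>
  moreover have "L p - L (p - e) \<le> 3 * (e / z)"
  proof -
    have "ln p - ln (p - e) \<le> (p - (p - e)) / (p - e)"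
      using z e by (intro ln_diff_le) auto
    also have "\<dots> \<le> e / (z / 2)"
      using z e(1,2) divide_left_mono[of "z / 2" "p - e" e] by simp
    finally have "ln p - ln (p - e) \<le> 2 * (e / z)" by (simp add: mult.commute)
    moreover have "ln (1 - (p - e)) - ln (1 - p) \<le> ((1 - (p - e)) - (1 - p)) / (1 - p)"
      using z e by (intro ln_diff_le) auto
    then have "ln (1 - (p - e)) - ln (1 - p) \<le> e / (1 - p)" by simp
    moreover have "e / (1 - p) \<le> e / z"
      using z e by (auto intro!: divide_left_mono)
    ultimately show ?thesis by (simp add: L_def)
  qed
  moreover have "z \<le> L c - L p"
  proof -
    have "ln p - ln c \<le> (p - c) / c"
      using z by (intro ln_diff_le) auto
    moreover have "z \<le> (c - p) / c"
    proof -
      have "z * c \<le> (c - p) * 1"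
        using z by (smt (verit) mult_left_le)
      then show ?thesis using z by (simp add: field_simps)
    qed
    moreover have "(p - c) / c = - ((c - p) / c)"
      by (simp add: divide_simps)
    moreover have "ln (1 - c) \<le> ln (1 - p)"
      using z by auto
    ultimately show ?thesis by (simp add: L_def)
  qed
  moreover have "\<kappa> / 2 * z \<le> \<kappa> / 2 * (L c - L p)"
    using \<kappa> calculation(5) by (intro mult_left_mono) auto
  ultimately show False
    using e(3) unfolding \<Psi>_def distrib_right e_def[symmetric] right_diff_distrib by linarith
qed

text \<open>At a bias \<open>x\<close> where \<open>i\<close> has influence above
  \<open>1 - \<kappa>\<close>, this influence and the measure of \<open>?V\<close> add up to a
  probability, so \<open>?V\<close> has measure at most \<open>\<kappa>\<close>.\<close>

lemma dictator_stability:
  assumes z: "0 < z" "z \<le> p" "p + z \<le> c" "c < 1" and \<kappa>: "0 < \<kappa>" "\<kappa> \<le> 1"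
    and J: "finite J" and U: "upset J U"
    and "p - \<kappa> * z\<^sup>2 / 8 \<le> mu p J U" "mu c J U \<le> c"
  shows "\<exists>i\<in>J. mu p J {A\<in>U. i \<notin> A} \<le> \<kappa>"
proof -
  obtain x i where x: "p \<le> x" "x \<le> c" and i: "i \<in> J" and big: "1 - \<kappa> < infl x J U i"
    using large_influence[OF assms] by auto
  \<comment> \<open>Deleting \<open>i\<close> before the test yields an up-set, which the members of
    \<open>U\<close> missing \<open>i\<close> need not form; so the bound can be carried from
    \<open>x\<close> down to \<open>p\<close> by monotonicity in the bias.\<close>
  let ?V = "{A. A - {i} \<in> U}"
  have V: "upset J ?V"
    unfolding upset_def
  proof (intro allI impI)
    fix A B assume "A \<in> ?V" "A \<subseteq> B" "B \<subseteq> J"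
    then have "A - {i} \<in> U" "A - {i} \<subseteq> B - {i}" "B - {i} \<subseteq> J"
      by auto
    then show "B \<in> ?V"
      using U unfolding upset_def by blast
  qed
  have "infl x J U i + mu x J ?V = bexp x J (\<lambda>A. of_bool (insert i A \<in> U))"
    unfolding infl_def mu_def bexp_add[symmetric] by (simp add: dif_def)
  also have "\<dots> \<le> 1"
    using x z J by (intro bexp_le_1) auto
  finally have "mu x J ?V \<le> \<kappa>"
    using big by simp
  moreover have "mu p J ?V \<le> mu x J ?V"
    using V J x z by (intro mu_mono_p) auto
  moreover have "mu p J {A\<in>U. i \<notin> A} \<le> mu p J ?V"
    using z by (intro mu_mono) auto
  ultimately show ?thesis
    using i by (intro bexI[of _ i]) auto
qed

subsection \<open>Random tuples, correlated pairs and slices\<close>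

text \<open>Each element of \<open>N\<close> gets an independent label from \<open>T\<close> with
  weights \<open>c\<close>, and sets are read off from the labels. Labels in
  \<open>{..Suc d}\<close> couple \<open>d + 1\<close> sets, labels in
  \<open>bool \<times> bool\<close> couple two.\<close>

definition texp :: "('t \<Rightarrow> real) \<Rightarrow> 't set \<Rightarrow> 'a set \<Rightarrow> (('a \<Rightarrow> 't) \<Rightarrow> real) \<Rightarrow> real" where
  "texp c T N F = (\<Sum>x\<in>PiE N (\<lambda>_. T). (\<Prod>i\<in>N. c (x i)) * F x)"

lemma texp_insert:
  assumes "finite N" "i \<notin> N"
  shows "texp c T (insert i N) F = (\<Sum>t\<in>T. c t * texp c T N (\<lambda>x. F (x(i := t))))"
proof -
  let ?w = "\<lambda>x. (\<Prod>j\<in>insert i N. c (x j)) * F x"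
  have inj: "inj_on (\<lambda>(t, x). x(i := t)) (T \<times> PiE N (\<lambda>_. T))"
    using inj_combinator[OF assms(2), of "\<lambda>_. T"] by simp
  have w: "?w (x(i := t)) = c t * ((\<Prod>j\<in>N. c (x j)) * F (x(i := t)))" for x t
  proof -
    have "(\<Prod>j\<in>N. c ((x(i := t)) j)) = (\<Prod>j\<in>N. c (x j))"
      using assms(2) by (intro prod.cong) auto
    then show ?thesis
      using assms by simp
  qed
  have "texp c T (insert i N) F = sum ?w ((\<lambda>(t, x). x(i := t)) ` (T \<times> PiE N (\<lambda>_. T)))"
    unfolding texp_def PiE_insert_eq by simp
  also have "\<dots> = (\<Sum>(t, x)\<in>T \<times> PiE N (\<lambda>_. T). ?w (x(i := t)))"
    using inj by (subst sum.reindex) (auto intro!: sum.cong)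
  also have "\<dots> = (\<Sum>t\<in>T. \<Sum>x\<in>PiE N (\<lambda>_. T). ?w (x(i := t)))"
    by (simp add: sum.cartesian_product)
  finally show ?thesis
    unfolding w by (simp add: texp_def sum_distrib_left)
qed

lemma texp_empty [simp]: "texp c T {} F = F (\<lambda>_. undefined)"
  by (simp add: texp_def)

lemma texp_mono:
  assumes "\<And>t. t \<in> T \<Longrightarrow> 0 \<le> c t" "\<And>x. F x \<le> G x"
  shows "texp c T N F \<le> texp c T N G"
  unfolding texp_def using assms
  by (intro sum_mono mult_left_mono prod_nonneg) (auto dest: PiE_mem)

lemma texp_add: "texp c T N (\<lambda>x. F x + G x) = texp c T N F + texp c T N G"
  by (simp add: texp_def sum.distrib algebra_simps)

lemma texp_diff: "texp c T N (\<lambda>x. F x - G x) = texp c T N F - texp c T N G"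
  by (simp add: texp_def sum_subtractf algebra_simps)

lemma texp_cmult: "texp c T N (\<lambda>x. a * F x) = a * texp c T N F"
  by (simp add: texp_def sum_distrib_left algebra_simps)

lemma texp_sum: "texp c T N (\<lambda>x. \<Sum>j\<in>I. F j x) = (\<Sum>j\<in>I. texp c T N (F j))"
  unfolding texp_def by (simp add: sum_distrib_left) (rule sum.swap)

text \<open>The elements with label in \<open>S\<close> form a random set of bias
  \<open>sum c (T \<inter> S)\<close>; every marginal of a coupling is obtained from this.\<close>

lemma texp_marginal:
  fixes g :: "'a set \<Rightarrow> real"
  assumes "finite T" "sum c T = 1" "finite N"
  shows "texp c T N (\<lambda>x. g {j\<in>N. x j \<in> S}) = bexp (sum c (T \<inter> S)) N g"
  using assms(3)
proof (induction N arbitrary: g rule: finite_induct)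
  case (insert i N)
  define q where "q = sum c (T \<inter> S)"
  have q': "sum c (T - S) = 1 - q"
    using sum.Int_Diff[OF assms(1), of c S] assms(2) by (simp add: q_def)
  have *: "texp c T N (\<lambda>x. g {j \<in> insert i N. (x(i := t)) j \<in> S}) =
      (if t \<in> S then bexp q N (\<lambda>A. g (insert i A)) else bexp q N g)" for t
  proof -
    have "{j \<in> insert i N. (x(i := t)) j \<in> S} =
        (if t \<in> S then insert i {j\<in>N. x j \<in> S} else {j\<in>N. x j \<in> S})" for x
      using insert.hyps by auto
    then show ?thesis
      using insert.IH[of g] insert.IH[of "\<lambda>A. g (insert i A)"] by (auto simp: q_def)
  qed
  have "texp c T (insert i N) (\<lambda>x. g {j\<in>insert i N. x j \<in> S}) =
      (\<Sum>t\<in>T. c t * (if t \<in> S then bexp q N (\<lambda>A. g (insert i A)) else bexp q N g))"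
    unfolding texp_insert[OF insert.hyps] * ..
  also have "\<dots> = (\<Sum>t\<in>T \<inter> S. c t * bexp q N (\<lambda>A. g (insert i A))) + (\<Sum>t\<in>T - S. c t * bexp q N g)"
    by (subst sum.Int_Diff[OF assms(1), of _ S]) auto
  also have "\<dots> = q * bexp q N (\<lambda>A. g (insert i A)) + (1 - q) * bexp q N g"
    by (simp add: sum_distrib_right[symmetric] q' q_def[symmetric])
  also have "\<dots> = bexp q (insert i N) g"
    using insert.hyps by (simp add: bexp_insert)
  finally show ?case
    by (simp add: q_def)
qed simp

lemma texp_const:
  assumes "finite T" "sum c T = 1" "finite N"
  shows "texp c T N (\<lambda>x. a) = a"
  using texp_marginal[OF assms, of "\<lambda>_. a" T] assms by simp

lemma bexp_card:
  fixes p :: real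
  shows "finite N \<Longrightarrow> bexp p N (\<lambda>A. real (card A)) = p * card N"
proof (induction N rule: finite_induct)
  case (insert i N)
  have "bexp p N (\<lambda>A. real (card (insert i A))) = bexp p N (\<lambda>A. real (card A) + 1)"
  proof (rule bexp_cong)
    fix A assume "A \<subseteq> N"
    then have "card (insert i A) = Suc (card A)"
      using insert.hyps by (intro card_insert_disjoint) (auto dest: finite_subset)
    then show "real (card (insert i A)) = real (card A) + 1"
      by simp
  qed
  then show ?case
    using insert by (simp add: bexp_insert bexp_add algebra_simps)
qed simp

text \<open>The shift \<open>t\<close> is for the induction: fixing one coordinate changes it to
  \<open>t + 1 - p\<close> or \<open>t - p\<close>.\<close>

lemma bexp_card_variance:
  fixes p :: real
  shows "finite N \<Longrightarrow> bexp p N (\<lambda>A. (real (card A) - p * card N + t)\<^sup>2) = p * (1 - p) * card N + t\<^sup>2"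
proof (induction N arbitrary: t rule: finite_induct)
  case (insert i N)
  have "bexp p N (\<lambda>A. (real (card (insert i A)) - p * card (insert i N) + t)\<^sup>2)
      = bexp p N (\<lambda>A. (real (card A) - p * card N + (t + 1 - p))\<^sup>2)"
  proof (rule bexp_cong)
    fix A assume "A \<subseteq> N"
    then have "card (insert i A) = Suc (card A)"
      using insert.hyps by (intro card_insert_disjoint) (auto dest: finite_subset)
    then show "(real (card (insert i A)) - p * card (insert i N) + t)\<^sup>2
        = (real (card A) - p * card N + (t + 1 - p))\<^sup>2"
      using insert.hyps by (simp add: algebra_simps)
  qed
  moreover have "bexp p N (\<lambda>A. (real (card A) - p * card (insert i N) + t)\<^sup>2)
      = bexp p N (\<lambda>A. (real (card A) - p * card N + (t - p))\<^sup>2)"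
    using insert.hyps by (simp add: algebra_simps)
  ultimately show ?case
    using insert by (simp add: bexp_insert) (simp add: power2_eq_square algebra_simps)
qed simp

lemma markov_card:
  fixes p :: real
  assumes "finite N" "0 \<le> p" "p \<le> 1" "0 < s"
  shows "bexp p N (\<lambda>A. of_bool (s < real (card A))) \<le> p * card N / s"
proof -
  have "bexp p N (\<lambda>A. of_bool (s < real (card A))) \<le> bexp p N (\<lambda>A. (1 / s) * real (card A))"
    using assms by (intro bexp_mono) auto
  then show ?thesis
    using assms by (simp only: bexp_cmult bexp_card) simp
qed

lemma chebyshev_card:
  fixes p e :: real
  assumes "finite N" "N \<noteq> {}" "0 \<le> p" "p \<le> 1" "0 < e"
  shows "bexp p N (\<lambda>A. of_bool (e * card N < \<bar>real (card A) - p * card N\<bar>)) \<le> 1 / (4 * e\<^sup>2 * card N)"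
proof -
  let ?n = "real (card N)"
  have n: "?n > 0" using assms by auto
  have "bexp p N (\<lambda>A. of_bool (e * ?n < \<bar>real (card A) - p * ?n\<bar>))
      \<le> bexp p N (\<lambda>A. (1 / (e * ?n)\<^sup>2) * (real (card A) - p * ?n + 0)\<^sup>2)"
  proof (intro bexp_mono assms)
    fix A
    show "of_bool (e * ?n < \<bar>real (card A) - p * ?n\<bar>) \<le> 1 / (e * ?n)\<^sup>2 * (real (card A) - p * ?n + 0)\<^sup>2"
    proof (cases "e * ?n < \<bar>real (card A) - p * ?n\<bar>")
      case True
      then have "(e * ?n)\<^sup>2 \<le> \<bar>real (card A) - p * ?n\<bar>\<^sup>2"
        using assms n by (intro power_mono) auto
      then show ?thesis
        using True assms n by (simp add: field_simps)
    qed simp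
  qed
  also have "\<dots> = 1 / (e * ?n)\<^sup>2 * (p * (1 - p) * ?n)"
    using assms by (simp only: bexp_cmult bexp_card_variance) simp
  also have "\<dots> \<le> 1 / (e * ?n)\<^sup>2 * (1 / 4 * ?n)"
  proof -
    have "p * (1 - p) \<le> 1 / 4"
      using zero_le_power2[of "p - 1/2"] by (simp add: power2_eq_square algebra_simps)
    then show ?thesis
      using n by (intro mult_left_mono mult_right_mono) auto
  qed
  also have "\<dots> = 1 / (4 * e\<^sup>2 * ?n)"
    using n assms by (simp add: field_simps power2_eq_square)
  finally show ?thesis .
qed

text \<open>Union bound over a coupling whose sets never share a point: each has bias
  \<open>u * d / (d + 1)\<close>, and all lie in one set of bias \<open>u\<close>. The left side of
  \<open>less\<close> bounds the chance that some set leaves its \<open>H j\<close> or that this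
  superset is too large.\<close>

lemma random_cluster:
  fixes H :: "nat \<Rightarrow> 'a set set"
  assumes N: "finite N" and u: "0 \<le> u" "u \<le> 1"
    and less: "(\<Sum>j\<le>d. 1 - mu (u * real d / (real d + 1)) N (H j)) + bexp u N (\<lambda>X. of_bool (s < real (card X))) < 1"
  shows "\<exists>A. (\<forall>j\<le>d. A j \<in> H j \<and> A j \<subseteq> N) \<and> (\<Inter>j\<le>d. A j) = {} \<and> real (card (\<Union>j\<le>d. A j)) \<le> s"
proof (rule ccontr)
  assume contra: "\<not> ?thesis"
  txt \<open>An element with outcome \<open>t \<le> d\<close> lies in all sets but the one with index \<open>t\<close>; outcome
    \<open>d + 1\<close> leaves it out of all of them.\<close>
  define c where "c t = (if t \<le> d then u / (d + 1) else 1 - u)" for t :: nat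
  define A where "A x j = {i\<in>N. x i \<in> {..d} - {j}}" for x :: "'a \<Rightarrow> nat" and j
  define X where "X x = {i\<in>N. x i \<in> {..d}}" for x :: "'a \<Rightarrow> nat"
  have c_nn: "0 \<le> c t" for t
    using u by (simp add: c_def)
  have cd: "sum c {..d} = u"
    by (simp add: c_def add.commute)
  have c1: "sum c {..Suc d} = 1"
    using cd by (simp add: c_def)
  have cj: "sum c ({..Suc d} \<inter> ({..d} - {j})) = u * real d / (real d + 1)" if "j \<le> d" for j
  proof -
    have "{..Suc d} \<inter> ({..d} - {j}) = {..d} - {j}" by auto
    moreover have "sum c ({..d} - {j}) = sum c {..d} - c j"
      using that by (simp add: sum_diff1)
    ultimately show ?thesis
      using that unfolding cd by (simp add: c_def field_simps)
  qed
  have cu: "sum c ({..Suc d} \<inter> {..d}) = u"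
    using cd by (simp add: Int_absorb1)
  have "1 \<le> (\<Sum>j\<le>d. 1 - of_bool (A x j \<in> H j)) + (of_bool (s < real (card (X x))) :: real)" for x
  proof (rule ccontr)
    assume neg: "\<not> ?thesis"
    have nn: "0 \<le> (1 - of_bool (A x j \<in> H j) :: real)" for j by auto
    have 1: "A x j \<in> H j" if "j \<le> d" for j
    proof (rule ccontr)
      assume "A x j \<notin> H j"
      then have "of_bool (A x j \<in> H j) = (0 :: real)"
        by simp
      moreover have "(1 - of_bool (A x j \<in> H j) :: real) \<le> (\<Sum>j\<le>d. 1 - of_bool (A x j \<in> H j))"
        using that nn by (intro member_le_sum) auto
      moreover have "(0::real) \<le> of_bool (s < real (card (X x)))"
        by simp
      ultimately show False
        using neg by linarith
    qed
    have "0 \<le> (\<Sum>j\<le>d. 1 - of_bool (A x j \<in> H j) :: real)"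
      using nn by (intro sum_nonneg)
    then have 2: "real (card (X x)) \<le> s"
      using neg by (cases "s < real (card (X x))") auto
    have "(\<Union>j\<le>d. A x j) \<subseteq> X x"
      by (auto simp: A_def X_def)
    then have "real (card (\<Union>j\<le>d. A x j)) \<le> s"
      using N 2 card_mono[of "X x" "\<Union>j\<le>d. A x j"] by (simp add: X_def)
    moreover have "(\<Inter>j\<le>d. A x j) = {}"
      by (auto simp: A_def)
    moreover have "A x j \<subseteq> N" for j
      by (auto simp: A_def)
    ultimately show False
      using contra 1 by blast
  qed
  then have "texp c {..Suc d} N (\<lambda>x. 1) \<le>
      texp c {..Suc d} N (\<lambda>x. (\<Sum>j\<le>d. 1 - of_bool (A x j \<in> H j)) + of_bool (s < real (card (X x))))"
    using c_nn by (intro texp_mono)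
  also have "\<dots> = (\<Sum>j\<le>d. texp c {..Suc d} N (\<lambda>x. 1) - texp c {..Suc d} N (\<lambda>x. of_bool (A x j \<in> H j)))
      + texp c {..Suc d} N (\<lambda>x. of_bool (s < real (card (X x))))"
    by (simp add: texp_add texp_diff texp_sum)
  also have "\<dots> = (\<Sum>j\<le>d. 1 - mu (u * real d / (real d + 1)) N (H j)) + bexp u N (\<lambda>X. of_bool (s < real (card X)))"
  proof -
    have "texp c {..Suc d} N (\<lambda>x. of_bool (A x j \<in> H j)) = mu (u * real d / (real d + 1)) N (H j)" if "j \<le> d" for j
      using texp_marginal[OF finite_atMost c1 N, of "\<lambda>X. of_bool (X \<in> H j)" "{..d} - {j}"]
      unfolding cj[OF that] A_def mu_def .
    moreover have "texp c {..Suc d} N (\<lambda>x. of_bool (s < real (card (X x)))) = bexp u N (\<lambda>X. of_bool (s < real (card X)))"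
      using texp_marginal[OF finite_atMost c1 N, of "\<lambda>X. of_bool (s < real (card X))" "{..d}"]
      unfolding cu X_def .
    ultimately show ?thesis
      unfolding texp_const[OF finite_atMost c1 N]
      by (metis (mono_tags, lifting) atMost_iff sum.cong)
  qed
  finally show False
    using less c1 N by (simp add: texp_const)
qed

text \<open>For \<open>u = 1\<close> every element is withheld from exactly one set and the size
  condition is void, so a larger measure would yield \<open>d + 1\<close> members of
  \<open>U\<close> without a common point.\<close>

lemma mu_intersecting:
  assumes J: "finite J" and U: "\<And>A. (\<forall>j\<le>d. A j \<in> U \<and> A j \<subseteq> J) \<Longrightarrow> (\<Inter>j\<le>d. A j) \<noteq> {}"
  shows "mu (real d / (real d + 1)) J U \<le> real d / (real d + 1)"
proof (rule ccontr)
  assume "\<not> ?thesis"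
  then have "real d < mu (real d / (real d + 1)) J U * (real d + 1)"
    by (simp add: pos_divide_less_eq not_le add.commute)
  then have "(\<Sum>j\<le>d. 1 - mu (1 * real d / (real d + 1)) J U) < 1"
    by (simp add: algebra_simps)
  moreover have "bexp 1 J (\<lambda>X. of_bool (real (card J) < real (card X))) \<le> bexp 1 J (\<lambda>X. 0)"
    using J card_mono by (intro bexp_mono) (auto simp: not_less)
  moreover have "bexp 1 J (\<lambda>X. 0) = 0"
    using J by simp
  ultimately have "(\<Sum>j\<le>d. 1 - mu (1 * real d / (real d + 1)) J U)
      + bexp 1 J (\<lambda>X. of_bool (real (card J) < real (card X))) < 1"
    by linarith
  from random_cluster[OF J _ _ this] show False
    using U by auto
qed

section \<open>Permutation symmetry, from slices to the cube\<close>

lemma exists_permutes_image: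
  assumes "finite N" "A \<subseteq> N" "B \<subseteq> N" "card A = card B"
  shows "\<exists>\<sigma>. \<sigma> permutes N \<and> \<sigma> ` A = B"
proof -
  have fin: "finite A" "finite B"
    using assms finite_subset by auto
  then obtain f where f: "bij_betw f A B"
    using assms(4) by (meson finite_same_card_bij)
  have "card (N - A) = card (N - B)"
    using assms fin by (simp add: card_Diff_subset)
  then obtain g where g: "bij_betw g (N - A) (N - B)"
    using assms(1) by (meson finite_Diff finite_same_card_bij)
  define \<sigma> where "\<sigma> x = (if x \<in> A then f x else if x \<in> N then g x else x)" for x
  have A: "bij_betw \<sigma> A B"
    using f by (rule bij_betw_cong[THEN iffD1, rotated]) (simp add: \<sigma>_def)
  have "bij_betw \<sigma> (N - A) (N - B)"
    using g by (rule bij_betw_cong[THEN iffD1, rotated]) (simp add: \<sigma>_def)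
  with A have "bij_betw \<sigma> (A \<union> (N - A)) (B \<union> (N - B))"
    by (intro bij_betw_combine) auto
  then have "bij_betw \<sigma> N N"
    using assms by (simp add: Un_absorb1 Un_commute)
  then have "\<sigma> permutes N"
    using assms(2) by (intro bij_imp_permutes) (auto simp: \<sigma>_def)
  moreover have "\<sigma> ` A = B"
    using A by (simp add: bij_betw_def)
  ultimately show ?thesis by blast
qed

lemma bexp_permute:
  assumes "\<sigma> permutes N" "finite N"
  shows "bexp p N (\<lambda>X. f (\<sigma> ` X)) = bexp p N f"
proof -
  have inj: "inj_on \<sigma> X" for X
    using permutes_inj[OF assms(1)] by (auto simp: inj_on_def)
  have bij: "bij_betw (image \<sigma>) (Pow N) (Pow N)"
    using permutes_imp_bij[OF assms(1)] by (rule bij_betw_Pow)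
  have "card (N - \<sigma> ` X) = card (N - X)" if "X \<subseteq> N" for X
  proof -
    have "N - \<sigma> ` X = \<sigma> ` (N - X)"
      using image_set_diff[of \<sigma> N X] permutes_inj[OF assms(1)] permutes_image[OF assms(1)] by simp
    then show ?thesis
      using inj by (simp add: card_image)
  qed
  then have "bexp p N (\<lambda>X. f (\<sigma> ` X)) =
      (\<Sum>X\<in>Pow N. p ^ card (\<sigma> ` X) * (1 - p) ^ card (N - \<sigma> ` X) * f (\<sigma> ` X))"
    unfolding bexp_def using inj by (intro sum.cong) (auto simp: card_image)
  also have "\<dots> = bexp p N f"
    unfolding bexp_def using bij by (rule sum.reindex_bij_betw)
  finally show ?thesis .
qed

text \<open>For \<open>card X < k\<close> the denominator is 0 and the value is 0 by default; hence
  the indicator of \<open>k \<le> card X\<close> in \<open>bexp_local_density\<close>.\<close>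

definition local_density :: "nat \<Rightarrow> 'a set set \<Rightarrow> 'a set \<Rightarrow> real" where
  "local_density k F X = real (card {A\<in>F. A \<subseteq> X}) / real (card X choose k)"

lemma local_density_bounds:
  assumes "finite X" "\<And>A. A \<in> F \<Longrightarrow> card A = k"
  shows "0 \<le> local_density k F X" "local_density k F X \<le> 1"
proof -
  have "card {A\<in>F. A \<subseteq> X} \<le> card {A. A \<subseteq> X \<and> card A = k}"
    using assms by (intro card_mono) auto
  then have "card {A\<in>F. A \<subseteq> X} \<le> card X choose k"
    using n_subsets[OF assms(1)] by simp
  then show "local_density k F X \<le> 1"
    unfolding local_density_def by (auto simp: divide_le_eq_1)
qed (simp add: local_density_def)

text \<open>By symmetry all \<open>k\<close>-sets enter the left side with one common weight, which
  is found from the family of all \<open>k\<close>-sets. This converts sizes in a slice into means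
  over the cube.\<close>

lemma bexp_local_density:
  assumes N: "finite N" and F: "\<And>A. A \<in> F \<Longrightarrow> A \<subseteq> N \<and> card A = k"
  shows "real (card N choose k) * bexp p N (local_density k F)
    = real (card F) * bexp p N (\<lambda>X. of_bool (k \<le> card X))"
proof -
  define w where "w A = bexp p N (\<lambda>X. of_bool (A \<subseteq> X) / real (card X choose k))" for A
  define S where "S = {A. A \<subseteq> N \<and> card A = k}"
  have finS: "finite S" using N by (auto simp: S_def)
  have FS: "F \<subseteq> S" using F by (auto simp: S_def)
  have dens: "local_density k G X = (\<Sum>A\<in>G. of_bool (A \<subseteq> X) / real (card X choose k))" if "G \<subseteq> S" for G X
  proof -
    have "finite G" using that finS by (rule finite_subset)
    note count = sum_of_bool_eq[OF this this, of "\<lambda>A. A \<subseteq> X"]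
    have "{A\<in>G. A \<subseteq> X} = G \<inter> {A. A \<subseteq> X}"
      by auto
    then show ?thesis
      unfolding local_density_def sum_divide_distrib[symmetric] count by (rule arg_cong)
  qed
  have bw: "bexp p N (local_density k G) = (\<Sum>A\<in>G. w A)" if "G \<subseteq> S" for G
    unfolding w_def dens[OF that] bexp_sum[symmetric] ..
  have w_eq: "w A = w B" if AB: "A \<in> S" "B \<in> S" for A B
  proof -
    have "\<exists>\<sigma>. \<sigma> permutes N \<and> \<sigma> ` A = B"
      by (rule exists_permutes_image) (use N AB in \<open>auto simp: S_def\<close>)
    then obtain \<sigma> where \<sigma>: "\<sigma> permutes N" "\<sigma> ` A = B"
      by blast
    have "w B = bexp p N (\<lambda>X. of_bool (B \<subseteq> \<sigma> ` X) / real (card (\<sigma> ` X) choose k))"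
      unfolding w_def
      using bexp_permute[OF \<sigma>(1) N, of p "\<lambda>X. of_bool (B \<subseteq> X) / real (card X choose k)"] by (rule sym)
    also have "\<dots> = w A"
      unfolding w_def
    proof (rule bexp_cong)
      fix X
      have "\<sigma> ` A \<subseteq> \<sigma> ` X \<longleftrightarrow> A \<subseteq> X"
        by (rule inj_image_subset_iff[OF permutes_inj[OF \<sigma>(1)]])
      moreover have "card (\<sigma> ` X) = card X"
        by (rule card_image, rule inj_on_subset[OF permutes_inj[OF \<sigma>(1)]]) simp
      ultimately show "of_bool (B \<subseteq> \<sigma> ` X) / real (card (\<sigma> ` X) choose k) = of_bool (A \<subseteq> X) / real (card X choose k)"
        unfolding \<sigma>(2) by (simp only:)
    qed
    finally show ?thesis by simp
  qed
  have "bexp p N (local_density k S) = bexp p N (\<lambda>X. of_bool (k \<le> card X))"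
  proof (rule bexp_cong)
    fix X assume X: "X \<subseteq> N"
    then have "{A\<in>S. A \<subseteq> X} = {A. A \<subseteq> X \<and> card A = k}" "finite X"
      using N finite_subset by (auto simp: S_def)
    then show "local_density k S X = of_bool (k \<le> card X)"
      using n_subsets[of X k] by (simp add: local_density_def)
  qed
  then have tot: "(\<Sum>A\<in>S. w A) = bexp p N (\<lambda>X. of_bool (k \<le> card X))"
    using bw[of S] by simp
  show ?thesis
  proof (cases "F = {}")
    case False
    then obtain A0 where A0: "A0 \<in> F" by auto
    have "w A = w A0" if "A \<in> S" for A
      using that A0 FS by (intro w_eq) auto
    then have const: "(\<Sum>A\<in>G. w A) = real (card G) * w A0" if "G \<subseteq> S" for G
      using that sum.cong[of G G w "\<lambda>_. w A0"] by (simp add: subset_iff)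
    have "card S = card N choose k"
      unfolding S_def using n_subsets[OF N] by simp
    then show ?thesis
      using tot bw[OF FS] const[OF FS] const[of S] by simp
  qed (simp add: bw)
qed

section \<open>Small-set expansion for correlated pairs\<close>

text \<open>\<open>c\<close> is the joint law of membership in two sets. The estimate tensorises:
  the induction hypothesis treats the four pairs of restrictions, and the one-coordinate estimate is
  applied to their norms.\<close>

lemma pair_tensor:
  fixes f g :: "'a set \<Rightarrow> real" and c :: "bool \<times> bool \<Rightarrow> real"
  assumes p: "0 \<le> p" "p \<le> 1" and q: "0 < q" and c: "\<And>t. 0 \<le> c t"
    and two: "\<And>F1 F0 G1 G0. 0 \<le> F1 \<Longrightarrow> 0 \<le> F0 \<Longrightarrow> 0 \<le> G1 \<Longrightarrow> 0 \<le> G0 \<Longrightarrow>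
      c (True, True) * (F1 * G1) + c (True, False) * (F1 * G0)
        + c (False, True) * (F0 * G1) + c (False, False) * (F0 * G0)
      \<le> sqrt (p * F1\<^sup>2 + (1 - p) * F0\<^sup>2) * (p * G1 powr q + (1 - p) * G0 powr q) powr (1/q)"
    and "finite N" "\<And>A. A \<subseteq> N \<Longrightarrow> 0 \<le> f A" "\<And>A. A \<subseteq> N \<Longrightarrow> 0 \<le> g A"
  shows "texp c UNIV N (\<lambda>x. f {i\<in>N. fst (x i)} * g {i\<in>N. snd (x i)})
    \<le> sqrt (bexp p N (\<lambda>A. (f A)\<^sup>2)) * bexp p N (\<lambda>A. g A powr q) powr (1/q)"
  using assms(6-)
proof (induction N arbitrary: f g rule: finite_induct)
  case empty
  then show ?case
    using q by (simp add: powr_powr)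
next
  case (insert i N)
  let ?f1 = "\<lambda>A. f (insert i A)" and ?g1 = "\<lambda>A. g (insert i A)"
  define P where "P F = sqrt (bexp p N (\<lambda>A. (F A)\<^sup>2))" for F
  define Q where "Q G = bexp p N (\<lambda>A. G A powr q) powr (1/q)" for G
  have PQ: "0 \<le> P F" "0 \<le> Q F" "(P F)\<^sup>2 = bexp p N (\<lambda>A. (F A)\<^sup>2)" "Q F powr q = bexp p N (\<lambda>A. F A powr q)" for F
  proof -
    have "0 \<le> bexp p N (\<lambda>A. F A powr q)" "0 \<le> bexp p N (\<lambda>A. (F A)\<^sup>2)"
      using p by (auto intro!: bexp_nonneg)
    then show "0 \<le> P F" "0 \<le> Q F" "(P F)\<^sup>2 = bexp p N (\<lambda>A. (F A)\<^sup>2)" "Q F powr q = bexp p N (\<lambda>A. F A powr q)"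
      using q by (auto simp: P_def Q_def powr_powr)
  qed
  define X where "X x = {j\<in>N. fst (x j)}" for x :: "'a \<Rightarrow> bool \<times> bool"
  define Y where "Y x = {j\<in>N. snd (x j)}" for x :: "'a \<Rightarrow> bool \<times> bool"
  have X': "{j\<in>insert i N. fst ((x(i := t)) j)} = (if fst t then insert i (X x) else X x)" for x t
    using insert.hyps by (auto simp: X_def)
  have Y': "{j\<in>insert i N. snd ((x(i := t)) j)} = (if snd t then insert i (Y x) else Y x)" for x t
    using insert.hyps by (auto simp: Y_def)
  have IH: "texp c UNIV N (\<lambda>x. F (X x) * G (Y x)) \<le> P F * Q G"
    if "\<And>A. A \<subseteq> N \<Longrightarrow> 0 \<le> F A" "\<And>A. A \<subseteq> N \<Longrightarrow> 0 \<le> G A" for F G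
    unfolding P_def Q_def X_def Y_def by (rule insert.IH) (use that in auto)
  have nn: "0 \<le> ?f1 A" "0 \<le> f A" "0 \<le> ?g1 A" "0 \<le> g A" if "A \<subseteq> N" for A
    using that by (auto intro!: insert.prems)
  have UNIV_pairs: "(\<Sum>t\<in>UNIV. H t) = H (True, True) + H (True, False) + H (False, True) + H (False, False)"
    for H :: "bool \<times> bool \<Rightarrow> real"
    unfolding UNIV_Times_UNIV[symmetric] UNIV_bool by simp
  have "texp c UNIV (insert i N) (\<lambda>x. f {j\<in>insert i N. fst (x j)} * g {j\<in>insert i N. snd (x j)})
      = c (True, True) * texp c UNIV N (\<lambda>x. ?f1 (X x) * ?g1 (Y x))
      + c (True, False) * texp c UNIV N (\<lambda>x. ?f1 (X x) * g (Y x))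
      + c (False, True) * texp c UNIV N (\<lambda>x. f (X x) * ?g1 (Y x))
      + c (False, False) * texp c UNIV N (\<lambda>x. f (X x) * g (Y x))"
    unfolding texp_insert[OF insert.hyps] X' Y' UNIV_pairs by simp
  also have "\<dots> \<le> c (True, True) * (P ?f1 * Q ?g1) + c (True, False) * (P ?f1 * Q g)
      + c (False, True) * (P f * Q ?g1) + c (False, False) * (P f * Q g)"
    using c nn by (intro add_mono mult_left_mono IH) auto
  also have "\<dots> \<le> sqrt (p * (P ?f1)\<^sup>2 + (1 - p) * (P f)\<^sup>2) * (p * Q ?g1 powr q + (1 - p) * Q g powr q) powr (1/q)"
    by (intro two PQ)
  also have "\<dots> = sqrt (bexp p (insert i N) (\<lambda>A. (f A)\<^sup>2)) * bexp p (insert i N) (\<lambda>A. g A powr q) powr (1/q)"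
    using insert.hyps by (simp add: PQ bexp_insert)
  finally show ?case .
qed

text \<open>The left side is the product of the means plus the covariance \<open>s - \<tau>\<close>
  times the product of the differences. By Cauchy-Schwarz it suffices that the 2/r-norm of
  \<open>G\<close> dominates the mean and the reduced variance
  \<open>(s - \<tau>)\<^sup>2 / s * (G1 - G0)\<^sup>2\<close>; \<open>two_point\<close> gives this
  if its error is at most the reduction.\<close>

lemma two_point_pair:
  fixes p p0 r \<tau> F1 F0 G1 G0 :: real
  assumes p: "0 < p0" "p0 \<le> p" "p \<le> 1 - p0" and r: "1 \<le> r" "r \<le> 2"
    and \<tau>: "(r - 1) / p0 \<le> \<tau> * (2 * (p * (1 - p)) - \<tau>)"
    and nn: "0 \<le> F1" "0 \<le> F0" "0 \<le> G1" "0 \<le> G0"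
  shows "(p - \<tau>) * (F1 * G1) + \<tau> * (F1 * G0) + \<tau> * (F0 * G1) + (1 - p - \<tau>) * (F0 * G0)
      \<le> sqrt (p * F1\<^sup>2 + (1 - p) * F0\<^sup>2) * (p * G1 powr (2/r) + (1 - p) * G0 powr (2/r)) powr (1/(2/r))"
proof -
  define s where "s = p * (1 - p)"
  have s: "0 < s" "s \<le> 1"
    using p by (auto simp: s_def intro!: mult_le_one)
  define mF mG where "mF = p * F1 + (1 - p) * F0" and "mG = p * G1 + (1 - p) * G0"
  define M where "M = p * G1 powr (2/r) + (1 - p) * G0 powr (2/r)"
  have M: "0 \<le> M" using p by (simp add: M_def)
  have G2: "(G powr (2/r)) powr r = G\<^sup>2" "(G powr (2/r)) powr (r/2) = G" if "0 \<le> G" for G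
    using that r by (auto simp: powr_powr)
  have 1: "p * G1\<^sup>2 + (1 - p) * G0\<^sup>2 \<le> M powr r + (r - 1) / p0 * (G1 - G0)\<^sup>2"
    using two_point[OF p r, of "G1 powr (2/r)" "G0 powr (2/r)"] nn by (simp add: G2 M_def)
  \<comment> \<open>The reduction is \<open>\<tau> * (2 * s - \<tau>) / s\<close>, and
    \<open>s \<le> 1\<close> permits dropping the denominator.\<close>
  have "\<tau> * (2 * s - \<tau>) \<le> \<tau> * (2 * s - \<tau>) / s"
  proof -
    have "0 \<le> (r - 1) / p0" using p r by simp
    then have "0 \<le> \<tau> * (2 * s - \<tau>)" using \<tau> by (simp add: s_def)
    then show ?thesis
      using s divide_left_mono[of s 1 "\<tau> * (2 * s - \<tau>)"] by simp
  qed
  also have "\<dots> = s - (s - \<tau>)\<^sup>2 / s"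
    using s by (simp add: field_simps power2_eq_square)
  finally have "(r - 1) / p0 \<le> s - (s - \<tau>)\<^sup>2 / s"
    using \<tau> by (simp add: s_def)
  then have "(r - 1) / p0 * (G1 - G0)\<^sup>2 \<le> (s - (s - \<tau>)\<^sup>2 / s) * (G1 - G0)\<^sup>2"
    by (intro mult_right_mono) auto
  moreover have "p * G1\<^sup>2 + (1 - p) * G0\<^sup>2 = mG\<^sup>2 + s * (G1 - G0)\<^sup>2"
    by (simp add: mG_def s_def power2_eq_square algebra_simps)
  ultimately have G: "mG\<^sup>2 + (s - \<tau>)\<^sup>2 / s * (G1 - G0)\<^sup>2 \<le> M powr r"
    using 1 by (simp add: algebra_simps)
  have F: "mF\<^sup>2 + s * (F1 - F0)\<^sup>2 = p * F1\<^sup>2 + (1 - p) * F0\<^sup>2"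
    by (simp add: mF_def s_def power2_eq_square algebra_simps)
  define a b a' b' where "a = mF" and "b = mG" and "a' = sqrt s * (F1 - F0)" and "b' = (s - \<tau>) / sqrt s * (G1 - G0)"
  have sq: "a'\<^sup>2 = s * (F1 - F0)\<^sup>2" "b'\<^sup>2 = (s - \<tau>)\<^sup>2 / s * (G1 - G0)\<^sup>2" "a' * b' = (s - \<tau>) * ((F1 - F0) * (G1 - G0))"
    using s by (auto simp: a'_def b'_def power_mult_distrib power_divide)
  have "(a * b + a' * b')\<^sup>2 \<le> (a\<^sup>2 + a'\<^sup>2) * (b\<^sup>2 + b'\<^sup>2)"
    using zero_le_power2[of "a * b' - a' * b"] by (simp add: power2_eq_square algebra_simps)
  also have "\<dots> \<le> (p * F1\<^sup>2 + (1 - p) * F0\<^sup>2) * M powr r"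
    using G F s p unfolding sq a_def b_def by (intro mult_mono) auto
  also have "\<dots> = (sqrt (p * F1\<^sup>2 + (1 - p) * F0\<^sup>2) * M powr (1/(2/r)))\<^sup>2"
    using p M by (simp add: power_mult_distrib power2_eq_square[of "M powr _"] flip: powr_add)
  finally have "a * b + a' * b' \<le> sqrt (p * F1\<^sup>2 + (1 - p) * F0\<^sup>2) * M powr (1/(2/r))"
    by (rule power2_le_imp_le) (use p in simp)
  moreover have "(p - \<tau>) * (F1 * G1) + \<tau> * (F1 * G0) + \<tau> * (F0 * G1) + (1 - p - \<tau>) * (F0 * G0) = a * b + a' * b'"
    unfolding sq a_def b_def mF_def mG_def s_def by (simp add: algebra_simps)
  ultimately show ?thesis
    unfolding M_def by simp
qed

subsection \<open>Juntas\<close>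

text \<open>By the mean value theorem some bias in the interval has total influence at most
  \<open>1 / \<delta>\<close>, so at most \<open>1 / (\<delta> * \<tau>)\<close> influences exceed
  \<open>\<tau>\<close>, a bound independent of \<open>N\<close> and \<open>G\<close>. The choice of
  \<open>r\<close> and \<open>\<tau>\<close> makes each of the two error terms of
  \<open>junta_variance\<close> at most \<open>e / 2\<close>.\<close>

lemma junta_extract:
  fixes p0 \<delta> e :: real
  assumes "0 < p0" "0 < \<delta>" "0 < e"
  shows "\<exists>M. \<forall>(N :: 'a set) G a. finite N \<longrightarrow> upset N G \<longrightarrow> p0 \<le> a \<longrightarrow> a + \<delta> \<le> 1 - p0 \<longrightarrow>
    (\<exists>p J. a \<le> p \<and> p \<le> a + \<delta> \<and> J \<subseteq> N \<and> real (card J) \<le> M \<and>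
      bexp p J (\<lambda>B. mu p (N - J) {C. B \<union> C \<in> G} * (1 - mu p (N - J) {C. B \<union> C \<in> G})) \<le> e)"
proof -
  define r where "r = 1 + min 1 (e * \<delta> * p0 / 2)"
  define \<tau> where "\<tau> = (e * \<delta> / 2) powr (1 / (r - 1))"
  have r: "1 < r" "r \<le> 2" "r - 1 \<le> e * \<delta> * p0 / 2"
    using assms by (auto simp: r_def)
  have \<tau>: "0 < \<tau>" "\<tau> powr (r - 1) = e * \<delta> / 2"
    using assms r by (auto simp: \<tau>_def powr_powr)
  show ?thesis
  proof (rule exI[of _ "1 / \<delta> / \<tau>"], intro allI impI)
    fix N :: "'a set" and G a
    assume N: "finite N" and G: "upset N G" and a: "p0 \<le> a" "a + \<delta> \<le> 1 - p0"
    have "\<exists>p>a. p < a + \<delta> \<and> mu (a + \<delta>) N G - mu a N G = (a + \<delta> - a) * (\<Sum>i\<in>N. infl p N G i)"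
      using assms russo[OF N] by (intro MVT2) auto
    then obtain p where p: "a < p" "p < a + \<delta>"
      and mv: "mu (a + \<delta>) N G - mu a N G = \<delta> * (\<Sum>i\<in>N. infl p N G i)"
      by auto
    have "\<delta> * (\<Sum>i\<in>N. infl p N G i) \<le> 1"
      using mu_bounds[OF N, of "a + \<delta>" G] mu_bounds[OF N, of a G] a assms mv by linarith
    then have total: "(\<Sum>i\<in>N. infl p N G i) \<le> 1 / \<delta>"
      using assms by (simp add: field_simps)
    define J where "J = {i\<in>N. \<tau> < infl p N G i}"
    have J: "J \<subseteq> N" "finite J" "J \<union> (N - J) = N"
      using N by (auto simp: J_def)
    have "real (card J) * \<tau> = (\<Sum>i\<in>J. \<tau>)" by simp
    also have "\<dots> \<le> (\<Sum>i\<in>J. infl p N G i)"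
      by (intro sum_mono) (auto simp: J_def)
    also have "\<dots> \<le> (\<Sum>i\<in>N. infl p N G i)"
      using infl_bounds[OF G N] p a assms J N by (intro sum_mono2) auto
    finally have "real (card J) * \<tau> \<le> 1 / \<delta>"
      using total by linarith
    then have card_J: "real (card J) \<le> 1 / \<delta> / \<tau>"
      using pos_le_divide_eq[OF \<tau>(1)] by blast
    have "bexp p J (\<lambda>B. mu p (N - J) {C. B \<union> C \<in> G} * (1 - mu p (N - J) {C. B \<union> C \<in> G}))
        \<le> (\<tau> powr (r - 1) + (r - 1) / p0) * (1 / \<delta>)"
    proof (rule junta_variance)
      show "upset (J \<union> (N - J)) G" "(\<Sum>i\<in>J \<union> (N - J). infl p (J \<union> (N - J)) G i) \<le> 1 / \<delta>"
        using J G total by auto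
      show "infl p (J \<union> (N - J)) G i \<le> \<tau>" if "i \<in> N - J" for i
        using that J unfolding J(3) by (auto simp: J_def)
    qed (use p a assms r \<tau> N J in auto)
    also have "\<dots> \<le> (e * \<delta> / 2 + e * \<delta> / 2) * (1 / \<delta>)"
      using r(3) assms unfolding \<tau>(2) by (intro mult_right_mono add_left_mono) (auto simp: field_simps)
    also have "\<dots> = e"
      using assms by simp
    finally show "\<exists>p J. a \<le> p \<and> p \<le> a + \<delta> \<and> J \<subseteq> N \<and> real (card J) \<le> 1 / \<delta> / \<tau> \<and>
      bexp p J (\<lambda>B. mu p (N - J) {C. B \<union> C \<in> G} * (1 - mu p (N - J) {C. B \<union> C \<in> G})) \<le> e"
      using p J card_J by (intro exI[of _ p] exI[of _ J]) auto
  qed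
qed

text \<open>Intermediate fibres are discarded, not rounded: every member must have a fibre dense
  enough for a union bound over \<open>d + 1\<close> of them.\<close>

definition junta :: "real \<Rightarrow> real \<Rightarrow> 'a set \<Rightarrow> 'a set \<Rightarrow> 'a set set \<Rightarrow> 'a set set" where
  "junta p \<eta> J K G = {B. B \<subseteq> J \<and> 1 - \<eta> \<le> mu p K {C. B \<union> C \<in> G}}"

lemma upset_junta:
  assumes "upset (J \<union> K) G" "0 \<le> p" "p \<le> 1"
  shows "upset J (junta p \<eta> J K G)"
  unfolding upset_def
proof (intro allI impI)
  fix A B assume A: "A \<in> junta p \<eta> J K G" and AB: "A \<subseteq> B" "B \<subseteq> J"
  have "mu p K {C. A \<union> C \<in> G} \<le> mu p K {C. B \<union> C \<in> G}"
  proof (rule mu_mono[OF assms(2,3)])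
    fix C assume "C \<subseteq> K" "C \<in> {C. A \<union> C \<in> G}"
    moreover have "A \<union> C \<subseteq> B \<union> C" "B \<union> C \<subseteq> J \<union> K"
      using AB \<open>C \<subseteq> K\<close> by auto
    ultimately show "C \<in> {C. B \<union> C \<in> G}"
      using assms(1) unfolding upset_def by blast
  qed
  then show "B \<in> junta p \<eta> J K G"
    using A AB by (auto simp: junta_def)
qed

text \<open>A discarded fibre of measure \<open>m\<close> has
  \<open>m \<le> m * (1 - m) / \<eta>\<close>, so the small mean variance bounds the discarded mass.
  \<open>S\<close> will be the set of all traces and the set of traces missing the centre.\<close>

lemma junta_mass:
  assumes p: "0 \<le> p" "p \<le> 1" and \<eta>: "0 < \<eta>" and JK: "finite J" "finite K" "J \<inter> K = {}"
    and var: "bexp p J (\<lambda>B. mu p K {C. B \<union> C \<in> G} * (1 - mu p K {C. B \<union> C \<in> G})) \<le> e"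
  shows "mu p (J \<union> K) {X\<in>G. X \<inter> J \<in> S} \<le> mu p J (junta p \<eta> J K G \<inter> S) + e / \<eta>"
proof -
  let ?m = "\<lambda>B. mu p K {C. B \<union> C \<in> G}"
  have m: "0 \<le> ?m B" "?m B \<le> 1" for B
    using mu_bounds[of K p "{C. B \<union> C \<in> G}"] JK p by auto
  have "mu p (J \<union> K) {X\<in>G. X \<inter> J \<in> S} = bexp p J (\<lambda>B. of_bool (B \<in> S) * ?m B)"
    unfolding mu_def bexp_union[OF JK(2,1,3)] bexp_cmult[symmetric]
  proof (intro bexp_cong)
    fix B C assume "B \<subseteq> J" "C \<subseteq> K"
    then have "(B \<union> C) \<inter> J = B" using JK by auto
    then show "of_bool (B \<union> C \<in> {X\<in>G. X \<inter> J \<in> S}) = of_bool (B \<in> S) * (of_bool (C \<in> {C. B \<union> C \<in> G}) :: real)"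
      by auto
  qed
  also have "\<dots> \<le> bexp p J (\<lambda>B. of_bool (B \<in> junta p \<eta> J K G \<inter> S) + (1 / \<eta>) * (?m B * (1 - ?m B)))"
  proof (rule bexp_mono[OF p])
    fix B assume B: "B \<subseteq> J"
    have nn: "0 \<le> ?m B * (1 - ?m B)"
      using m by (intro mult_nonneg_nonneg) auto
    show "of_bool (B \<in> S) * ?m B \<le> of_bool (B \<in> junta p \<eta> J K G \<inter> S) + (1 / \<eta>) * (?m B * (1 - ?m B))"
    proof (cases "B \<in> S \<and> B \<notin> junta p \<eta> J K G")
      case True
      then have "\<eta> \<le> 1 - ?m B"
        using B by (auto simp: junta_def)
      then have "?m B * \<eta> \<le> ?m B * (1 - ?m B)"
        using m by (intro mult_left_mono) auto
      then show ?thesis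
        using True \<eta> by (simp add: field_simps)
    next
      case False
      then show ?thesis
        using nn \<eta> m[of B] by (auto intro!: add_increasing2)
    qed
  qed
  also have "\<dots> = mu p J (junta p \<eta> J K G \<inter> S) + (1 / \<eta>) * bexp p J (\<lambda>B. ?m B * (1 - ?m B))"
    by (simp only: bexp_add bexp_cmult mu_def)
  also have "\<dots> \<le> mu p J (junta p \<eta> J K G \<inter> S) + (1 / \<eta>) * e"
    using var \<eta> by (intro add_left_mono mult_left_mono) auto
  finally show ?thesis by simp
qed

definition upclosure :: "'a set \<Rightarrow> 'a set set \<Rightarrow> 'a set set" where
  "upclosure N F = {X. X \<subseteq> N \<and> (\<exists>A\<in>F. A \<subseteq> X)}"

lemma upset_upclosure: "upset N (upclosure N F)"
  unfolding upset_def upclosure_def by blast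

text \<open>Members of the junta without a common point would be extended inside \<open>K\<close> by
  coupled sets of bias \<open>p\<close>, with union of bias \<open>p * (d + 1) / d\<close>. In
  \<open>less\<close>, the first term pays for missing one of the fibres, the second is Markov's
  bound for a union of more than \<open>s - card J\<close> elements.\<close>

lemma junta_intersecting:
  fixes J K :: "nat set"
  assumes d: "d \<ge> 1" and JK: "finite J" "finite K" "J \<inter> K = {}"
    and p: "0 \<le> p" "p \<le> real d / (real d + 1)"
    and free: "\<not> contains_cluster F d s"
    and s: "real (card J) < s"
    and less: "(real d + 1) * \<eta> + p * (real d + 1) / real d * real (card K) / (s - real (card J)) < 1"
    and A: "\<forall>j\<le>d. A j \<in> junta p \<eta> J K (upclosure (J \<union> K) F) \<and> A j \<subseteq> J"
  shows "(\<Inter>j\<le>d. A j) \<noteq> {}"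
proof
  assume empty: "(\<Inter>j\<le>d. A j) = {}"
  define u where "u = p * (real d + 1) / real d"
  define t where "t = s - real (card J)"
  have dpos: "0 < real d" "0 < real d + 1"
    using d by auto
  then have u: "0 \<le> u" "u \<le> 1"
    using p by (auto simp: u_def field_simps)
  have u': "u * real d / (real d + 1) = p"
    using dpos by (simp add: u_def)
  let ?H = "\<lambda>j. {C. A j \<union> C \<in> upclosure (J \<union> K) F}"
  have "(\<Sum>j\<le>d. 1 - mu (u * real d / (real d + 1)) K (?H j)) \<le> (\<Sum>j\<le>d. \<eta>)"
    unfolding u' using A by (intro sum_mono) (auto simp: junta_def)
  moreover have "bexp u K (\<lambda>X. of_bool (t < real (card X))) \<le> u * card K / t"
    using s u JK by (intro markov_card) (auto simp: t_def)
  ultimately have "(\<Sum>j\<le>d. 1 - mu (u * real d / (real d + 1)) K (?H j))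
      + bexp u K (\<lambda>X. of_bool (t < real (card X))) < 1"
    using less by (simp add: u_def t_def add.commute)
  from random_cluster[OF JK(2) u(1,2) this]
  obtain C where C: "\<forall>j\<le>d. C j \<in> ?H j \<and> C j \<subseteq> K" "(\<Inter>j\<le>d. C j) = {}" "real (card (\<Union>j\<le>d. C j)) \<le> t"
    by auto
  \<comment> \<open>Passing from the up-closure down to \<open>F\<close> only shrinks intersection
    and union. Coincidences among the \<open>B j\<close> are harmless, as
    \<open>contains_cluster\<close> speaks of an indexed family.\<close>
  have "\<forall>j. \<exists>B. j \<le> d \<longrightarrow> B \<in> F \<and> B \<subseteq> A j \<union> C j"
    using C(1) unfolding upclosure_def by blast
  then obtain B where B: "\<And>j. j \<le> d \<Longrightarrow> B j \<in> F \<and> B j \<subseteq> A j \<union> C j"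
    by metis
  have "(\<Inter>j\<le>d. B j) \<subseteq> (\<Inter>j\<le>d. A j) \<union> (\<Inter>j\<le>d. C j)"
  proof
    fix x assume x: "x \<in> (\<Inter>j\<le>d. B j)"
    then have xj: "x \<in> A j \<union> C j" if "j \<le> d" for j
      using B that by blast
    show "x \<in> (\<Inter>j\<le>d. A j) \<union> (\<Inter>j\<le>d. C j)"
    proof (cases "x \<in> J")
      case True
      then have "x \<in> A j" if "j \<le> d" for j
        using xj[OF that] C(1) JK(3) that by blast
      then show ?thesis by auto
    next
      case False
      then have "x \<in> C j" if "j \<le> d" for j
        using xj[OF that] A that by blast
      then show ?thesis by auto
    qed
  qed
  then have "(\<Inter>j\<le>d. B j) = {}"
    using empty C(2) by auto
  moreover have "real (card (\<Union>j\<le>d. B j)) \<le> s"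
  proof -
    have "(\<Union>j\<le>d. C j) \<subseteq> K" using C(1) by blast
    then have fin: "finite (\<Union>j\<le>d. C j)" using JK finite_subset by blast
    have "(\<Union>j\<le>d. B j) \<subseteq> J \<union> (\<Union>j\<le>d. C j)"
      using B A by blast
    then have "card (\<Union>j\<le>d. B j) \<le> card (J \<union> (\<Union>j\<le>d. C j))"
      using fin JK by (intro card_mono) auto
    also have "\<dots> \<le> card J + card (\<Union>j\<le>d. C j)"
      by (rule card_Un_le)
    finally show ?thesis
      using C(3) by (simp add: t_def)
  qed
  ultimately show False
    using free B unfolding contains_cluster_def by blast
qed

lemma prob_card_ge:
  fixes p e :: real
  assumes "finite N" "N \<noteq> {}" "0 \<le> p" "p \<le> 1" "0 < e" and k: "real k \<le> (p - e) * card N"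
  shows "1 - 1 / (4 * e\<^sup>2 * card N) \<le> bexp p N (\<lambda>X. of_bool (k \<le> card X))"
proof -
  have "bexp p N (\<lambda>X. 1 - of_bool (e * card N < \<bar>real (card X) - p * card N\<bar>)) \<le> bexp p N (\<lambda>X. of_bool (k \<le> card X))"
  proof (rule bexp_mono[OF assms(3,4)])
    fix X
    show "1 - of_bool (e * card N < \<bar>real (card X) - p * card N\<bar>) \<le> (of_bool (k \<le> card X) :: real)"
    proof (cases "k \<le> card X")
      case False
      then have "real (card X) < (p - e) * card N"
        using k by linarith
      then have "e * card N < \<bar>real (card X) - p * card N\<bar>"
        by (simp add: algebra_simps abs_if)
      then show ?thesis by simp
    qed simp
  qed
  moreover have "bexp p N (\<lambda>X. 1 - of_bool (e * card N < \<bar>real (card X) - p * card N\<bar>))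
      = 1 - bexp p N (\<lambda>X. of_bool (e * card N < \<bar>real (card X) - p * card N\<bar>))"
    using assms by (simp add: bexp_diff)
  ultimately show ?thesis
    using chebyshev_card[OF assms(1-5)] by linarith
qed

text \<open>The density of \<open>F\<close> inside \<open>X\<close> is at most the indicator of the
  up-closure; averaging gives a local LYM inequality for biased measures.\<close>

lemma mu_upclosure_ge:
  assumes N: "finite N" and p: "0 \<le> p" "p \<le> 1" and F: "\<And>A. A \<in> F \<Longrightarrow> A \<subseteq> N \<and> card A = k"
  shows "real (card F) * bexp p N (\<lambda>X. of_bool (k \<le> card X)) \<le> real (card N choose k) * mu p N (upclosure N F)"
proof -
  have "bexp p N (local_density k F) \<le> mu p N (upclosure N F)"
    unfolding mu_def
  proof (rule bexp_mono[OF p])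
    fix X assume X: "X \<subseteq> N"
    show "local_density k F X \<le> of_bool (X \<in> upclosure N F)"
    proof (cases "X \<in> upclosure N F")
      case True
      then show ?thesis
        using local_density_bounds[of X F k] F X N finite_subset by fastforce
    next
      case False
      then have empty: "{A\<in>F. A \<subseteq> X} = {}"
        using X by (auto simp: upclosure_def)
      show ?thesis
        unfolding local_density_def empty by simp
    qed
  qed
  then have "real (card N choose k) * bexp p N (local_density k F) \<le> real (card N choose k) * mu p N (upclosure N F)"
    by (intro mult_left_mono) auto
  then show ?thesis
    using bexp_local_density[OF N F, where p = p] by simp
qed

subsection \<open>Approximation by a star\<close>

text \<open>Sizes enter twice through \<open>mu_upclosure_ge\<close>: a large \<open>F\<close> has
  an up-closure of measure almost \<open>p\<close>, and a small measure of the sets missing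
  \<open>i\<close> means that few members of \<open>F\<close> miss \<open>i\<close>.\<close>

lemma close_to_star:
  fixes d :: nat and \<zeta> \<epsilon> :: real
  assumes d: "d \<ge> 1" and \<zeta>: "0 < \<zeta>" "\<zeta> \<le> 1 / 2" and \<epsilon>: "0 < \<epsilon>"
  shows "\<exists>n0::nat. \<forall>n k F. n > n0 \<longrightarrow>
           \<zeta> * real n \<le> real k \<longrightarrow>
           real k \<le> (real d / (real d + 1) - \<zeta>) * real n \<longrightarrow>
           F \<subseteq> ksubsets n k \<longrightarrow>
           \<not> contains_cluster F d (((real d + 1) / real d + \<zeta>) * real k) \<longrightarrow>
           (n - 1) choose (k - 1) \<le> card F \<longrightarrow>
           (\<exists>i\<in>{1..n}. real (card {A\<in>F. i \<notin> A}) \<le> \<epsilon> * real ((n - 1) choose k))"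
proof -
  define c where "c = real d / (real d + 1)"
  define b where "b = (real d + 1) / real d"
  \<comment> \<open>\<open>e2\<close> is the tolerance of \<open>dictator_stability\<close> for
    \<open>z = \<zeta> / 2\<close>. The excess \<open>2 * \<delta>\<close> of the bias over
    \<open>k / n\<close>, Chebyshev's bound and \<open>e1 / \<eta>\<close> each cost at most
    \<open>e2 / 4\<close>. The value \<open>\<zeta> / 24\<close> of \<open>(d + 1) * \<eta>\<close>
    is half the slack \<open>\<zeta> / 12\<close> left by Markov's bound.\<close>
  define \<kappa> where "\<kappa> = min 1 (\<epsilon> * \<zeta> / 8)"
  define e2 where "e2 = \<kappa> * (\<zeta> / 2)\<^sup>2 / 8"
  define \<eta> where "\<eta> = \<zeta> / (24 * (real d + 1))"
  define \<delta> where "\<delta> = min (\<zeta>\<^sup>2 / 16) (e2 / 8)"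
  define e1 where "e1 = \<eta> * min (e2 / 4) (\<epsilon> * \<zeta> / 8)"
  have c: "0 < c" "c < 1" using d by (auto simp: c_def)
  have b: "1 \<le> b" "b \<le> 2" using d by (auto simp: b_def field_simps)
  have \<kappa>: "0 < \<kappa>" "\<kappa> \<le> 1" "\<kappa> \<le> \<epsilon> * \<zeta> / 8" using \<zeta> \<epsilon> by (auto simp: \<kappa>_def)
  have e2: "0 < e2" using \<kappa> \<zeta> by (simp add: e2_def)
  have \<eta>: "0 < \<eta>" "(real d + 1) * \<eta> = \<zeta> / 24"
    using \<zeta> by (auto simp: \<eta>_def add_pos_pos) (simp add: field_simps)
  have \<delta>: "0 < \<delta>" "\<delta> \<le> \<zeta>\<^sup>2 / 16" "\<delta> \<le> e2 / 8" using \<zeta> e2 by (auto simp: \<delta>_def)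
  have e1: "0 < e1" "e1 / \<eta> \<le> e2 / 4" "e1 / \<eta> \<le> \<epsilon> * \<zeta> / 8"
    using \<eta> e2 \<epsilon> \<zeta> by (auto simp: e1_def)
  have \<zeta>sq: "\<zeta>\<^sup>2 \<le> \<zeta> / 2"
    using \<zeta> by (simp add: power2_eq_square mult_left_le)
  have "0 < \<zeta> / 2" using \<zeta> by simp
  from junta_extract[OF this \<delta>(1) e1(1), where 'a = nat]
  obtain M where M: "\<forall>(N :: nat set) G a. finite N \<longrightarrow> upset N G \<longrightarrow> \<zeta> / 2 \<le> a \<longrightarrow> a + \<delta> \<le> 1 - \<zeta> / 2 \<longrightarrow>
    (\<exists>p J. a \<le> p \<and> p \<le> a + \<delta> \<and> J \<subseteq> N \<and> real (card J) \<le> M \<and>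
      bexp p J (\<lambda>B. mu p (N - J) {C. B \<union> C \<in> G} * (1 - mu p (N - J) {C. B \<union> C \<in> G})) \<le> e1)"
    by (rule exE)
  \<comment> \<open>The summands provide in turn \<open>2 \<le> n\<close>, the smallness of
    \<open>J\<close> against \<open>k\<close>, Chebyshev's bound on \<open>N\<close>, the same on
    \<open>N'\<close>, and the passage from \<open>n\<close> to \<open>n - 1\<close>.\<close>
  obtain n0 :: nat where n0: "2 + 2 * \<bar>M\<bar> / \<zeta>\<^sup>2 + 1 / (\<delta>\<^sup>2 * e2) + 2 / \<delta>\<^sup>2 + 4 / \<delta> < real n0"
    using reals_Archimedean2 by blast
  show ?thesis
  proof (intro exI[of _ n0] allI impI)
    fix n k :: nat and F
    assume n: "n > n0" and k: "\<zeta> * real n \<le> real k" "real k \<le> (real d / (real d + 1) - \<zeta>) * real n"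
      and F: "F \<subseteq> ksubsets n k" and free: "\<not> contains_cluster F d (((real d + 1) / real d + \<zeta>) * real k)"
      and large: "(n - 1) choose (k - 1) \<le> card F"
    have pos: "0 \<le> 2 * \<bar>M\<bar> / \<zeta>\<^sup>2" "0 \<le> 1 / (\<delta>\<^sup>2 * e2)" "0 \<le> 2 / \<delta>\<^sup>2" "0 \<le> 4 / \<delta>"
      using \<delta> e2 by auto
    have nbig: "2 \<le> real n" "2 * \<bar>M\<bar> / \<zeta>\<^sup>2 \<le> real n" "1 / (\<delta>\<^sup>2 * e2) \<le> real n"
        "2 / \<delta>\<^sup>2 \<le> real n - 1" "4 / \<delta> \<le> real n"
      using n n0 pos by linarith+
    have npos: "0 < real n" using nbig by linarith
    define \<alpha> where "\<alpha> = real k / real n"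
    have k_eq: "real k = \<alpha> * real n" using npos by (simp add: \<alpha>_def)
    have \<alpha>: "\<zeta> \<le> \<alpha>" "\<alpha> \<le> c - \<zeta>"
      using k npos by (auto simp: \<alpha>_def c_def field_simps)
    have kpos: "0 < k" using k_eq \<alpha> \<zeta> npos by (metis gr0I mult_pos_pos not_less of_nat_0 order_less_le_trans order_refl)
    have kn: "k \<le> n"
    proof -
      have "\<alpha> * real n \<le> 1 * real n" using \<alpha> c \<zeta> by (intro mult_right_mono) auto
      then show ?thesis using k_eq by simp
    qed
    define N where "N = {1..n}"
    have N: "finite N" "N \<noteq> {}" "card N = n" using nbig by (auto simp: N_def)
    have FN: "A \<subseteq> N \<and> card A = k" if "A \<in> F" for A
      using F that by (auto simp: ksubsets_def N_def)
    define G where "G = upclosure N F"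
    have G: "upset N G" unfolding G_def by (rule upset_upclosure)
    \<comment> \<open>Starting the interval at \<open>\<alpha> + \<delta>\<close> ensures
      \<open>p - \<delta> \<ge> \<alpha>\<close>, so a random set most likely has at least
      \<open>k\<close> elements.\<close>
    have "\<zeta> / 2 \<le> \<alpha> + \<delta>" "\<alpha> + \<delta> + \<delta> \<le> 1 - \<zeta> / 2"
      using \<alpha> \<delta> \<zeta> \<zeta>sq c by linarith+
    from M[rule_format, OF N(1) G this] obtain p J where p: "\<alpha> + \<delta> \<le> p" "p \<le> \<alpha> + \<delta> + \<delta>" and J: "J \<subseteq> N" "real (card J) \<le> M"
      and var: "bexp p J (\<lambda>B. mu p (N - J) {C. B \<union> C \<in> G} * (1 - mu p (N - J) {C. B \<union> C \<in> G})) \<le> e1"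
      by blast
    define K where "K = N - J"
    have JK: "finite J" "finite K" "J \<inter> K = {}" "J \<union> K = N"
      using J N by (auto simp: K_def intro: finite_subset)
    have p01: "0 \<le> p" "p \<le> 1" "\<zeta> / 2 \<le> p" "p + \<zeta> / 2 \<le> c" "p \<le> c"
      using p \<alpha> \<delta> \<zeta> \<zeta>sq c by linarith+
    define U where "U = junta p \<eta> J K G"
    have mass: "mu p N {X\<in>G. X \<inter> J \<in> S} \<le> mu p J (U \<inter> S) + e1 / \<eta>" for S
      using junta_mass[OF p01(1,2) \<eta>(1) JK(1-3) var[folded K_def], of S] unfolding JK(4) U_def .
    have choose_pos: "0 < real (n choose k)" using kn by simp
    have absorb: "\<alpha> * real (n choose k) = real ((n - 1) choose (k - 1))"
    proof -
      have "k * (n choose k) = n * ((n - 1) choose (k - 1))"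
        using kpos by (rule times_binomial_minus1_eq)
      then have "real k * real (n choose k) = real n * real ((n - 1) choose (k - 1))"
        by (simp flip: of_nat_mult)
      then show ?thesis using npos by (simp add: \<alpha>_def field_simps)
    qed
    have muG: "\<alpha> - e2 / 4 \<le> mu p N G"
    proof -
      let ?P = "bexp p N (\<lambda>X. of_bool (k \<le> card X))"
      have "real k \<le> (p - \<delta>) * card N"
        unfolding N(3) k_eq using p npos by (intro mult_right_mono) auto
      then have P: "1 - 1 / (4 * \<delta>\<^sup>2 * card N) \<le> ?P"
        using prob_card_ge[OF N(1,2) p01(1,2) \<delta>(1)] by blast
      have "1 \<le> real n * (\<delta>\<^sup>2 * e2)"
        using nbig(3) \<delta> e2 by (simp add: field_simps)
      then have "1 / (4 * \<delta>\<^sup>2 * card N) \<le> e2 / 4"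
        unfolding N(3) using \<delta> npos by (simp add: field_simps)
      then have "1 - e2 / 4 \<le> ?P" using P by linarith
      moreover have "\<alpha> * ?P \<le> mu p N G"
      proof -
        have "0 \<le> ?P" using p01 by (intro bexp_nonneg) auto
        then have "\<alpha> * real (n choose k) * ?P \<le> real (card F) * ?P"
          unfolding absorb using large by (intro mult_right_mono) auto
        also have "\<dots> \<le> real (n choose k) * mu p N G"
          using mu_upclosure_ge[OF N(1) p01(1,2) FN] unfolding N(3) G_def by blast
        finally have "real (n choose k) * (\<alpha> * ?P) \<le> real (n choose k) * mu p N G"
          by (simp add: mult_ac)
        then show ?thesis using choose_pos by (rule mult_left_le_imp_le)
      qed
      moreover have "\<alpha> * (1 - e2 / 4) \<le> \<alpha> * ?P"
        using calculation(1) \<alpha> \<zeta> by (intro mult_left_mono) auto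
      moreover have "\<alpha> * e2 \<le> 1 * e2"
        using \<alpha> c \<zeta> e2 by (intro mult_right_mono) auto
      ultimately show ?thesis by (simp add: algebra_simps)
    qed
    have "mu p N G \<le> mu p J U + e1 / \<eta>"
      using mass[of UNIV] by simp
    then have lo: "p - e2 \<le> mu p J U"
      using muG p \<delta> e1 by linarith
    have Jsmall: "real (card J) \<le> \<zeta> / 2 * real k"
    proof -
      have "2 * \<bar>M\<bar> \<le> real n * \<zeta>\<^sup>2"
        using nbig(2) \<zeta> by (simp add: field_simps)
      then have "real (card J) \<le> \<zeta> / 2 * (\<zeta> * real n)"
        using J by (simp add: power2_eq_square algebra_simps)
      also have "\<dots> \<le> \<zeta> / 2 * real k"
        using k \<zeta> by (intro mult_left_mono) auto
      finally show ?thesis .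
    qed
    have kr: "0 < real k" using kpos by simp
    have hi: "mu c J U \<le> c"
      unfolding c_def
    proof (rule mu_intersecting[OF JK(1)])
      fix A assume A: "\<forall>j\<le>d. A j \<in> U \<and> A j \<subseteq> J"
      define s where "s = (b + \<zeta>) * real k"
      have s: "(b + \<zeta> / 2) * real k \<le> s - real (card J)"
        using Jsmall by (simp add: s_def algebra_simps)
      have bk: "0 < (b + \<zeta> / 2) * real k" using b \<zeta> kr by simp
      have "p * b * real (card K) \<le> (\<alpha> + 2 * \<delta>) * b * real n"
      proof -
        have "card K \<le> n" using card_mono[of N K] N by (auto simp: K_def)
        then show ?thesis using p p01 b \<alpha> \<zeta> \<delta> by (intro mult_mono) auto
      qed
      also have "\<dots> = b * real k + 2 * \<delta> * real n * b"
        by (simp add: k_eq algebra_simps)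
      also have "\<dots> \<le> b * real k + 2 * \<delta> * real n * 2"
        using b \<delta> npos by (intro add_left_mono mult_left_mono) auto
      also have "2 * \<delta> * real n * 2 \<le> \<zeta> / 4 * (\<zeta> * real n)"
      proof -
        have "4 * \<delta> * real n \<le> 4 * (\<zeta>\<^sup>2 / 16) * real n"
          using \<delta> by (intro mult_right_mono) auto
        then show ?thesis by (simp add: power2_eq_square algebra_simps)
      qed
      also have "\<dots> \<le> \<zeta> / 4 * real k"
        using k \<zeta> by (intro mult_left_mono) auto
      \<comment> \<open>A union of mean size about \<open>b * k\<close> must fit into
        \<open>s - card J\<close>, which is at least \<open>(b + \<zeta> / 2) * k\<close>. After the
        loss \<open>\<zeta> / 4 * k\<close> due to \<open>p > \<alpha>\<close>, the rest is spent on
        the factor \<open>1 - \<zeta> / 12\<close>.\<close>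
      also have "b * real k + \<zeta> / 4 * real k \<le> (1 - \<zeta> / 12) * ((b + \<zeta> / 2) * real k)"
      proof -
        have "\<zeta> * b \<le> \<zeta> * 2" "\<zeta> * \<zeta> \<le> \<zeta> / 2"
          using b \<zeta> \<zeta>sq by (auto simp: power2_eq_square)
        moreover have "(1 - \<zeta> / 12) * (b + \<zeta> / 2) = b + \<zeta> / 2 - \<zeta> * b / 12 - \<zeta> * \<zeta> / 24"
          by (simp add: algebra_simps)
        ultimately have "b + \<zeta> / 4 \<le> (1 - \<zeta> / 12) * (b + \<zeta> / 2)"
          using \<zeta> by linarith
        then have "(b + \<zeta> / 4) * real k \<le> (1 - \<zeta> / 12) * (b + \<zeta> / 2) * real k"
          by (intro mult_right_mono) auto
        then show ?thesis by (simp only: distrib_right mult.assoc)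
      qed
      also have "\<dots> \<le> (1 - \<zeta> / 12) * (s - real (card J))"
        using s \<zeta> by (intro mult_left_mono) auto
      finally have "p * b * real (card K) / (s - real (card J)) \<le> 1 - \<zeta> / 12"
        using s bk by (simp add: pos_divide_le_eq)
      then have "(real d + 1) * \<eta> + p * (real d + 1) / real d * real (card K) / (s - real (card J)) < 1"
        using \<eta> \<zeta> by (simp add: b_def)
      moreover have "real (card J) < s" using s bk by linarith
      moreover have "\<not> contains_cluster F d s" using free by (simp add: s_def b_def)
      ultimately show "(\<Inter>j\<le>d. A j) \<noteq> {}"
        using A p01 d JK unfolding U_def G_def JK(4)[symmetric] c_def
        by (intro junta_intersecting[where F = F and s = s and p = p and \<eta> = \<eta> and J = J and K = K]) auto
    qed
    have "upset J U"
      unfolding U_def using G JK(4) p01 by (intro upset_junta) auto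
    then obtain i where i: "i \<in> J" "mu p J {A\<in>U. i \<notin> A} \<le> \<kappa>"
      using dictator_stability[of "\<zeta> / 2" p c \<kappa> J U] p01 c \<kappa> JK(1) lo hi \<zeta> unfolding e2_def by auto
    have iN: "i \<in> N" using i J by auto
    define N' where "N' = N - {i}"
    define H where "H = {A\<in>F. i \<notin> A}"
    have N': "finite N'" "i \<notin> N'" "insert i N' = N" "card N' = n - 1" "real (card N') = real n - 1"
      using N iN nbig by (auto simp: N'_def of_nat_diff)
    have HN: "A \<subseteq> N' \<and> card A = k" if "A \<in> H" for A
      using FN that by (auto simp: H_def N'_def)
    have "{X\<in>G. X \<inter> J \<in> {B. i \<notin> B}} = {X\<in>G. i \<notin> X}" "U \<inter> {B. i \<notin> B} = {A\<in>U. i \<notin> A}"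
      using i(1) by auto
    then have "mu p N {X\<in>G. i \<notin> X} \<le> mu p J {A\<in>U. i \<notin> A} + e1 / \<eta>"
      using mass[of "{B. i \<notin> B}"] by (simp only:)
    then have "mu p N {X\<in>G. i \<notin> X} \<le> \<epsilon> * \<zeta> / 4"
      using i(2) \<kappa>(3) e1(3) by linarith
    \<comment> \<open>A random set misses \<open>i\<close> with probability \<open>1 - p\<close>, at
      least \<open>\<zeta> / 2\<close>, and is then a random subset of \<open>N'\<close>, the ground
      set of \<open>H\<close>.\<close>
    moreover have "(1 - p) * mu p N' (upclosure N' H) \<le> mu p N {X\<in>G. i \<notin> X}"
    proof -
      have "(1 - p) * mu p N' (upclosure N' H) \<le> (1 - p) * mu p N' {X\<in>G. i \<notin> X}"
      proof (intro mult_left_mono mu_mono p01)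
        fix A assume "A \<subseteq> N'" "A \<in> upclosure N' H"
        then show "A \<in> {X\<in>G. i \<notin> X}"
          unfolding G_def upclosure_def H_def N'_def by auto
      qed (use p01 in auto)
      also have "\<dots> \<le> mu p (insert i N') {X\<in>G. i \<notin> X}"
        unfolding mu_def bexp_insert[OF N'(1,2)] using p01 by (simp add: bexp_nonneg)
      finally show ?thesis unfolding N'(3) .
    qed
    ultimately have up: "(1 - p) * mu p N' (upclosure N' H) \<le> \<epsilon> * \<zeta> / 4" by linarith
    have "\<zeta> / 2 * mu p N' (upclosure N' H) \<le> (1 - p) * mu p N' (upclosure N' H)"
      using p01 c mu_bounds[OF N'(1) p01(1,2)] by (intro mult_right_mono) auto
    then have "\<zeta> / 2 * mu p N' (upclosure N' H) \<le> \<zeta> / 2 * (\<epsilon> / 2)"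
      using up by (simp add: mult_ac)
    then have muH: "mu p N' (upclosure N' H) \<le> \<epsilon> / 2"
      using \<zeta> by simp
    \<comment> \<open>A constant is enough here: it turns \<open>\<epsilon> / 2\<close> into
      \<open>\<epsilon>\<close>.\<close>
    have "1 / 2 \<le> bexp p N' (\<lambda>X. of_bool (k \<le> card X))"
    proof -
      have "real k \<le> (p - \<delta> / 2) * card N'"
      proof -
        have "\<alpha> * real n \<le> (\<alpha> + \<delta> / 2) * (real n - 1)"
        proof -
          have "4 \<le> \<delta> * real n" using nbig(5) \<delta> by (simp add: field_simps)
          moreover have "\<delta> \<le> 1" using \<delta>(2) \<zeta>sq \<zeta> by linarith
          ultimately show ?thesis using \<alpha> c \<zeta> by (simp add: algebra_simps)
        qed
        also have "\<dots> \<le> (p - \<delta> / 2) * (real n - 1)"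
          using p nbig by (intro mult_right_mono) auto
        finally show ?thesis using k_eq N'(5) by simp
      qed
      moreover have "N' \<noteq> {}" using N'(5) nbig by auto
      ultimately have "1 - 1 / (4 * (\<delta> / 2)\<^sup>2 * card N') \<le> bexp p N' (\<lambda>X. of_bool (k \<le> card X))"
        using prob_card_ge[OF N'(1) _ p01(1,2), of "\<delta> / 2" k] \<delta> by simp
      moreover have "1 / (4 * (\<delta> / 2)\<^sup>2 * card N') \<le> 1 / 2"
      proof -
        have "2 \<le> \<delta>\<^sup>2 * (real n - 1)"
          using nbig(4) \<delta> by (simp add: field_simps)
        then show ?thesis
          unfolding N'(5) by (simp add: power_divide)
      qed
      ultimately show ?thesis by linarith
    qed
    then have "real (card H) * (1 / 2) \<le> real (card H) * bexp p N' (\<lambda>X. of_bool (k \<le> card X))"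
      by (intro mult_left_mono) auto
    also have "\<dots> \<le> real ((n - 1) choose k) * mu p N' (upclosure N' H)"
      using mu_upclosure_ge[OF N'(1) p01(1,2) HN] unfolding N'(4) by blast
    also have "\<dots> \<le> real ((n - 1) choose k) * (\<epsilon> / 2)"
      using muH by (intro mult_left_mono) auto
    finally show "\<exists>i\<in>{1..n}. real (card {A\<in>F. i \<notin> A}) \<le> \<epsilon> * real ((n - 1) choose k)"
      using iN unfolding H_def N_def by (intro bexI[of _ i]) (simp_all add: mult.commute)
  qed
qed

subsection \<open>Averaging over permutations\<close>

lemma card_permutes_preimage:
  assumes "\<pi> permutes N" "F \<subseteq> Pow N"
  shows "card {A. A \<subseteq> N \<and> \<pi> ` A \<in> F} = card F"
proof -
  have bij: "bij_betw (image \<pi>) (Pow N) (Pow N)"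
    using permutes_imp_bij[OF assms(1)] by (rule bij_betw_Pow)
  have "F \<subseteq> image \<pi> ` Pow N"
    using bij assms(2) by (simp add: bij_betw_def)
  then have "F = image \<pi> ` {A. A \<subseteq> N \<and> \<pi> ` A \<in> F}"
    by blast
  moreover have "inj_on (image \<pi>) {A. A \<subseteq> N \<and> \<pi> ` A \<in> F}"
    using bij unfolding bij_betw_def by (rule inj_on_subset[OF conjunct1]) auto
  ultimately show ?thesis
    by (metis card_image)
qed

text \<open>By symmetry every \<open>k\<close>-set is sent into \<open>F\<close> by equally many
  permutations, and each permutation sends exactly \<open>card F\<close> of the
  \<open>k\<close>-sets into \<open>F\<close>.\<close>

lemma sum_permutes_image:
  assumes N: "finite N" and F: "\<And>A. A \<in> F \<Longrightarrow> A \<subseteq> N \<and> card A = k" and A: "A \<subseteq> N" "card A = k"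
  shows "real (card N choose k) * (\<Sum>\<pi> | \<pi> permutes N. of_bool (\<pi> ` A \<in> F))
    = real (card F) * real (card {\<pi>. \<pi> permutes N})"
proof -
  define S where "S = {A. A \<subseteq> N \<and> card A = k}"
  define w where "w A = (\<Sum>\<pi> | \<pi> permutes N. of_bool (\<pi> ` A \<in> F) :: real)" for A
  have S: "finite S" "card S = card N choose k" "A \<in> S"
    using N n_subsets[OF N] A by (auto simp: S_def)
  have w_eq: "w B = w A" if B: "B \<in> S" for B
  proof -
    have "\<exists>\<sigma>. \<sigma> permutes N \<and> \<sigma> ` A = B"
      by (rule exists_permutes_image) (use N A B in \<open>auto simp: S_def\<close>)
    then obtain \<sigma> where \<sigma>: "\<sigma> permutes N" "\<sigma> ` A = B"
      by blast
    have "w A = (\<Sum>\<pi> | \<pi> permutes N. of_bool ((\<pi> \<circ> \<sigma>) ` A \<in> F))"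
      unfolding w_def by (rule sum_permutations_compose_right[OF \<sigma>(1)])
    also have "\<dots> = w B"
      unfolding w_def \<sigma>(2)[symmetric] by (simp only: image_comp)
    finally show ?thesis by simp
  qed
  have "(\<Sum>B\<in>S. w B) = (\<Sum>\<pi> | \<pi> permutes N. \<Sum>B\<in>S. of_bool (\<pi> ` B \<in> F))"
    unfolding w_def by (rule sum.swap)
  also have "\<dots> = (\<Sum>\<pi> | \<pi> permutes N. real (card F))"
  proof (rule sum.cong[OF refl])
    fix \<pi> assume "\<pi> \<in> {\<pi>. \<pi> permutes N}"
    then have \<pi>: "\<pi> permutes N" by simp
    have "(\<Sum>B\<in>S. of_bool (\<pi> ` B \<in> F)) = real (card (S \<inter> {B. \<pi> ` B \<in> F}))"
      using S(1) by simp
    also have "S \<inter> {B. \<pi> ` B \<in> F} = {B. B \<subseteq> N \<and> \<pi> ` B \<in> F}"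
    proof -
      have "card B = k" if "\<pi> ` B \<in> F" for B
        using F[OF that] card_image[OF inj_on_subset[OF permutes_inj[OF \<pi>]], of B] by simp
      then show ?thesis by (auto simp: S_def)
    qed
    also have "card \<dots> = card F"
      using F by (intro card_permutes_preimage[OF \<pi>]) auto
    finally show "(\<Sum>B\<in>S. of_bool (\<pi> ` B \<in> F)) = real (card F)" .
  qed
  finally have "(\<Sum>B\<in>S. w B) = real (card F) * real (card {\<pi>. \<pi> permutes N})"
    by (simp add: mult.commute)
  moreover have "(\<Sum>B\<in>S. w B) = (\<Sum>B\<in>S. w A)"
    by (rule sum.cong[OF refl]) (rule w_eq)
  ultimately show ?thesis
    using S(2) by (simp add: w_def)
qed

text \<open>Greedy: each image of \<open>T\<close> takes \<open>card T\<close> uncovered points, or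
  all of them once fewer remain. Permutations of \<open>A\<close> fix everything outside
  \<open>A\<close>, which the application relies on.\<close>

lemma permutes_cover:
  assumes A: "finite A" and T: "T \<subseteq> A" and X: "X \<subseteq> A" "card X \<le> d * card T"
  shows "\<exists>\<sigma>. (\<forall>j<d. \<sigma> j permutes A) \<and> X \<subseteq> (\<Union>j<d. \<sigma> j ` T)"
  using X
proof (induction d arbitrary: X)
  case 0
  then have "X = {}" using A finite_subset[of X A] by auto
  then show ?case by auto
next
  case (Suc d)
  have finX: "finite X" using Suc.prems A finite_subset by auto
  have "\<exists>Y. Y \<subseteq> A \<and> card Y = card T \<and> card (X - Y) \<le> d * card T"
  proof (cases "card T \<le> card X")
    case True
    then obtain Y where "Y \<subseteq> X" "card Y = card T" "finite Y"
      by (rule obtain_subset_with_card_n)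
    then show ?thesis
      using Suc.prems by (intro exI[of _ Y]) (auto simp: card_Diff_subset)
  next
    case False
    then have "\<exists>Y. X \<subseteq> Y \<and> Y \<subseteq> A \<and> card Y = card T"
      using Suc.prems A T card_mono[OF A T] by (intro exists_subset_between) auto
    then obtain Y where "X \<subseteq> Y" "Y \<subseteq> A" "card Y = card T"
      by blast
    then show ?thesis
      by (intro exI[of _ Y]) (auto simp: Diff_eq_empty_iff[THEN iffD2])
  qed
  then obtain Y where Y: "Y \<subseteq> A" "card Y = card T" "card (X - Y) \<le> d * card T"
    by blast
  obtain \<sigma> where \<sigma>: "\<forall>j<d. \<sigma> j permutes A" "X - Y \<subseteq> (\<Union>j<d. \<sigma> j ` T)"
    using Suc.IH[of "X - Y"] Y Suc.prems by blast
  obtain \<tau> where \<tau>: "\<tau> permutes A" "\<tau> ` T = Y"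
    using exists_permutes_image[OF A T Y(1)] Y by auto
  have "\<forall>j<Suc d. (\<sigma>(d := \<tau>)) j permutes A"
    using \<sigma> \<tau> by (auto simp: less_Suc_eq)
  moreover have "X \<subseteq> (\<Union>j<Suc d. (\<sigma>(d := \<tau>)) j ` T)"
  proof
    fix x assume "x \<in> X"
    show "x \<in> (\<Union>j<Suc d. (\<sigma>(d := \<tau>)) j ` T)"
    proof (cases "x \<in> Y")
      case True
      then show ?thesis using \<tau> by (intro UN_I[of d]) auto
    next
      case False
      then obtain j where "j < d" "x \<in> \<sigma> j ` T" using \<open>x \<in> X\<close> \<sigma> by blast
      then show ?thesis by (intro UN_I[of j]) auto
    qed
  qed
  ultimately show ?case by blast
qed

text \<open>Copies of \<open>B\<close> under permutations of \<open>A\<close> agree outside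
  \<open>A\<close>, so with \<open>A\<close> they add only \<open>B - A\<close> to the union; if the
  images of \<open>A - B\<close> cover \<open>A\<close>, no point of \<open>A\<close> lies in all
  copies. So whenever \<open>A\<close> is sent into \<open>F\<close>, one of \<open>d\<close> copies
  is sent into \<open>M\<close>. Composition with \<open>\<sigma> j\<close> preserves
  \<open>A\<close> and reindexes the sum, which costs a factor \<open>d\<close>. The 1 in
  \<open>union\<close> is room for the centre of the star.\<close>

lemma sum_permutes_cluster:
  fixes s :: real and N :: "'a set"
  assumes N: "finite N" and A: "A \<subseteq> N" "card A = k" and B: "B \<subseteq> N" "card B = l"
    and cover: "k \<le> d * card (A - B)" and union: "real (card (B - A) + k + 1) \<le> s"
    and key: "\<And>A' B' C. A' \<in> F \<Longrightarrow> (\<And>j. j < d \<Longrightarrow> B' j \<subseteq> N \<and> card (B' j) = l \<and> B' j - A' = C) \<Longrightarrow>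
      (\<And>x. x \<in> A' \<Longrightarrow> \<exists>j<d. x \<notin> B' j) \<Longrightarrow> real (card C + k + 1) \<le> s \<Longrightarrow> \<exists>j<d. B' j \<in> M"
  shows "(\<Sum>\<pi> | \<pi> permutes N. of_bool (\<pi> ` A \<in> F))
    \<le> real d * (\<Sum>\<pi> | \<pi> permutes N. of_bool (\<pi> ` A \<in> F) * of_bool (\<pi> ` B \<in> M))"
proof -
  have finA: "finite A" using A N finite_subset by auto
  obtain \<sigma> where \<sigma>: "\<And>j. j < d \<Longrightarrow> \<sigma> j permutes A" and cov: "A \<subseteq> (\<Union>j<d. \<sigma> j ` (A - B))"
    using permutes_cover[OF finA, of "A - B" A d] A cover by auto
  have \<sigma>N: "\<sigma> j permutes N" if "j < d" for j
    using \<sigma>[OF that] A(1) by (rule permutes_subset)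
  have pt: "of_bool (\<pi> ` A \<in> F) \<le> (\<Sum>j<d. of_bool ((\<pi> \<circ> \<sigma> j) ` A \<in> F) * of_bool ((\<pi> \<circ> \<sigma> j) ` B \<in> M) :: real)"
    if \<pi>: "\<pi> permutes N" for \<pi>
  proof (cases "\<pi> ` A \<in> F")
    case True
    have inj: "inj \<pi>" using permutes_inj[OF \<pi>] .
    have A': "(\<pi> \<circ> \<sigma> j) ` A = \<pi> ` A" if "j < d" for j
      using permutes_image[OF \<sigma>[OF that]] by (simp only: image_comp[symmetric])
    have "\<exists>j<d. (\<pi> \<circ> \<sigma> j) ` B \<in> M"
    proof (rule key[OF True])
      fix j assume j: "j < d"
      have injs: "inj (\<pi> \<circ> \<sigma> j)"
        using inj permutes_inj[OF \<sigma>[OF j]] by (rule inj_compose)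
      have "(\<pi> \<circ> \<sigma> j) ` B \<subseteq> N"
        using B(1) permutes_image[OF permutes_compose[OF \<sigma>N[OF j] \<pi>]] by blast
      moreover have "card ((\<pi> \<circ> \<sigma> j) ` B) = l"
        using card_image[OF inj_on_subset[OF injs], of B] B by simp
      moreover have "(\<pi> \<circ> \<sigma> j) ` B - \<pi> ` A = \<pi> ` (B - A)"
      proof -
        have "(\<pi> \<circ> \<sigma> j) ` B - \<pi> ` A = (\<pi> \<circ> \<sigma> j) ` (B - A)"
          unfolding A'[OF j, symmetric] by (rule image_set_diff[OF injs, symmetric])
        also have "\<dots> = \<pi> ` (B - A)"
          using permutes_not_in[OF \<sigma>[OF j]] by (intro image_cong) auto
        finally show ?thesis .
      qed
      ultimately show "(\<pi> \<circ> \<sigma> j) ` B \<subseteq> N \<and> card ((\<pi> \<circ> \<sigma> j) ` B) = l \<and> (\<pi> \<circ> \<sigma> j) ` B - \<pi> ` A = \<pi> ` (B - A)"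
        by blast
    next
      fix x assume "x \<in> \<pi> ` A"
      then obtain y where y: "y \<in> A" "x = \<pi> y" by blast
      then obtain j z where j: "j < d" and z: "z \<in> A - B" "y = \<sigma> j z" using cov by blast
      have "x \<notin> (\<pi> \<circ> \<sigma> j) ` B"
        using inj_compose[OF inj permutes_inj[OF \<sigma>[OF j]]] z y by (auto simp: inj_def)
      then show "\<exists>j<d. x \<notin> (\<pi> \<circ> \<sigma> j) ` B" using j by blast
    next
      show "real (card (\<pi> ` (B - A)) + k + 1) \<le> s"
        using union card_image[OF inj_on_subset[OF inj], of "B - A"] by simp
    qed
    then obtain j where j: "j < d" "(\<pi> \<circ> \<sigma> j) ` B \<in> M" by blast
    have "(1::real) = of_bool ((\<pi> \<circ> \<sigma> j) ` A \<in> F) * of_bool ((\<pi> \<circ> \<sigma> j) ` B \<in> M)"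
      using j True A' by simp
    also have "\<dots> \<le> (\<Sum>j<d. of_bool ((\<pi> \<circ> \<sigma> j) ` A \<in> F) * of_bool ((\<pi> \<circ> \<sigma> j) ` B \<in> M))"
      using j by (intro member_le_sum[of j "{..<d}" "\<lambda>j. of_bool ((\<pi> \<circ> \<sigma> j) ` A \<in> F) * of_bool ((\<pi> \<circ> \<sigma> j) ` B \<in> M) :: real"]) auto
    finally show ?thesis using True by simp
  qed (simp add: sum_nonneg)
  have "(\<Sum>\<pi> | \<pi> permutes N. of_bool (\<pi> ` A \<in> F) :: real)
      \<le> (\<Sum>\<pi> | \<pi> permutes N. \<Sum>j<d. of_bool ((\<pi> \<circ> \<sigma> j) ` A \<in> F) * of_bool ((\<pi> \<circ> \<sigma> j) ` B \<in> M))"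
    using pt by (intro sum_mono) auto
  also have "\<dots> = (\<Sum>j<d. \<Sum>\<pi> | \<pi> permutes N. of_bool ((\<pi> \<circ> \<sigma> j) ` A \<in> F) * of_bool ((\<pi> \<circ> \<sigma> j) ` B \<in> M))"
    by (rule sum.swap)
  also have "\<dots> = (\<Sum>j<d. \<Sum>\<pi> | \<pi> permutes N. of_bool (\<pi> ` A \<in> F) * of_bool (\<pi> ` B \<in> M))"
    using \<sigma>N by (intro sum.cong refl sum_permutations_compose_right[symmetric, where f = "\<lambda>\<pi>. of_bool (\<pi> ` A \<in> F) * of_bool (\<pi> ` B \<in> M)"]) auto
  finally show ?thesis by simp
qed

text \<open>Both sets have bias \<open>p\<close>; \<open>\<tau>\<close> is the chance of lying in
  the first only. It governs \<open>card (A - B)\<close>, which decides whether \<open>d\<close>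
  copies of \<open>A - B\<close> can cover \<open>A\<close>.\<close>

definition pair_weight :: "real \<Rightarrow> real \<Rightarrow> bool \<times> bool \<Rightarrow> real" where
  "pair_weight p \<tau> t = (if fst t then if snd t then p - \<tau> else \<tau> else if snd t then \<tau> else 1 - p - \<tau>)"

lemma pair_weight_sums:
  "sum (pair_weight p \<tau>) UNIV = 1"
  "sum (pair_weight p \<tau>) (UNIV \<inter> {t. fst t}) = p"
  "sum (pair_weight p \<tau>) (UNIV \<inter> {t. snd t}) = p"
  "sum (pair_weight p \<tau>) (UNIV \<inter> {t. fst t \<and> \<not> snd t}) = \<tau>"
  "sum (pair_weight p \<tau>) (UNIV \<inter> {t. fst t \<and> snd t}) = p - \<tau>"
proof -
  have U: "(UNIV :: (bool \<times> bool) set) = {(True, True), (True, False), (False, True), (False, False)}"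
    by auto
  show "sum (pair_weight p \<tau>) UNIV = 1"
    unfolding U by (simp add: pair_weight_def)
  have "UNIV \<inter> {t. fst t} = {(True, True), (True, False)}" "UNIV \<inter> {t. snd t} = {(True, True), (False, True)}"
      "UNIV \<inter> {t. fst t \<and> \<not> snd t} = {(True, False)}" "UNIV \<inter> {t. fst t \<and> snd t} = {(True, True)}"
    by auto
  then show "sum (pair_weight p \<tau>) (UNIV \<inter> {t. fst t}) = p"
    "sum (pair_weight p \<tau>) (UNIV \<inter> {t. snd t}) = p"
    "sum (pair_weight p \<tau>) (UNIV \<inter> {t. fst t \<and> \<not> snd t}) = \<tau>"
    "sum (pair_weight p \<tau>) (UNIV \<inter> {t. fst t \<and> snd t}) = p - \<tau>"
    by (simp_all add: pair_weight_def)
qed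

text \<open>The case \<open>p = \<tau>\<close>, in which random pairs are disjoint, is used for \<open>d = 1\<close>, where
  approximate sizes alone would not suffice.\<close>
definition balanced :: "real \<Rightarrow> real \<Rightarrow> real \<Rightarrow> 'a set \<Rightarrow> 'a set \<Rightarrow> 'a set \<Rightarrow> bool" where
  "balanced p \<tau> e N X Y \<longleftrightarrow> \<bar>real (card X) - p * card N\<bar> \<le> e * card N \<and> \<bar>real (card Y) - p * card N\<bar> \<le> e * card N
    \<and> \<bar>real (card (X - Y)) - \<tau> * card N\<bar> \<le> e * card N \<and> (p = \<tau> \<longrightarrow> X \<inter> Y = {})"

lemma pair_balanced:
  fixes N :: "'a set" and p \<tau> e :: real
  assumes N: "finite N" "N \<noteq> {}" and p: "0 \<le> p" "p \<le> 1" and \<tau>: "0 \<le> \<tau>" "\<tau> \<le> p" "p + \<tau> \<le> 1" and e: "0 < e"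
  shows "1 - 3 / (4 * e\<^sup>2 * card N)
    \<le> texp (pair_weight p \<tau>) UNIV N (\<lambda>x. of_bool (balanced p \<tau> e N {i\<in>N. fst (x i)} {i\<in>N. snd (x i)}))"
proof -
  let ?c = "pair_weight p \<tau>"
  define dev where "dev q X = (of_bool (e * card N < \<bar>real (card X) - q * card N\<bar>) :: real)" for q :: real and X :: "'a set"
  define X where "X x = {i\<in>N. fst (x i)}" for x :: "'a \<Rightarrow> bool \<times> bool"
  define Y where "Y x = {i\<in>N. snd (x i)}" for x :: "'a \<Rightarrow> bool \<times> bool"
  have marg: "texp ?c UNIV N (\<lambda>x. g {i\<in>N. x i \<in> S}) = bexp (sum ?c (UNIV \<inter> S)) N g" for g S
    by (rule texp_marginal) (auto simp: pair_weight_sums N)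
  have 1: "texp ?c UNIV N (\<lambda>x. dev p (X x)) \<le> 1 / (4 * e\<^sup>2 * card N)"
    using marg[of "dev p" "{t. fst t}"] chebyshev_card[OF N p e] by (simp add: pair_weight_sums[unfolded Int_UNIV_left] X_def dev_def[abs_def])
  have 2: "texp ?c UNIV N (\<lambda>x. dev p (Y x)) \<le> 1 / (4 * e\<^sup>2 * card N)"
    using marg[of "dev p" "{t. snd t}"] chebyshev_card[OF N p e] by (simp add: pair_weight_sums[unfolded Int_UNIV_left] Y_def dev_def[abs_def])
  have "{i\<in>N. x i \<in> {t. fst t \<and> \<not> snd t}} = X x - Y x" for x
    by (auto simp: X_def Y_def)
  then have 3: "texp ?c UNIV N (\<lambda>x. dev \<tau> (X x - Y x)) \<le> 1 / (4 * e\<^sup>2 * card N)"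
    using marg[of "dev \<tau>" "{t. fst t \<and> \<not> snd t}"] chebyshev_card[OF N, of \<tau> e] \<tau> p e
    by (simp add: pair_weight_sums[unfolded Int_UNIV_left] dev_def[abs_def])
  have "{i\<in>N. x i \<in> {t. fst t \<and> snd t}} = X x \<inter> Y x" for x
    by (auto simp: X_def Y_def)
  \<comment> \<open>Disjointness for \<open>p = \<tau>\<close> has to hold exactly: the mean size of
    the intersection is then 0, and this size stands in for an indicator in the pointwise bound
    below.\<close>
  then have "texp ?c UNIV N (\<lambda>x. of_bool (p = \<tau>) * real (card (X x \<inter> Y x))) = of_bool (p = \<tau>) * ((p - \<tau>) * card N)"
    using marg[of "\<lambda>X. of_bool (p = \<tau>) * real (card X)" "{t. fst t \<and> snd t}"]
    by (simp add: pair_weight_sums[unfolded Int_UNIV_left] bexp_cmult bexp_card[OF N(1)])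
  then have 4: "texp ?c UNIV N (\<lambda>x. of_bool (p = \<tau>) * real (card (X x \<inter> Y x))) = 0"
    by simp
  have fin: "finite (X x \<inter> Y x)" for x
    using N by (simp add: X_def)
  have "1 - dev p (X x) - dev p (Y x) - dev \<tau> (X x - Y x) - of_bool (p = \<tau>) * real (card (X x \<inter> Y x))
      \<le> of_bool (balanced p \<tau> e N (X x) (Y x))" for x
  proof (cases "balanced p \<tau> e N (X x) (Y x)")
    case True
    have "0 \<le> dev p (X x)" "0 \<le> dev p (Y x)" "0 \<le> dev \<tau> (X x - Y x)" "0 \<le> of_bool (p = \<tau>) * real (card (X x \<inter> Y x))"
      by (auto simp: dev_def)
    moreover have "of_bool (balanced p \<tau> e N (X x) (Y x)) = (1 :: real)"
      using True by simp
    ultimately show ?thesis by linarith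
  next
    case False
    then have "dev p (X x) = 1 \<or> dev p (Y x) = 1 \<or> dev \<tau> (X x - Y x) = 1 \<or> 1 \<le> of_bool (p = \<tau>) * real (card (X x \<inter> Y x))"
      using fin[of x] by (auto simp: balanced_def dev_def not_le Suc_le_eq card_gt_0_iff)
    moreover have "0 \<le> dev p (X x)" "0 \<le> dev p (Y x)" "0 \<le> dev \<tau> (X x - Y x)" "0 \<le> of_bool (p = \<tau>) * real (card (X x \<inter> Y x))"
      by (auto simp: dev_def)
    moreover have "of_bool (balanced p \<tau> e N (X x) (Y x)) = (0 :: real)"
      using False by simp
    ultimately show ?thesis by linarith
  qed
  then have "texp ?c UNIV N (\<lambda>x. 1 - dev p (X x) - dev p (Y x) - dev \<tau> (X x - Y x) - of_bool (p = \<tau>) * real (card (X x \<inter> Y x)))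
      \<le> texp ?c UNIV N (\<lambda>x. of_bool (balanced p \<tau> e N (X x) (Y x)))"
    using \<tau> p by (intro texp_mono) (auto simp: pair_weight_def)
  moreover have "texp ?c UNIV N (\<lambda>x. 1) = 1"
    by (rule texp_const) (auto simp: pair_weight_sums N)
  ultimately have "1 - 3 * (1 / (4 * e\<^sup>2 * card N)) \<le> texp ?c UNIV N (\<lambda>x. of_bool (balanced p \<tau> e N (X x) (Y x)))"
    using 1 2 3 4 unfolding texp_diff by linarith
  then show ?thesis
    by (simp add: X_def Y_def)
qed

subsection \<open>From approximate to exact stars\<close>

text \<open>One mean, over random pairs and permutations, is estimated twice, with \<open>a\<close>
  and \<open>b\<close> the two densities. Any two sets inside a good pair overlap as
  \<open>sum_permutes_cluster\<close> requires, so the mean is at least \<open>a / (2 * d)\<close>.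
  For each permutation, expansion bounds it by \<open>sqrt a * b powr (r/2)\<close>. Averaging over
  permutations lets every pair of subsets contribute alike, whatever the shape of
  \<open>F\<close>.\<close>

lemma cross_density_bound:
  fixes N :: "'a set" and p \<tau> p0 r s :: real
  assumes N: "finite N" and d: "d \<ge> 1" and kl: "k \<le> card N" "l \<le> card N"
    and F: "\<And>A. A \<in> F \<Longrightarrow> A \<subseteq> N \<and> card A = k" and M: "\<And>B. B \<in> M \<Longrightarrow> B \<subseteq> N \<and> card B = l"
    and p: "0 < p0" "p0 \<le> p" "p \<le> 1 - p0" and r: "1 \<le> r" "r \<le> 2"
    and \<tau>: "0 \<le> \<tau>" "\<tau> \<le> p" "p + \<tau> \<le> 1" "(r - 1) / p0 \<le> \<tau> * (2 * (p * (1 - p)) - \<tau>)"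
    and good: "\<And>X Y. good X Y \<Longrightarrow> k \<le> card X \<and> l \<le> card Y"
      "\<And>X Y A B. good X Y \<Longrightarrow> A \<subseteq> X \<Longrightarrow> B \<subseteq> Y \<Longrightarrow> card A = k \<Longrightarrow> card B = l \<Longrightarrow>
        X \<subseteq> N \<Longrightarrow> Y \<subseteq> N \<Longrightarrow> k \<le> d * card (A - B) \<and> real (card (B - A) + k + 1) \<le> s"
    and half: "1 / 2 \<le> texp (pair_weight p \<tau>) UNIV N (\<lambda>x. of_bool (good {i\<in>N. fst (x i)} {i\<in>N. snd (x i)}))"
    and key: "\<And>A' B' C. A' \<in> F \<Longrightarrow> (\<And>j. j < d \<Longrightarrow> B' j \<subseteq> N \<and> card (B' j) = l \<and> B' j - A' = C) \<Longrightarrow>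
      (\<And>x. x \<in> A' \<Longrightarrow> \<exists>j<d. x \<notin> B' j) \<Longrightarrow> real (card C + k + 1) \<le> s \<Longrightarrow> \<exists>j<d. B' j \<in> M"
  shows "card F / (card N choose k) \<le> 4 * (real d)\<^sup>2 * (card M / (card N choose l)) powr r"
proof -
  let ?c = "pair_weight p \<tau>"
  define P where "P = {\<pi>. \<pi> permutes N}"
  define m where "m = real (card P)"
  define a where "a = card F / (card N choose k)"
  define b where "b = card M / (card N choose l)"
  define X where "X x = {i\<in>N. fst (x i)}" for x :: "'a \<Rightarrow> bool \<times> bool"
  define Y where "Y x = {i\<in>N. snd (x i)}" for x :: "'a \<Rightarrow> bool \<times> bool"
  define f where "f \<pi> = local_density k {A. A \<subseteq> N \<and> \<pi> ` A \<in> F}" for \<pi>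
  define g where "g \<pi> = local_density l {B. B \<subseteq> N \<and> \<pi> ` B \<in> M}" for \<pi>
  have finP: "finite P" unfolding P_def by (rule finite_permutations[OF N])
  have "id \<in> P" by (simp add: P_def permutes_id)
  then have m: "0 < m" using finP by (auto simp: m_def card_gt_0_iff)
  have ab: "0 \<le> a" "0 \<le> b" by (simp_all add: a_def b_def)
  have dpos: "0 < real d" using d by simp
  have choose_pos: "0 < real (card N choose k)" "0 < real (card N choose l)" using kl by auto
  have p': "0 \<le> p" "p \<le> 1" using p by auto
  have preimage_card: "card A = k" if "\<pi> permutes N" "\<pi> ` A \<in> F" for A \<pi>
    using F[OF that(2)] card_image[OF inj_on_subset[OF permutes_inj[OF that(1)]], of A] by simp
  have preimage_card': "card A = l" if "\<pi> permutes N" "\<pi> ` A \<in> M" for A \<pi>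
    using M[OF that(2)] card_image[OF inj_on_subset[OF permutes_inj[OF that(1)]], of A] by simp
  have mean_le: "bexp p N (local_density j {A. A \<subseteq> N \<and> \<pi> ` A \<in> G}) \<le> card G / (card N choose j)"
    if \<pi>: "\<pi> permutes N" and G: "\<And>A. A \<in> G \<Longrightarrow> A \<subseteq> N" and card_j: "\<And>A. \<pi> ` A \<in> G \<Longrightarrow> card A = j" and j: "j \<le> card N" for \<pi> G j
  proof -
    let ?G = "{A. A \<subseteq> N \<and> \<pi> ` A \<in> G}"
    have "real (card N choose j) * bexp p N (local_density j ?G) = real (card ?G) * bexp p N (\<lambda>X. of_bool (j \<le> card X))"
      using card_j by (intro bexp_local_density[OF N]) auto
    also have "\<dots> \<le> real (card ?G) * 1"
      using p' N by (intro mult_left_mono bexp_le_1) auto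
    also have "card ?G = card G"
      using G by (intro card_permutes_preimage[OF \<pi>]) auto
    finally show ?thesis
      using j by (simp add: pos_le_divide_eq mult.commute)
  qed
  have step1: "texp ?c UNIV N (\<lambda>x. f \<pi> (X x) * g \<pi> (Y x)) \<le> sqrt a * b powr (r/2)" if "\<pi> \<in> P" for \<pi>
  proof -
    have \<pi>: "\<pi> permutes N" using that by (simp add: P_def)
    have f01: "0 \<le> f \<pi> A" "f \<pi> A \<le> 1" and g01: "0 \<le> g \<pi> A" "g \<pi> A \<le> 1" if "A \<subseteq> N" for A
      unfolding f_def g_def using preimage_card[OF \<pi>] preimage_card'[OF \<pi>] finite_subset[OF that N]
      by (auto intro!: local_density_bounds)
    have "texp ?c UNIV N (\<lambda>x. f \<pi> (X x) * g \<pi> (Y x))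
        \<le> sqrt (bexp p N (\<lambda>A. (f \<pi> A)\<^sup>2)) * bexp p N (\<lambda>A. g \<pi> A powr (2/r)) powr (1/(2/r))"
      unfolding X_def Y_def
    proof (rule pair_tensor[OF p'])
      show "0 \<le> ?c t" for t using \<tau> p by (auto simp: pair_weight_def)
      fix F1 F0 G1 G0 :: real
      assume "0 \<le> F1" "0 \<le> F0" "0 \<le> G1" "0 \<le> G0"
      then show "?c (True, True) * (F1 * G1) + ?c (True, False) * (F1 * G0)
          + ?c (False, True) * (F0 * G1) + ?c (False, False) * (F0 * G0)
        \<le> sqrt (p * F1\<^sup>2 + (1 - p) * F0\<^sup>2) * (p * G1 powr (2/r) + (1 - p) * G0 powr (2/r)) powr (1/(2/r))"
        using two_point_pair[OF p r \<tau>(4)] by (simp add: pair_weight_def)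
    qed (use r N f01 g01 in auto)
    also have "\<dots> \<le> sqrt a * b powr (r/2)"
    proof -
      \<comment> \<open>Densities lie between 0 and 1, so powers with exponent at least 1 do not
        exceed them and the norms reduce to means.\<close>
      have "bexp p N (\<lambda>A. (f \<pi> A)\<^sup>2) \<le> bexp p N (f \<pi>)"
        using f01 by (intro bexp_mono p') (auto simp: power2_eq_square mult_left_le)
      also have "\<dots> \<le> a"
        unfolding f_def a_def using F preimage_card[OF \<pi>] kl by (intro mean_le \<pi>) auto
      finally have 1: "bexp p N (\<lambda>A. (f \<pi> A)\<^sup>2) \<le> a" .
      have "bexp p N (\<lambda>A. g \<pi> A powr (2/r)) \<le> bexp p N (g \<pi>)"
      proof (rule bexp_mono[OF p'])
        fix A assume "A \<subseteq> N"
        then show "g \<pi> A powr (2/r) \<le> g \<pi> A"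
          using g01[of A] r powr_mono'[of 1 "2/r" "g \<pi> A"] by auto
      qed
      also have "\<dots> \<le> b"
        unfolding g_def b_def using M preimage_card'[OF \<pi>] kl by (intro mean_le \<pi>) auto
      finally have 2: "bexp p N (\<lambda>A. g \<pi> A powr (2/r)) \<le> b" .
      have "bexp p N (\<lambda>A. g \<pi> A powr (2/r)) powr (1/(2/r)) \<le> b powr (1/(2/r))"
        using 2 r p' by (intro powr_mono2 bexp_nonneg) auto
      then show ?thesis
        using 1 ab by (intro mult_mono) auto
    qed
    finally show ?thesis .
  qed
  have step2: "m * a / d \<le> (\<Sum>\<pi>\<in>P. f \<pi> V * g \<pi> W)" if VW: "good V W" "V \<subseteq> N" "W \<subseteq> N" for V W
  proof -
    define S where "S = {A. A \<subseteq> V \<and> card A = k}"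
    define T where "T = {B. B \<subseteq> W \<and> card B = l}"
    have finVW: "finite V" "finite W" using VW N finite_subset by auto
    have S: "finite S" "card S = card V choose k" "0 < real (card V choose k)"
      using finVW n_subsets[of V k] good(1)[OF VW(1)] by (auto simp: S_def)
    have T: "finite T" "card T = card W choose l" "0 < real (card W choose l)"
      using finVW n_subsets[of W l] good(1)[OF VW(1)] by (auto simp: T_def)
    define C where "C = real (card V choose k) * real (card W choose l)"
    have C: "0 < C" using S T by (simp add: C_def)
    have fV: "f \<pi> V = (\<Sum>A\<in>S. of_bool (\<pi> ` A \<in> F)) / real (card V choose k)" if "\<pi> \<in> P" for \<pi>
    proof -
      have "{A \<in> {A. A \<subseteq> N \<and> \<pi> ` A \<in> F}. A \<subseteq> V} = S \<inter> {A. \<pi> ` A \<in> F}"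
        using VW preimage_card[of \<pi>] that by (auto simp: S_def P_def)
      then show ?thesis
        unfolding f_def local_density_def sum_of_bool_eq[OF S(1) S(1)] by (simp only:)
    qed
    have gW: "g \<pi> W = (\<Sum>B\<in>T. of_bool (\<pi> ` B \<in> M)) / real (card W choose l)" if "\<pi> \<in> P" for \<pi>
    proof -
      have "{A \<in> {A. A \<subseteq> N \<and> \<pi> ` A \<in> M}. A \<subseteq> W} = T \<inter> {A. \<pi> ` A \<in> M}"
        using VW preimage_card'[of \<pi>] that by (auto simp: T_def P_def)
      then show ?thesis
        unfolding g_def local_density_def sum_of_bool_eq[OF T(1) T(1)] by (simp only:)
    qed
    have avg: "m * a / d \<le> (\<Sum>\<pi>\<in>P. of_bool (\<pi> ` A \<in> F) * of_bool (\<pi> ` B \<in> M))"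
      if A: "A \<in> S" and B: "B \<in> T" for A B
    proof -
      have A': "A \<subseteq> N" "card A = k" "A \<subseteq> V" and B': "B \<subseteq> N" "card B = l" "B \<subseteq> W"
        using A B VW by (auto simp: S_def T_def)
      have "real (card N choose k) * (\<Sum>\<pi>\<in>P. of_bool (\<pi> ` A \<in> F)) = real (card F) * m"
        unfolding P_def m_def by (rule sum_permutes_image[OF N F A'(1,2)])
      then have "m * a = (\<Sum>\<pi>\<in>P. of_bool (\<pi> ` A \<in> F))"
        using choose_pos by (simp add: a_def field_simps)
      also have "\<dots> \<le> real d * (\<Sum>\<pi>\<in>P. of_bool (\<pi> ` A \<in> F) * of_bool (\<pi> ` B \<in> M))"
        unfolding P_def using good(2)[OF VW(1) A'(3) B'(3) A'(2) B'(2) VW(2,3)]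
        by (intro sum_permutes_cluster[OF N A'(1,2) B'(1,2) _ _ key]) auto
      finally show ?thesis
        using dpos by (simp add: field_simps)
    qed
    have "m * a / d = (\<Sum>A\<in>S. \<Sum>B\<in>T. m * a / d) / C"
      using C S T by (simp add: C_def)
    also have "\<dots> \<le> (\<Sum>A\<in>S. \<Sum>B\<in>T. \<Sum>\<pi>\<in>P. of_bool (\<pi> ` A \<in> F) * of_bool (\<pi> ` B \<in> M)) / C"
      using avg C by (intro divide_right_mono sum_mono) auto
    also have "(\<Sum>A\<in>S. \<Sum>B\<in>T. \<Sum>\<pi>\<in>P. of_bool (\<pi> ` A \<in> F) * of_bool (\<pi> ` B \<in> M) :: real)
        = (\<Sum>A\<in>S. \<Sum>\<pi>\<in>P. \<Sum>B\<in>T. of_bool (\<pi> ` A \<in> F) * of_bool (\<pi> ` B \<in> M))"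
      by (intro sum.cong refl sum.swap)
    also have "\<dots> = (\<Sum>\<pi>\<in>P. \<Sum>A\<in>S. \<Sum>B\<in>T. of_bool (\<pi> ` A \<in> F) * of_bool (\<pi> ` B \<in> M))"
      by (rule sum.swap)
    also have "\<dots> / C = (\<Sum>\<pi>\<in>P. f \<pi> V * g \<pi> W)"
    proof (subst sum_divide_distrib, rule sum.cong[OF refl])
      fix \<pi> assume \<pi>: "\<pi> \<in> P"
      have "(\<Sum>A\<in>S. \<Sum>B\<in>T. of_bool (\<pi> ` A \<in> F) * of_bool (\<pi> ` B \<in> M))
          = (\<Sum>A\<in>S. of_bool (\<pi> ` A \<in> F)) * (\<Sum>B\<in>T. of_bool (\<pi> ` B \<in> M) :: real)"
        by (rule sum_product[symmetric])
      then show "(\<Sum>A\<in>S. \<Sum>B\<in>T. of_bool (\<pi> ` A \<in> F) * of_bool (\<pi> ` B \<in> M)) / C = f \<pi> V * g \<pi> W"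
        unfolding fV[OF \<pi>] gW[OF \<pi>] C_def times_divide_times_eq by (simp only:)
    qed
    finally show ?thesis .
  qed
  have "m * a / d * (1 / 2) \<le> m * a / d * texp ?c UNIV N (\<lambda>x. of_bool (good (X x) (Y x)))"
    using half m ab dpos unfolding X_def Y_def by (intro mult_left_mono) auto
  also have "\<dots> = texp ?c UNIV N (\<lambda>x. m * a / d * of_bool (good (X x) (Y x)))"
    by (simp only: texp_cmult)
  also have "\<dots> \<le> texp ?c UNIV N (\<lambda>x. \<Sum>\<pi>\<in>P. f \<pi> (X x) * g \<pi> (Y x))"
  proof (rule texp_mono)
    show "0 \<le> ?c t" for t using \<tau> p by (auto simp: pair_weight_def)
    fix x
    have "0 \<le> (\<Sum>\<pi>\<in>P. f \<pi> (X x) * g \<pi> (Y x))"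
      unfolding f_def g_def local_density_def by (intro sum_nonneg) auto
    then show "m * a / d * of_bool (good (X x) (Y x)) \<le> (\<Sum>\<pi>\<in>P. f \<pi> (X x) * g \<pi> (Y x))"
      using step2[of "X x" "Y x"] by (cases "good (X x) (Y x)") (auto simp: X_def Y_def)
  qed
  also have "\<dots> = (\<Sum>\<pi>\<in>P. texp ?c UNIV N (\<lambda>x. f \<pi> (X x) * g \<pi> (Y x)))"
    by (rule texp_sum)
  also have "\<dots> \<le> (\<Sum>\<pi>\<in>P. sqrt a * b powr (r/2))"
    by (rule sum_mono) (rule step1)
  also have "\<dots> = m * (sqrt a * b powr (r/2))"
    by (simp add: m_def)
  finally have "m * (a / (2 * d)) \<le> m * (sqrt a * b powr (r/2))"
    by (simp add: mult_ac)
  then have "a / (2 * d) \<le> sqrt a * b powr (r/2)"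
    using m by (rule mult_left_le_imp_le)
  then have main: "sqrt a * sqrt a \<le> sqrt a * (2 * d * b powr (r/2))"
    using dpos ab by (simp add: field_simps)
  have "a \<le> 4 * (real d)\<^sup>2 * b powr r"
  proof (cases "a = 0")
    case False
    then have "0 < sqrt a" using ab by simp
    with main have "sqrt a \<le> 2 * d * b powr (r/2)"
      by (rule mult_left_le_imp_le)
    then have "(sqrt a)\<^sup>2 \<le> (2 * d * b powr (r/2))\<^sup>2"
      using ab by (intro power_mono) auto
    moreover have "(b powr (r/2))\<^sup>2 = b powr r"
      by (simp add: power2_eq_square flip: powr_add)
    ultimately show ?thesis
      using ab by (simp add: power_mult_distrib)
  qed simp
  then show ?thesis
    by (simp add: a_def b_def)
qed

lemma subsets_containing:
  assumes "i \<in> N" "finite N" "0 < k"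
  shows "{A. A \<subseteq> N \<and> card A = k \<and> i \<in> A} = insert i ` {B. B \<subseteq> N - {i} \<and> card B = k - 1}"
proof (intro equalityI subsetI)
  fix A assume "A \<in> {A. A \<subseteq> N \<and> card A = k \<and> i \<in> A}"
  then have "A = insert i (A - {i})" "A - {i} \<subseteq> N - {i}" "card (A - {i}) = k - 1"
    by auto
  then show "A \<in> insert i ` {B. B \<subseteq> N - {i} \<and> card B = k - 1}"
    by blast
next
  fix A assume "A \<in> insert i ` {B. B \<subseteq> N - {i} \<and> card B = k - 1}"
  then obtain B where B: "A = insert i B" "B \<subseteq> N - {i}" "card B = k - 1"
    by blast
  then have "card (insert i B) = Suc (card B)"
    using assms by (intro card_insert_disjoint) (auto dest: finite_subset)
  then show "A \<in> {A. A \<subseteq> N \<and> card A = k \<and> i \<in> A}"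
    using B assms by auto
qed

lemma star_eq: "star n k i = {A. A \<subseteq> {1..n} \<and> card A = k \<and> i \<in> A}"
  by (auto simp: star_def ksubsets_def)

lemma card_star:
  assumes "i \<in> {1..n}" "0 < k"
  shows "finite (star n k i)" "card (star n k i) = (n - 1) choose (k - 1)"
proof -
  let ?S = "{B. B \<subseteq> {1..n} - {i} \<and> card B = k - 1}"
  have star: "star n k i = insert i ` ?S"
    unfolding star_eq using assms by (intro subsets_containing) auto
  show "finite (star n k i)"
    unfolding star by auto
  have "inj_on (insert i) ?S"
    by (auto simp: inj_on_def)
  then have "card (star n k i) = card ?S"
    unfolding star by (rule card_image)
  also have "\<dots> = (n - 1) choose (k - 1)"
    using n_subsets[of "{1..n} - {i}" "k - 1"] assms by simp
  finally show "card (star n k i) = (n - 1) choose (k - 1)" .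
qed

text \<open>The densities of \<open>H\<close> and \<open>M\<close> satisfy
  \<open>b \<le> a / \<zeta>\<close>, as \<open>M\<close> is no larger than \<open>H\<close>, and
  \<open>a \<le> 4 * (real d)\<^sup>2 * b powr r\<close> by expansion. For
  \<open>0 < a \<le> \<epsilon>\<close> these would give \<open>a \<le> a / 2\<close>.\<close>

lemma star_if_large:
  fixes d :: nat and \<zeta> :: real
  assumes d: "d \<ge> 1" and \<zeta>: "0 < \<zeta>" "\<zeta> \<le> 1 / 2"
  shows "\<exists>n0::nat. \<forall>n k F. n > n0 \<longrightarrow>
           \<zeta> * real n \<le> real k \<longrightarrow>
           real k \<le> (real d / (real d + 1) - \<zeta>) * real n \<longrightarrow>
           F \<subseteq> ksubsets n k \<longrightarrow>
           \<not> contains_cluster F d (((real d + 1) / real d + \<zeta>) * real k) \<longrightarrow>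
           (n - 1) choose (k - 1) \<le> card F \<longrightarrow> is_star n k F"
proof -
  define c where "c = real d / (real d + 1)"
  define \<delta> where "\<delta> = \<zeta>\<^sup>2 / 16"
  define p0 where "p0 = \<zeta> / 2"
  \<comment> \<open>Product of the lower bounds \<open>\<zeta> / d\<close> for \<open>\<tau>\<close>
    and \<open>\<zeta> * (\<zeta> / 2)\<close> for \<open>2 * (p * (1 - p)) - \<tau>\<close>;
    \<open>r\<close> is then chosen to meet the condition of \<open>two_point_pair\<close>.\<close>
  define w where "w = \<zeta> / real d * (\<zeta> * (\<zeta> / 2))"
  define r where "r = 1 + min 1 (w * p0)"
  \<comment> \<open>This makes \<open>4 * (real d)\<^sup>2 / \<zeta>\<^sup>2 * \<epsilon> powr (r -
    1)\<close> equal to 1/2.\<close>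
  define \<epsilon> where "\<epsilon> = (\<zeta>\<^sup>2 / (8 * (real d)\<^sup>2)) powr (1 / (r - 1))"
  have dpos: "0 < real d" using d by simp
  have c: "0 < c" "c < 1" using d by (auto simp: c_def)
  have \<zeta>sq: "\<zeta>\<^sup>2 \<le> \<zeta> / 2"
    using \<zeta> by (simp add: power2_eq_square mult_left_le)
  have \<delta>: "0 < \<delta>" "16 * \<delta> \<le> \<zeta> / 2" using \<zeta> \<zeta>sq by (auto simp: \<delta>_def)
  have w: "0 < w" using \<zeta> dpos by (simp add: w_def)
  have p0: "0 < p0" using \<zeta> by (simp add: p0_def)
  have r: "1 < r" "r \<le> 2" "(r - 1) / p0 \<le> w"
  proof -
    show "1 < r" "r \<le> 2" using w p0 by (auto simp: r_def)
    have "r - 1 \<le> w * p0" by (simp add: r_def)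
    then show "(r - 1) / p0 \<le> w" using p0 by (simp add: pos_divide_le_eq)
  qed
  have \<epsilon>: "0 < \<epsilon>" "\<epsilon> powr (r - 1) = \<zeta>\<^sup>2 / (8 * (real d)\<^sup>2)"
    using \<zeta> dpos r by (auto simp: \<epsilon>_def powr_powr)
  obtain n1 where n1: "\<forall>n k F. n > n1 \<longrightarrow>
           \<zeta> * real n \<le> real k \<longrightarrow>
           real k \<le> (real d / (real d + 1) - \<zeta>) * real n \<longrightarrow>
           F \<subseteq> ksubsets n k \<longrightarrow>
           \<not> contains_cluster F d (((real d + 1) / real d + \<zeta>) * real k) \<longrightarrow>
           (n - 1) choose (k - 1) \<le> card F \<longrightarrow>
           (\<exists>i\<in>{1..n}. real (card {A\<in>F. i \<notin> A}) \<le> \<epsilon> * real ((n - 1) choose k))"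
    using close_to_star[OF d \<zeta> \<epsilon>(1)] by (rule exE)
  obtain n0 :: nat where n0: "real n1 + 2 + 3 / (2 * \<delta>\<^sup>2) + 2 / \<delta> < real n0"
    using reals_Archimedean2 by blast
  show ?thesis
  proof (intro exI[of _ n0] allI impI)
    fix n k :: nat and F
    assume n: "n > n0" and k: "\<zeta> * real n \<le> real k" "real k \<le> (real d / (real d + 1) - \<zeta>) * real n"
      and F: "F \<subseteq> ksubsets n k" and free: "\<not> contains_cluster F d (((real d + 1) / real d + \<zeta>) * real k)"
      and large: "(n - 1) choose (k - 1) \<le> card F"
    define s where "s = ((real d + 1) / real d + \<zeta>) * real k"
    have pos: "0 \<le> 3 / (2 * \<delta>\<^sup>2)" "0 \<le> 2 / \<delta>" "0 \<le> real n1"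
      using \<delta> by auto
    have nbig: "real n1 < real n" "2 \<le> real n" "3 / (2 * \<delta>\<^sup>2) \<le> real n - 1" "2 / \<delta> \<le> real n"
      using n n0 pos by linarith+
    have \<delta>n: "2 \<le> \<delta> * real n"
      using nbig(4) \<delta> by (simp add: field_simps)
    have npos: "0 < real n" using nbig by linarith
    define \<alpha> where "\<alpha> = real k / real n"
    have k_eq: "real k = \<alpha> * real n" using npos by (simp add: \<alpha>_def)
    have \<alpha>: "\<zeta> \<le> \<alpha>" "\<alpha> \<le> c - \<zeta>"
      using k npos by (auto simp: \<alpha>_def c_def field_simps)
    have kr: "0 < real k"
      using k(1) \<zeta> npos by (meson mult_pos_pos order_less_le_trans)
    then have kpos: "0 < k" by simp
    have kn: "k < n"
    proof -
      have "\<alpha> * real n < 1 * real n" using \<alpha> c \<zeta> npos by (intro mult_strict_right_mono) auto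
      then show ?thesis using k_eq by simp
    qed
    have "n > n1" using nbig(1) by simp
    from n1[rule_format, OF this k F free large]
    obtain i where i: "i \<in> {1..n}" and close: "real (card {A\<in>F. i \<notin> A}) \<le> \<epsilon> * real ((n - 1) choose k)"
      by blast
    define N where "N = {1..n} - {i}"
    define H where "H = {A\<in>F. i \<notin> A}"
    define M where "M = {B. B \<subseteq> N \<and> card B = k - 1 \<and> insert i B \<notin> F}"
    have N: "finite N" "card N = n - 1" "real (card N) = real n - 1" "N \<noteq> {}"
    proof -
      show "finite N" "card N = n - 1" using i by (auto simp: N_def)
      then show "real (card N) = real n - 1" using nbig by (simp add: of_nat_diff)
      then show "N \<noteq> {}" using nbig by auto
    qed
    have finF: "finite F"
      using F by (rule finite_subset) (simp add: ksubsets_def)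
    have HN: "A \<subseteq> N \<and> card A = k" if "A \<in> H" for A
      using that F by (auto simp: H_def N_def ksubsets_def)
    \<comment> \<open>\<open>M\<close> and \<open>R\<close> partition the
      \<open>(k - 1)\<close>-subsets of \<open>N\<close>, and at most \<open>card R\<close> members
      of \<open>F\<close> contain \<open>i\<close>; so each set missing from the star is made up for
      in \<open>H\<close>.\<close>
    have card_MH: "card M \<le> card H"
    proof -
      define R where "R = {B. B \<subseteq> N \<and> card B = k - 1 \<and> insert i B \<in> F}"
      have fin: "finite M" "finite R" using N by (auto simp: M_def R_def)
      have "M \<union> R = {B. B \<subseteq> N \<and> card B = k - 1}" "M \<inter> R = {}" by (auto simp: M_def R_def)
      then have "card M + card R = card {B. B \<subseteq> N \<and> card B = k - 1}"
        using card_Un_disjoint[OF fin] by simp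
      also have "\<dots> = (n - 1) choose (k - 1)"
        using n_subsets[OF N(1), of "k - 1"] N(2) by simp
      finally have MR: "card M + card R = (n - 1) choose (k - 1)" .
      have "{A\<in>F. i \<in> A} \<subseteq> insert i ` R"
      proof
        fix A assume A: "A \<in> {A\<in>F. i \<in> A}"
        then have "A \<in> {A. A \<subseteq> {1..n} \<and> card A = k \<and> i \<in> A}"
          using F by (auto simp: ksubsets_def)
        then obtain B where "A = insert i B" "B \<subseteq> N" "card B = k - 1"
          unfolding subsets_containing[OF i finite_atLeastAtMost kpos] N_def by blast
        then show "A \<in> insert i ` R" using A by (auto simp: R_def)
      qed
      then have "card {A\<in>F. i \<in> A} \<le> card R"
        using fin(2) by (rule surj_card_le[rotated])
      moreover have "F = H \<union> {A\<in>F. i \<in> A}" by (auto simp: H_def)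
      then have "card F \<le> card H + card {A\<in>F. i \<in> A}"
        by (metis card_Un_le)
      ultimately show ?thesis using large MR by linarith
    qed
    define p where "p = \<alpha> + 2 * \<delta>"
    \<comment> \<open>For \<open>d > 1\<close> the surplus \<open>6 * \<delta>\<close> outweighs the
      losses in \<open>good\<close>: \<open>\<delta>\<close> from \<open>X - Y\<close> and
      \<open>3 * \<delta>\<close> from \<open>X\<close>. For \<open>d = 1\<close> this value would
      exceed \<open>p\<close>, the largest admissible one.\<close>
    define \<tau> where "\<tau> = (if d = 1 then p else \<alpha> / real d + 6 * \<delta>)"
    have p: "p0 \<le> p" "p \<le> 1 - p0" "0 \<le> p" "p \<le> 1" "\<zeta> \<le> p"
      using \<alpha> c \<delta> \<zeta> by (auto simp: p_def p0_def)
    have \<alpha>d: "\<zeta> / real d \<le> \<alpha> / real d"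
      using \<alpha> dpos by (intro divide_right_mono) auto
    have \<tau>: "\<zeta> / real d \<le> \<tau>" "\<tau> \<le> p" "p + \<tau> \<le> 1 - \<zeta> / 2"
    proof -
      show "\<zeta> / real d \<le> \<tau>"
        using p \<alpha>d \<delta> by (auto simp: \<tau>_def)
      show "\<tau> \<le> p"
      proof (cases "d = 1")
        case False
        then have "2 \<le> real d" using d by simp
        then have "\<alpha> / real d \<le> \<alpha> / 2"
          using \<alpha> \<zeta> by (intro divide_left_mono) auto
        then show ?thesis
          using False \<alpha> \<delta> by (simp add: \<tau>_def p_def)
      qed (simp add: \<tau>_def)
      have "\<alpha> + \<alpha> / real d = \<alpha> * ((real d + 1) / real d)"
        using dpos by (simp add: field_simps)
      also have "\<dots> \<le> (c - \<zeta>) * ((real d + 1) / real d)"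
        using \<alpha> dpos by (intro mult_right_mono) auto
      also have "\<dots> = c * ((real d + 1) / real d) - \<zeta> * ((real d + 1) / real d)"
        by (rule left_diff_distrib)
      also have "c * ((real d + 1) / real d) = 1"
        using dpos by (simp add: c_def)
      also have "1 - \<zeta> * ((real d + 1) / real d) \<le> 1 - \<zeta> * 1"
        using dpos \<zeta> by (intro diff_left_mono mult_left_mono) auto
      finally have "\<alpha> + \<alpha> / real d \<le> 1 - \<zeta>" by simp
      then show "p + \<tau> \<le> 1 - \<zeta> / 2"
        using \<delta> by (auto simp: \<tau>_def p_def)
    qed
    have \<tau>0: "0 \<le> \<tau>" using \<tau>(1) \<zeta> dpos by (smt (verit) divide_pos_pos)
    have \<tau>w: "(r - 1) / p0 \<le> \<tau> * (2 * (p * (1 - p)) - \<tau>)"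
    proof -
      \<comment> \<open>The split below has a second term that alone is large enough, so
        \<open>\<tau> = p\<close> is covered too.\<close>
      have "\<zeta> * (\<zeta> / 2) \<le> p * (1 - p - \<tau>)"
        using p \<tau> \<zeta> by (intro mult_mono) auto
      also have "\<dots> \<le> (p - \<tau>) * (1 - p) + p * (1 - p - \<tau>)"
        using p \<tau> by simp
      also have "\<dots> = 2 * (p * (1 - p)) - \<tau>"
        by (simp add: algebra_simps)
      finally have "w \<le> \<tau> * (2 * (p * (1 - p)) - \<tau>)"
        unfolding w_def using \<tau> \<zeta> dpos \<tau>0 by (intro mult_mono) auto
      then show ?thesis using r(3) by linarith
    qed
    have half: "1 / 2 \<le> texp (pair_weight p \<tau>) UNIV N (\<lambda>x. of_bool (balanced p \<tau> \<delta> N {j\<in>N. fst (x j)} {j\<in>N. snd (x j)}))"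
    proof -
      have "3 \<le> 2 * \<delta>\<^sup>2 * real (card N)"
        using nbig(3) \<delta> unfolding N(3) by (simp add: field_simps)
      moreover have "0 < real (card N)" using N(3) nbig by simp
      ultimately have "3 / (4 * \<delta>\<^sup>2 * card N) \<le> 1 / 2"
        using \<delta> by (simp add: pos_divide_le_eq mult_ac)
      moreover have "p + \<tau> \<le> 1" using \<tau> \<zeta> by linarith
      ultimately show ?thesis
        using pair_balanced[OF N(1,4) p(3,4) \<tau>0 \<tau>(2) _ \<delta>(1)] by linarith
    qed
    have size: "k \<le> card X" if "\<bar>real (card X) - p * card N\<bar> \<le> \<delta> * card N" for X
    proof -
      have "(p - \<delta>) * card N \<le> real (card X)"
        using that by (simp add: algebra_simps abs_le_iff)
      moreover have "\<alpha> * real n \<le> (p - \<delta>) * card N"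
        using \<delta>n \<alpha> \<delta> c \<zeta> unfolding N(3) p_def by (simp add: algebra_simps)
      ultimately show ?thesis using k_eq by linarith
    qed
    have good: "k \<le> d * card (A - B) \<and> real (card (B - A) + k + 1) \<le> s"
      if bal: "balanced p \<tau> \<delta> N X Y" and AB: "A \<subseteq> X" "B \<subseteq> Y" "card A = k" "card B = k - 1" and XY: "X \<subseteq> N" "Y \<subseteq> N" for X Y A B
    proof -
      have fin: "finite X" "finite Y" "finite A" "finite B"
        using XY AB(1,2) finite_subset[OF _ N(1)] by (auto dest: subset_trans)
      have cA: "card (A - B) + card (A \<inter> B) = k"
        using card_Int_Diff[OF fin(3), of B] AB by simp
      have cB: "card (B - A) + card (A \<inter> B) + 1 = k"
        using card_Int_Diff[OF fin(4), of A] AB kpos by (simp add: Int_commute)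
      have cBA: "card (B - A) + k + 1 = card (A - B) + k"
        using cA cB by linarith
      show ?thesis
      proof (cases "d = 1")
        case True
        then have "X \<inter> Y = {}" using bal by (simp add: balanced_def \<tau>_def)
        then have "A \<inter> B = {}" using AB by auto
        then have cAB: "card (A - B) = k" using cA by simp
        have "real (k + k) \<le> s"
          unfolding s_def True using kr \<zeta> by (simp add: algebra_simps)
        then show ?thesis using cAB cBA True by simp
      next
        case False
        have X: "real (card X) \<le> (p + \<delta>) * card N" and Y: "real (card Y) \<le> (p + \<delta>) * card N"
          and D: "(\<tau> - \<delta>) * card N \<le> real (card (X - Y))" "real (card (X - Y)) \<le> (\<tau> + \<delta>) * card N"
          using bal by (auto simp: balanced_def abs_le_iff algebra_simps)
        have \<tau>_eq: "\<tau> = \<alpha> / real d + 6 * \<delta>" using False by (simp add: \<tau>_def)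
        \<comment> \<open>Of the points of \<open>X - Y\<close>, at most \<open>card X - k\<close>
          lie outside \<open>A\<close>; the others belong to \<open>A - B\<close>.\<close>
        have "card (X - Y) \<le> card ((A - B) \<union> (X - A))"
          using fin AB by (intro card_mono) auto
        also have "\<dots> \<le> card (A - B) + card (X - A)" by (rule card_Un_le)
        also have "card (X - A) = card X - k" using AB fin by (simp add: card_Diff_subset)
        finally have "real (card (X - Y)) \<le> real (card (A - B)) + (real (card X) - real k)"
          using card_mono[OF fin(1) AB(1)] AB(3) by linarith
        then have "(\<tau> - \<delta>) * card N - (p + \<delta>) * card N + real k \<le> real (card (A - B))"
          using X D by linarith
        moreover have "(\<alpha> - \<alpha> / real d - 2 * \<delta>) * card N \<le> (\<alpha> - \<alpha> / real d) * real n"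
        proof -
          have "(\<alpha> - \<alpha> / real d - 2 * \<delta>) * card N \<le> (\<alpha> - \<alpha> / real d) * card N"
            using \<delta> by (intro mult_right_mono) auto
          also have "\<dots> \<le> (\<alpha> - \<alpha> / real d) * real n"
          proof (rule mult_left_mono)
            have "\<alpha> / real d \<le> \<alpha> / 1" using d \<alpha> \<zeta> by (intro divide_left_mono) auto
            then show "0 \<le> \<alpha> - \<alpha> / real d" by simp
          qed (use N in simp)
          finally show ?thesis .
        qed
        moreover have "(\<alpha> - \<alpha> / real d) * real n = real k - real k / real d"
          unfolding k_eq by (simp add: algebra_simps)
        ultimately have "real k / real d \<le> real (card (A - B))"
          unfolding \<tau>_eq p_def by (simp add: algebra_simps)
        then have "real k \<le> real (d * card (A - B))"
          using dpos by (simp add: pos_divide_le_eq mult.commute)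
        then have 1: "k \<le> d * card (A - B)" by linarith
        \<comment> \<open>Conversely, a point of \<open>A - B\<close> lies in \<open>X - Y\<close>
          or in \<open>Y - B\<close>, and \<open>Y\<close> is only slightly larger than
          \<open>B\<close>.\<close>
        have "card (A - B) \<le> card ((X - Y) \<union> (Y - B))"
          using fin AB by (intro card_mono) auto
        also have "\<dots> \<le> card (X - Y) + card (Y - B)" by (rule card_Un_le)
        also have "card (Y - B) = card Y - (k - 1)" using AB fin by (simp add: card_Diff_subset)
        finally have "real (card (A - B)) \<le> real (card (X - Y)) + (real (card Y) - (real k - 1))"
          using card_mono[OF fin(2) AB(2)] AB(4) kpos by linarith
        then have "real (card (A - B)) \<le> (\<tau> + \<delta>) * card N + (p + \<delta>) * card N - real k + 1"
          using Y D by linarith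
        also have "(\<tau> + \<delta>) * card N + (p + \<delta>) * card N = (\<alpha> / real d + \<alpha> + 10 * \<delta>) * card N"
          unfolding \<tau>_eq p_def by (simp add: algebra_simps)
        also have "\<dots> \<le> (\<alpha> / real d + \<alpha> + 10 * \<delta>) * real n"
          using \<alpha> \<zeta> \<delta> N by (intro mult_left_mono) auto
        also have "\<dots> = real k / real d + real k + 10 * \<delta> * real n"
          unfolding k_eq by (simp add: algebra_simps)
        finally have "real (card (A - B)) \<le> real k / real d + 10 * \<delta> * real n + 1" by simp
        \<comment> \<open>The value of \<open>\<delta>\<close> comes from here:
          \<open>10 * \<delta> * n + 1\<close> has to fit below \<open>\<zeta> * k\<close>.\<close>
        moreover have "16 * \<delta> * real n \<le> \<zeta> * real k"
          using mult_left_mono[OF k(1), of \<zeta>] \<zeta> by (simp add: \<delta>_def power2_eq_square mult.assoc)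
        ultimately have "real (card (A - B)) + real k \<le> real k / real d + \<zeta> * real k + real k"
          using \<delta>n by linarith
        also have "\<dots> = s"
          unfolding s_def using dpos by (simp add: field_simps)
        finally show ?thesis
          using 1 cBA by simp
      qed
    qed
    have key: "\<exists>j<d. B j \<in> M" if A: "A \<in> H" and B: "\<And>j. j < d \<Longrightarrow> B j \<subseteq> N \<and> card (B j) = k - 1 \<and> B j - A = C"
      and empty: "\<And>x. x \<in> A \<Longrightarrow> \<exists>j<d. x \<notin> B j" and small: "real (card C + k + 1) \<le> s" for A B C
    proof (rule ccontr)
      assume "\<not> ?thesis"
      then have BF: "insert i (B j) \<in> F" if "j < d" for j
        using B[OF that] that by (auto simp: M_def)
      \<comment> \<open>Index 0 carries \<open>A\<close>, followed by the \<open>d\<close> sets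
        through \<open>i\<close>. As \<open>A\<close> misses \<open>i\<close>, inserting it into the
        others creates no common point.\<close>
      define Z where "Z j = (case j of 0 \<Rightarrow> A | Suc j \<Rightarrow> insert i (B j))" for j
      have AF: "A \<in> F" "i \<notin> A" "card A = k" "finite A"
        using A HN[OF A] N(1) by (auto simp: H_def intro: finite_subset)
      have "\<forall>j\<le>d. Z j \<in> F"
        using AF BF by (auto simp: Z_def split: nat.split)
      moreover have "(\<Inter>j\<le>d. Z j) = {}"
      proof (rule equals0I)
        fix x assume x: "x \<in> (\<Inter>j\<le>d. Z j)"
        then have "x \<in> Z 0" by blast
        then have xA: "x \<in> A" by (simp add: Z_def)
        then obtain j where j: "j < d" "x \<notin> B j" using empty by blast
        have "x \<in> Z (Suc j)" using x j by (auto simp: Suc_le_eq)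
        then have "x = i" using j by (simp add: Z_def)
        then show False using xA AF by simp
      qed
      moreover have "real (card (\<Union>j\<le>d. Z j)) \<le> s"
      proof -
        have "B 0 - A = C" "finite (B 0)"
          using B[of 0] d N(1) by (auto intro: finite_subset)
        then have finC: "finite C" by auto
        have "(\<Union>j\<le>d. Z j) \<subseteq> insert i (A \<union> C)"
          using B by (force simp: Z_def Suc_le_eq split: nat.splits)
        then have "card (\<Union>j\<le>d. Z j) \<le> card (insert i (A \<union> C))"
          using AF finC by (intro card_mono) auto
        also have "\<dots> \<le> Suc (card (A \<union> C))"
          using AF finC by (simp add: card_insert_if)
        also have "\<dots> \<le> card C + k + 1"
          using card_Un_le[of A C] AF by simp
        finally show ?thesis using small by linarith
      qed
      ultimately show False
        using free unfolding contains_cluster_def s_def by blast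
    qed
    define a where "a = card H / (card N choose k)"
    define b where "b = card M / (card N choose (k - 1))"
    have bound: "a \<le> 4 * (real d)\<^sup>2 * b powr r"
      unfolding a_def b_def
    proof (rule cross_density_bound[where good = "balanced p \<tau> \<delta> N" and p = p and \<tau> = \<tau> and p0 = p0 and s = s])
      show "k \<le> card X \<and> k - 1 \<le> card Y" if "balanced p \<tau> \<delta> N X Y" for X Y
        using that size[of X] size[of Y] by (auto simp: balanced_def)
      show "k \<le> d * card (A - B) \<and> real (card (B - A) + k + 1) \<le> s"
        if "balanced p \<tau> \<delta> N X Y" "A \<subseteq> X" "B \<subseteq> Y" "card A = k" "card B = k - 1" "X \<subseteq> N" "Y \<subseteq> N" for X Y A B
        using that by (rule good)
      show "\<exists>j<d. B j \<in> M" if "A \<in> H" "\<And>j. j < d \<Longrightarrow> B j \<subseteq> N \<and> card (B j) = k - 1 \<and> B j - A = C"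
        "\<And>x. x \<in> A \<Longrightarrow> \<exists>j<d. x \<notin> B j" "real (card C + k + 1) \<le> s" for A B C
        using that by (rule key)
      show "p + \<tau> \<le> 1" using \<tau>(3) \<zeta> by linarith
    qed (use N kn d p p0 r \<tau> \<tau>0 \<tau>w half HN in \<open>auto simp: M_def\<close>)
    have chk: "0 < real (card N choose k)" "0 < real (card N choose (k - 1))"
      using kn N by auto
    \<comment> \<open>Equal sizes are not equal densities: \<open>M\<close> lies one level lower,
      and by \<open>k \<ge> \<zeta> * n\<close> that level has at least \<open>\<zeta>\<close> times
      as many sets.\<close>
    have ba: "b \<le> a / \<zeta>"
    proof -
      have "real k * real (n choose k) = real n * real ((n - 1) choose (k - 1))"
        using times_binomial_minus1_eq[OF kpos, of n] by (simp flip: of_nat_mult)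
      moreover have "real ((n - 1) choose k) \<le> real (n choose k)"
        using choose_reduce_nat[of n k] kpos kn by simp
      ultimately have "real k * real ((n - 1) choose k) \<le> real n * real ((n - 1) choose (k - 1))"
        using kr by (metis mult_left_mono of_nat_0_le_iff)
      moreover have "\<zeta> * real n * real ((n - 1) choose k) \<le> real k * real ((n - 1) choose k)"
        using k by (intro mult_right_mono) auto
      ultimately have "real n * (\<zeta> * real ((n - 1) choose k)) \<le> real n * real ((n - 1) choose (k - 1))"
        by (simp add: algebra_simps)
      then have C: "\<zeta> * real ((n - 1) choose k) \<le> real ((n - 1) choose (k - 1))"
        using npos by simp
      have "b \<le> card H / (card N choose (k - 1))"
        unfolding b_def using card_MH by (intro divide_right_mono) auto
      also have "\<dots> \<le> card H / (\<zeta> * (card N choose k))"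
        using C chk \<zeta> unfolding N(2) by (intro divide_left_mono) auto
      finally show ?thesis by (simp add: a_def mult.commute)
    qed
    have a\<epsilon>: "a \<le> \<epsilon>"
      using close chk unfolding a_def H_def N(2) by (simp add: pos_divide_le_eq)
    have a0: "0 \<le> a" by (simp add: a_def)
    have "a = 0"
    proof (rule ccontr)
      assume "a \<noteq> 0"
      then have apos: "0 < a" using a0 by simp
      have "b powr r \<le> (a / \<zeta>) powr r"
        using ba r by (intro powr_mono2) (auto simp: b_def)
      also have "\<dots> = a powr r * (1 / \<zeta>) powr r"
        using apos \<zeta> by (simp add: powr_mult[symmetric])
      also have "\<dots> \<le> a powr r * (1 / \<zeta>) powr 2"
        using r \<zeta> by (intro mult_left_mono powr_mono) auto
      also have "a powr r = a * a powr (r - 1)"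
        using apos by (simp add: powr_diff)
      also have "a * a powr (r - 1) * (1 / \<zeta>) powr 2 \<le> a * \<epsilon> powr (r - 1) * (1 / \<zeta>) powr 2"
        using apos a\<epsilon> r by (intro mult_right_mono mult_left_mono powr_mono2) auto
      also have "\<dots> = a / (8 * (real d)\<^sup>2)"
        unfolding \<epsilon>(2) using \<zeta> by (simp add: power_divide field_simps)
      finally have "4 * (real d)\<^sup>2 * b powr r \<le> 4 * (real d)\<^sup>2 * (a / (8 * (real d)\<^sup>2))"
        by (intro mult_left_mono) auto
      also have "\<dots> = a / 2"
        using dpos by simp
      finally show False using bound apos by linarith
    qed
    then have "card H = 0" using chk by (simp add: a_def)
    moreover have "finite H" using finF by (simp add: H_def)
    ultimately have "H = {}" by simp
    then have "F \<subseteq> star n k i"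
      using F by (auto simp: H_def star_def)
    then have "F = star n k i"
      using card_star[OF i kpos] large by (intro card_seteq) auto
    then show "is_star n k F"
      using i by (auto simp: is_star_def)
  qed
qed

theorem theorem1p1:
  fixes d :: nat and \<zeta> :: real
  assumes "d \<ge> 1" and "\<zeta> > 0"
  shows "\<exists>n0::nat. \<forall>n k F. n > n0 \<longrightarrow>
           \<zeta> * real n \<le> real k \<longrightarrow>
           real k \<le> (real d / (real d + 1) - \<zeta>) * real n \<longrightarrow>
           F \<subseteq> ksubsets n k \<longrightarrow>
           \<not> contains_cluster F d (((real d + 1) / real d + \<zeta>) * real k) \<longrightarrow>
           card F \<le> (n - 1) choose (k - 1) \<and>
           (card F = (n - 1) choose (k - 1) \<longleftrightarrow> is_star n k F)"
proof (cases "\<zeta> \<le> 1 / 2")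
  case True
  obtain n0 where n0: "\<forall>n k F. n > n0 \<longrightarrow>
           \<zeta> * real n \<le> real k \<longrightarrow>
           real k \<le> (real d / (real d + 1) - \<zeta>) * real n \<longrightarrow>
           F \<subseteq> ksubsets n k \<longrightarrow>
           \<not> contains_cluster F d (((real d + 1) / real d + \<zeta>) * real k) \<longrightarrow>
           (n - 1) choose (k - 1) \<le> card F \<longrightarrow> is_star n k F"
    using star_if_large[OF assms True] by (rule exE)
  show ?thesis
  proof (intro exI[of _ n0] allI impI)
    fix n k :: nat and F
    assume *: "n > n0" "\<zeta> * real n \<le> real k" "real k \<le> (real d / (real d + 1) - \<zeta>) * real n"
      "F \<subseteq> ksubsets n k" "\<not> contains_cluster F d (((real d + 1) / real d + \<zeta>) * real k)"
    have "0 < \<zeta> * real n" using assms *(1) by simp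
    then have k: "0 < k" using *(2) by (metis gr0I not_less of_nat_0)
    have star: "card F = (n - 1) choose (k - 1)" if "is_star n k F"
      using that card_star(2)[OF _ k] by (auto simp: is_star_def)
    \<comment> \<open>A family above the bound would thus be a star, whose size is the bound itself;
      this settles inequality and equality together.\<close>
    have large: "is_star n k F" if "(n - 1) choose (k - 1) \<le> card F"
      using n0[rule_format, OF * that] .
    show "card F \<le> (n - 1) choose (k - 1) \<and> (card F = (n - 1) choose (k - 1) \<longleftrightarrow> is_star n k F)"
      using star large by (cases "(n - 1) choose (k - 1) \<le> card F") auto
  qed
next
  case False
  \<comment> \<open>The bounds on \<open>k\<close> would give
    \<open>2 * \<zeta> \<le> d / (d + 1) < 1\<close>.\<close>
  have vacuous: "\<not> real k \<le> (real d / (real d + 1) - \<zeta>) * real n" if "n > 0" "\<zeta> * real n \<le> real k" for n k :: nat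
  proof
    assume "real k \<le> (real d / (real d + 1) - \<zeta>) * real n"
    then have "\<zeta> * real n \<le> (real d / (real d + 1) - \<zeta>) * real n" using that by linarith
    then have "\<zeta> \<le> real d / (real d + 1) - \<zeta>" using that by simp
    moreover have "real d / (real d + 1) < 1" by simp
    ultimately show False using False by linarith
  qed
  show ?thesis
    using vacuous by blast
qed

end
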